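(* Let $\mathcal C$ be a class of topological semigroups containing all $0$-discrete Hausdorff topological semigroups and all compact Hausdorff topological semigroups. Let $X$ be an injectively $\mathcal C$-closed subsemigroup of a compact Hausdorff topological semigroup. (1) If $\mathrm{cov}(\mathcal M)=\mathfrak c$, then $X$ is polybounded. (2) If $\mathrm{cov}(\overline{\mathcal N})=\mathfrak c$, then $X$ is polyfinite.
   Context: $\mathfrak c$ is the cardinality of the continuum, $\mathrm{cov}(\mathcal M)$ is the smallest cardinality of a cover of the real line by meager sets, and $\mathrm{cov}(\overline{\mathcal N})$ is the smallest cardinality of a cover of the real line by closed subsets of Lebesgue measure zero. A topological semigroup is a semigroup with a topology making the binary operation continuous. A topological semigroup $X$ is $0$-discrete if $X$ has a unique non-isolated point $0\in X$ and $0x=0=x0$ for all $x\in X$. For a class $\mathcal C$ of topological semigroups, a semigroup $X$ is injectively $\mathcal C$-closed if for any injective homomorphism $h:X\to Y$ to a topological semigroup $Y\in\mathcal C$ the image $h[X]$ is closed in $Y$ (no continuity of $h$ is required: $X$ is regarded as an abstract semigroup). For a semigroup $X$, $X^1=X\cup\{1\}$, where $1\notin X$ is a new element with $1x=x=x1$ for every $x\in X^1$. A semigroup polynomial on $X$ is a function $f:X\to X$ of the form $f(x)=a_0xa_1x\cdots xa_n$ for some integer $n\ge 1$ and some $a_0,\dots,a_n\in X^1$; $n$ is its degree. A semigroup $X$ is polybounded if $X$ is the union of finitely many sets of the form $f^{-1}(b)$, where $b\in X$ and $f$ is a semigroup polynomial on $X$. A semigroup $X$ is polyfinite if there exist $n\in\mathbb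 N$ and a finite set $F\subseteq X$ such that for any $x,y\in X$ there exists a semigroup polynomial $f:X\to X$ of degree $\le n$ with $\{f(x),f(y)\}\subseteq F$. *)

theory Defs
  imports "HOL-Analysis.Analysis"
begin

unbundle cardinal_syntax

section \<open>Covering numbers\<close>

definition nowhere_dense :: "'a::topological_space set \<Rightarrow> bool" where
  "nowhere_dense A \<longleftrightarrow> interior (closure A) = {}"

definition meager :: "'a::topological_space set \<Rightarrow> bool" where
  "meager A \<longleftrightarrow> (\<exists>\<N>. countable \<N> \<and> (\<forall>N\<in>\<N>. nowhere_dense N) \<and> A = \<Union>\<N>)"

definition cover_by :: "'a set set \<Rightarrow> 'a set set \<Rightarrow> bool" where
  "cover_by \<I> \<A> \<longleftrightarrow> \<A> \<subseteq> \<I> \<and> \<Union>\<A> = UNIV"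

text \<open>
  The least cardinality of a cover by members of \<open>\<I>\<close>, as a cardinal in the sense of the
  library, i.e. up to \<open>=o\<close>.  It is meaningful only if \<open>\<I>\<close> covers the type; see
  \<open>cov_attained\<close> and \<open>cov_least\<close> below.
\<close>
definition cov :: "'a set set \<Rightarrow> 'a set rel" where
  "cov \<I> = |SOME \<A>. cover_by \<I> \<A> \<and> (\<forall>\<B>. cover_by \<I> \<B> \<longrightarrow> |\<A>| \<le>o |\<B>| )|"

lemma cov_minimal_cover_ex:
  assumes "\<Union>\<I> = UNIV"
  shows "\<exists>\<A>. cover_by \<I> \<A> \<and> (\<forall>\<B>. cover_by \<I> \<B> \<longrightarrow> |\<A>| \<le>o |\<B>| )"
proof -
  let ?R = "card_of ` {\<A>. cover_by \<I> \<A>}"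
  have "?R \<noteq> {}" using assms by (auto simp: cover_by_def)
  moreover have "\<forall>r\<in>?R. Card_order r" by (auto simp: card_of_Card_order)
  ultimately obtain r where "r \<in> ?R" "\<forall>r'\<in>?R. r \<le>o r'"
    using exists_minim_Card_order[of ?R] by blast
  then show ?thesis by blast
qed

lemma cov_attained:
  assumes "\<Union>\<I> = UNIV"
  shows "\<exists>\<A>. cover_by \<I> \<A> \<and> cov \<I> = |\<A>|"
  unfolding cov_def using someI_ex[OF cov_minimal_cover_ex[OF assms]] by blast

lemma cov_least:
  assumes "cover_by \<I> \<B>"
  shows "cov \<I> \<le>o |\<B>|"
proof -
  have "\<Union>\<I> = UNIV" using assms unfolding cover_by_def by blast
  from someI_ex[OF cov_minimal_cover_ex[OF this]] assms show ?thesis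
    unfolding cov_def by blast
qed

definition meager_sets :: "real set set" where
  "meager_sets = {A. meager A}"

definition closed_null_sets :: "real set set" where
  "closed_null_sets = {A. closed A \<and> A \<in> null_sets lebesgue}"

definition continuum :: "real rel" where
  "continuum = |UNIV :: real set|"


section \<open>Topological semigroups\<close>

text \<open>
  Semigroups are given by a carrier set and an operation whose values outside the carrier are
  irrelevant; a topological semigroup is a pair \<open>(T, m)\<close> with carrier \<open>topspace T\<close>.
  Carriers may be empty.
\<close>
definition semigroup_on :: "'a set \<Rightarrow> ('a \<Rightarrow> 'a \<Rightarrow> 'a) \<Rightarrow> bool" where
  "semigroup_on X m \<longleftrightarrow>
     (\<forall>x\<in>X. \<forall>y\<in>X. m x y \<in> X) \<and>
     (\<forall>x\<in>X. \<forall>y\<in>X. \<forall>z\<in>X. m (m x y) z = m x (m y z))"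

definition subsemigroup :: "'a set \<Rightarrow> 'a set \<Rightarrow> ('a \<Rightarrow> 'a \<Rightarrow> 'a) \<Rightarrow> bool" where
  "subsemigroup X S m \<longleftrightarrow> X \<subseteq> S \<and> (\<forall>x\<in>X. \<forall>y\<in>X. m x y \<in> X)"

type_synonym 'a top_semigroup = "'a topology \<times> ('a \<Rightarrow> 'a \<Rightarrow> 'a)"

fun topological_semigroup :: "'a top_semigroup \<Rightarrow> bool" where
  "topological_semigroup (T, m) \<longleftrightarrow>
     semigroup_on (topspace T) m \<and>
     continuous_map (prod_topology T T) T (\<lambda>(x, y). m x y)"

fun Hausdorff_semigroup :: "'a top_semigroup \<Rightarrow> bool" where
  "Hausdorff_semigroup (T, m) \<longleftrightarrow> topological_semigroup (T, m) \<and> Hausdorff_space T"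

fun compact_Hausdorff_semigroup :: "'a top_semigroup \<Rightarrow> bool" where
  "compact_Hausdorff_semigroup (T, m) \<longleftrightarrow> Hausdorff_semigroup (T, m) \<and> compact_space T"

fun zero_discrete :: "'a top_semigroup \<Rightarrow> bool" where
  "zero_discrete (T, m) \<longleftrightarrow>
     topological_semigroup (T, m) \<and>
     (\<exists>z. {x \<in> topspace T. \<not> openin T {x}} = {z} \<and>
          (\<forall>x\<in>topspace T. m z x = z \<and> m x z = z))"

text \<open>
  In the theorem \<open>'a\<close> and \<open>'b\<close> coincide and play the role of a universe: the class
  \<open>\<C>\<close> ranges over semigroups whose carriers are arbitrary subsets of that type.  Testing
  closedness against fewer targets only weakens the hypothesis on \<open>X\<close>.

  No continuity of \<open>h\<close> is required: \<open>X\<close> is an abstract semigroup.\<close>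
definition injectively_closed ::
    "'b top_semigroup set \<Rightarrow> 'a set \<Rightarrow> ('a \<Rightarrow> 'a \<Rightarrow> 'a) \<Rightarrow> bool" where
  "injectively_closed \<C> X m \<longleftrightarrow>
     (\<forall>(T, n)\<in>\<C>. \<forall>h. h ` X \<subseteq> topspace T \<and> inj_on h X \<and>
        (\<forall>x\<in>X. \<forall>y\<in>X. h (m x y) = n (h x) (h y)) \<longrightarrow> closedin T (h ` X))"


section \<open>Semigroup polynomials\<close>

text \<open>The semigroup \<open>X\<^sup>1\<close>, with \<open>None\<close> as the adjoined unit.\<close>
definition adjoin_one :: "'a set \<Rightarrow> 'a option set" where
  "adjoin_one X = insert None (Some ` X)"

fun mult_one :: "('a \<Rightarrow> 'a \<Rightarrow> 'a) \<Rightarrow> 'a option \<Rightarrow> 'a option \<Rightarrow> 'a option" where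
  "mult_one m None y = y"
| "mult_one m x None = x"
| "mult_one m (Some x) (Some y) = Some (m x y)"

text \<open>The product \<open>a\<^sub>0 x a\<^sub>1 x \<dots> x a\<^sub>n\<close>, computed in \<open>X\<^sup>1\<close>.\<close>
primrec poly_word ::
    "('a \<Rightarrow> 'a \<Rightarrow> 'a) \<Rightarrow> (nat \<Rightarrow> 'a option) \<Rightarrow> nat \<Rightarrow> 'a \<Rightarrow> 'a option" where
  "poly_word m a 0 x = a 0"
| "poly_word m a (Suc n) x = mult_one m (mult_one m (poly_word m a n x) (Some x)) (a (Suc n))"

definition semigroup_polynomial ::
    "'a set \<Rightarrow> ('a \<Rightarrow> 'a \<Rightarrow> 'a) \<Rightarrow> nat \<Rightarrow> ('a \<Rightarrow> 'a) \<Rightarrow> bool" where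
  "semigroup_polynomial X m n f \<longleftrightarrow>
     n \<ge> 1 \<and>
     (\<exists>a. (\<forall>i\<le>n. a i \<in> adjoin_one X) \<and> (\<forall>x\<in>X. poly_word m a n x = Some (f x)))"

definition polybounded :: "'a set \<Rightarrow> ('a \<Rightarrow> 'a \<Rightarrow> 'a) \<Rightarrow> bool" where
  "polybounded X m \<longleftrightarrow>
     (\<exists>\<F>. finite \<F> \<and> X = \<Union>\<F> \<and>
        (\<forall>A\<in>\<F>. \<exists>n f b. semigroup_polynomial X m n f \<and> b \<in> X \<and> A = {x \<in> X. f x = b}))"

definition polyfinite :: "'a set \<Rightarrow> ('a \<Rightarrow> 'a \<Rightarrow> 'a) \<Rightarrow> bool" where
  "polyfinite X m \<longleftrightarrow>
     (\<exists>n F. finite F \<and> F \<subseteq> X \<and>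
        (\<forall>x\<in>X. \<forall>y\<in>X. \<exists>k f. k \<le> n \<and> semigroup_polynomial X m k f \<and> {f x, f y} \<subseteq> F))"

end

theory Submission
  imports Defs "HOL-Complex_Analysis.Great_Picard"
begin

text \<open>
  \<open>X\<close> is closed in the compact semigroup, hence itself compact, so it has an idempotent \<open>e\<close> in a
  minimal left ideal, and \<open>H = e X e\<close> is a compact group.  Since \<open>x \<mapsto> f (e x e)\<close> is a polynomial on
  \<open>X\<close> for every polynomial \<open>f\<close> on \<open>H\<close>, it suffices to find suitable polynomials on \<open>H\<close>:

  \<^item> for polyboundedness, one \<open>f\<close> whose fibre \<open>{f = b}\<close> contains a nonempty open set, because finitely
    many translates of the fibre then cover \<open>H\<close>;
  \<^item> for polyfiniteness, one \<open>f\<close> such that for every \<open>z\<close> the fibre \<open>A = {f = b}\<close> meets \<open>z\<^sup>j A\<close> for some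
    positive \<open>j \<le> N\<close>; applied to \<open>z = y x\<^sup>-\<^sup>1\<close> this yields a polynomial mapping both \<open>x\<close> and \<open>y\<close> to
    \<open>e\<close>.

  If the conclusion fails, compactness of the space of coefficients shows that countably many
  continuous functions witness the failure, and these give a continuous pseudometric \<open>D\<close> on \<open>X\<close>,
  subinvariant under all translations, modulo which the conclusion still fails.  Modulo \<open>D\<close> there are
  at most continuum many points, so a transfinite construction along them would produce a zero
  adjoined to \<open>X\<close>, contradicting injective closedness, unless fewer than continuum many fibres cover
  \<open>H\<close>.  Finally \<open>H\<close> is split along a binary tree whose levels are mapped to subdivisions of \<open>[0, 1]\<close>:
  dyadic ones turn fibres without interior into nowhere dense sets, and a limit of normalized
  counting measures on maximal \<open>\<epsilon>\<close>-separated sets, a substitute for Haar measure, turns fibres with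
  long disjoint sequences of translates into null sets.  Both contradict the assumptions on covering
  numbers.
\<close>

section \<open>Small cardinals and adjoined zeros\<close>

lemma ordLess_real_if_countable:
  assumes "countable A" shows "|A| <o |UNIV :: real set|"
proof -
  have "\<not> (\<exists>f. inj_on f (UNIV :: real set) \<and> f ` UNIV \<subseteq> A)"
    using assms uncountable_UNIV_real countable_image_inj_on countable_subset by metis
  then show ?thesis by (simp only: card_of_ordLess)
qed

lemma finite_ordLess_infinite_set:
  assumes "finite A" "infinite C" shows "|A| <o |C|"
proof -
  have "\<not> (\<exists>f. inj_on f C \<and> f ` C \<subseteq> A)"
    using assms finite_subset finite_imageD by metis
  then show ?thesis by (simp only: card_of_ordLess)
qed

lemma Times_ordLeq_infinite:
  assumes "infinite C" "|A| \<le>o |C|" "|B| \<le>o |C|"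
  shows "|A \<times> B| \<le>o |C|"
  by (rule card_of_Times_ordLeq_infinite_Field) (use assms in \<open>simp_all add: card_of_card_order_on Field_card_of\<close>)

lemma Times_ordLess_infinite:
  assumes "infinite C" "|A| <o |C|" "|B| <o |C|"
  shows "|A \<times> B| <o |C|"
proof (cases "finite A \<and> finite B")
  case True
  then show ?thesis using assms(1) by (simp add: finite_ordLess_infinite_set)
next
  case False
  consider "|A| \<le>o |B|" | "|B| \<le>o |A|"
    using ordLeq_total[OF card_of_Well_order card_of_Well_order] by blast
  then show ?thesis
  proof cases
    case 1
    then have "infinite B" using False card_of_ordLeq_infinite by blast
    then have "|A \<times> B| \<le>o |B|"
      using 1 by (intro Times_ordLeq_infinite) (simp_all add: card_of_refl ordIso_imp_ordLeq)
    then show ?thesis using assms(3) ordLeq_ordLess_trans by blast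
  next
    case 2
    then have "infinite A" using False card_of_ordLeq_infinite by blast
    then have "|A \<times> B| \<le>o |A|"
      using 2 by (intro Times_ordLeq_infinite) (simp_all add: card_of_refl ordIso_imp_ordLeq)
    then show ?thesis using assms(2) ordLeq_ordLess_trans by blast
  qed
qed

lemma lists_ordLeq_infinite:
  assumes "infinite A" shows "|lists A| \<le>o |A|"
proof -
  define L where "L n = {l \<in> lists A. length l = n}" for n
  have "|L n| \<le>o |A|" for n
  proof (induction n)
    case 0
    have "L 0 = {[]}" by (auto simp: L_def)
    then show ?case using assms
      by (simp add: finite_ordLess_infinite_set ordLess_imp_ordLeq)
  next
    case (Suc n)
    have "L (Suc n) \<subseteq> (\<lambda>(a, l). a # l) ` (A \<times> L n)"
    proof
      fix l assume "l \<in> L (Suc n)"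
      then show "l \<in> (\<lambda>(a, l). a # l) ` (A \<times> L n)"
        by (cases l) (auto simp: L_def)
    qed
    then have "|L (Suc n)| \<le>o |A \<times> L n|"
      using card_of_mono1 card_of_image ordLeq_transitive by blast
    also have "|A \<times> L n| \<le>o |A|"
      using assms Suc by (intro Times_ordLeq_infinite) (simp_all add: card_of_refl ordIso_imp_ordLeq)
    finally show ?case .
  qed
  moreover have "lists A = (\<Union>n\<in>(UNIV::nat set). L n)" by (auto simp: L_def)
  moreover have "|UNIV :: nat set| \<le>o |A|" using assms infinite_iff_card_of_nat by blast
  ultimately show ?thesis
    using card_of_UNION_ordLeq_infinite[OF assms, of "UNIV :: nat set" L] by simp
qed

lemma lists_ordLess_real:
  assumes "|A| <o |UNIV :: real set|" shows "|lists A| <o |UNIV :: real set|"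
proof (cases "finite A")
  case True
  then show ?thesis by (simp add: ordLess_real_if_countable countable_finite countable_lists)
next
  case False
  then show ?thesis using lists_ordLeq_infinite assms ordLeq_ordLess_trans by blast
qed

lemma Un_ordLess_real:
  assumes "|A| <o |UNIV :: real set|" "|B| <o |UNIV :: real set|"
  shows "|A \<union> B| <o |UNIV :: real set|"
  using assms card_of_Un_ordLess_infinite infinite_UNIV_char_0 by blast

lemma image_ordLess:
  assumes "|A| <o |C|" shows "|f ` A| <o |C|"
  using assms card_of_image ordLeq_ordLess_trans by blast

text \<open>
  The family \<open>\<B>\<close> is a base of the traces on \<open>X\<close> of the neighbourhoods of a zero adjoined to the
  discrete semigroup \<open>X\<close>.  The extension lives on \<open>X\<close> itself, by a bijection of \<open>X\<close> onto
  \<open>X - {z}\<close>.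
\<close>
lemma injectively_closed_no_zero_base:
  fixes \<C> :: "'a top_semigroup set" and X :: "'a set"
  assumes C: "\<forall>S. zero_discrete S \<and> Hausdorff_semigroup S \<longrightarrow> S \<in> \<C>"
    and inj: "injectively_closed \<C> X m"
    and sg: "semigroup_on X m"
    and inf: "infinite X"
    and B: "\<B> \<noteq> {}" "\<forall>V\<in>\<B>. V \<noteq> {} \<and> V \<subseteq> X"
    and dirB: "\<forall>V\<in>\<B>. \<forall>W\<in>\<B>. \<exists>U\<in>\<B>. U \<subseteq> V \<inter> W"
    and freeB: "\<forall>b\<in>X. \<exists>V\<in>\<B>. b \<notin> V"
    and actB: "\<forall>a\<in>X. \<forall>V\<in>\<B>. \<exists>W\<in>\<B>. \<forall>w\<in>W. m a w \<in> V \<and> m w a \<in> V"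
    and mulB: "\<forall>V\<in>\<B>. \<exists>W\<in>\<B>. \<forall>w\<in>W. \<forall>w'\<in>W. m w w' \<in> V"
  shows False
proof -
  have mX: "m a b \<in> X" if "a \<in> X" "b \<in> X" for a b
    using sg that by (simp add: semigroup_on_def)
  have masc: "m (m a b) c = m a (m b c)" if "a \<in> X" "b \<in> X" "c \<in> X" for a b c
    using sg that by (simp add: semigroup_on_def)
  obtain z where z: "z \<in> X" using inf by (metis finite.emptyI ex_in_conv)
  obtain h where h: "bij_betw h X (X - {z})" using infinite_imp_bij_betw[OF inf] by blast
  define g where "g = inv_into X h"
  have hX: "h a \<in> X" "h a \<noteq> z" if "a \<in> X" for a
    using h that bij_betwE by fastforce+
  have gh: "g (h a) = a" if "a \<in> X" for a
    using that h bij_betw_inv_into_left unfolding g_def by fastforce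
  have gX: "g x \<in> X" "h (g x) = x" if "x \<in> X" "x \<noteq> z" for x
    using that h bij_betw_inv_into_right[OF h] bij_betwE[OF bij_betw_inv_into[OF h]]
    unfolding g_def by auto
  \<comment> \<open>The image of \<open>h\<close> is \<open>X\<close> without \<open>z\<close>;
    there the operation is transported from \<open>X\<close>, and \<open>z\<close> becomes the
    zero.\<close>
  define n where "n x y = (if x = z \<or> y = z then z else h (m (g x) (g y)))" for x y
  \<comment> \<open>Every point other than \<open>z\<close> is isolated, so only neighbourhoods of
    \<open>z\<close> matter for continuity and separation.\<close>
  define opn where "opn U \<longleftrightarrow> U \<subseteq> X \<and> (z \<in> U \<longrightarrow> (\<exists>V\<in>\<B>. h ` V \<subseteq> U))" for U
  have "istopology opn"
    unfolding istopology_def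
  proof (intro conjI allI impI)
    fix U W assume UW: "opn U" "opn W"
    show "opn (U \<inter> W)"
      unfolding opn_def
    proof (intro conjI impI)
      assume "z \<in> U \<inter> W"
      then obtain V V' where V: "V \<in> \<B>" "V' \<in> \<B>" "h ` V \<subseteq> U" "h ` V' \<subseteq> W"
        using UW unfolding opn_def by blast
      then obtain V'' where V'': "V'' \<in> \<B>" "V'' \<subseteq> V \<inter> V'" using dirB by meson
      with V have "h ` V'' \<subseteq> U" "h ` V'' \<subseteq> W"
        by (meson image_mono le_inf_iff order_trans)+
      with V''(1) show "\<exists>V\<in>\<B>. h ` V \<subseteq> U \<inter> W" by (intro bexI[of _ V'']) simp_all
    qed (use UW in \<open>auto simp: opn_def\<close>)
  next
    fix \<K> assume "\<forall>K\<in>\<K>. opn K"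
    then have K: "K \<subseteq> X" "z \<in> K \<Longrightarrow> \<exists>V\<in>\<B>. h ` V \<subseteq> K" if "K \<in> \<K>" for K
      using that by (auto simp: opn_def)
    show "opn (\<Union>\<K>)"
      unfolding opn_def
    proof (intro conjI impI)
      assume "z \<in> \<Union>\<K>"
      then obtain K where "K \<in> \<K>" "z \<in> K" by blast
      then obtain V where "V \<in> \<B>" "h ` V \<subseteq> K" using K(2) by blast
      then show "\<exists>V\<in>\<B>. h ` V \<subseteq> \<Union>\<K>" using \<open>K \<in> \<K>\<close> by (intro bexI[of _ V]) auto
    qed (use K(1) in blast)
  qed
  define T where "T = topology opn"
  have oT: "openin T U \<longleftrightarrow> opn U" for U
    using \<open>istopology opn\<close> by (simp add: T_def)
  obtain V0 where "V0 \<in> \<B>" using B(1) by blast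
  have VX: "V \<subseteq> X" "V \<noteq> {}" if "V \<in> \<B>" for V using that B(2) by simp_all
  have hV: "h ` V \<subseteq> X" if "V \<in> \<B>" for V by (intro image_subsetI hX(1) subsetD[OF VX(1)[OF that]])
  then have oX: "opn X" using \<open>V0 \<in> \<B>\<close> unfolding opn_def by (intro conjI impI bexI[of _ V0]) simp_all
  have tT: "topspace T = X"
    using oT[of "topspace T"] oT[of X] oX openin_subset[of T X] by (simp add: opn_def)
  have os: "openin T {x}" if "x \<in> X" "x \<noteq> z" for x
    using that by (simp add: oT opn_def)
  have oz: "openin T (insert z (h ` V))" if "V \<in> \<B>" for V
    using that hV[OF that] z by (auto simp: oT opn_def intro!: bexI[of _ V])
  have hz: "z \<notin> h ` V" if "V \<in> \<B>" for V using VX(1)[OF that] hX(2) by auto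
  have nX: "n x y \<in> X" if "x \<in> X" "y \<in> X" for x y
    using that z gX hX mX unfolding n_def by auto
  have nz: "n x y \<noteq> z" if "x \<in> X" "y \<in> X" "x \<noteq> z" "y \<noteq> z" for x y
    using that gX hX mX unfolding n_def by auto
  have sgn: "semigroup_on X n"
    unfolding semigroup_on_def
  proof (intro conjI ballI)
    fix x y w assume xyw: "x \<in> X" "y \<in> X" "w \<in> X"
    show "n (n x y) w = n x (n y w)"
    proof (cases "x = z \<or> y = z \<or> w = z")
      case True then show ?thesis by (auto simp: n_def)
    next
      case False
      then show ?thesis
        using xyw nz[of x y] nz[of y w] gX mX gh masc by (auto simp: n_def)
    qed
  qed (rule nX)
  have "continuous_map (prod_topology T T) T (\<lambda>(x, y). n x y)"
    unfolding continuous_map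
  proof (intro conjI allI impI)
    show "(\<lambda>(x, y). n x y) ` topspace (prod_topology T T) \<subseteq> topspace T"
      using nX by (auto simp: tT)
    fix U assume U: "openin T U"
    show "openin (prod_topology T T) {p \<in> topspace (prod_topology T T). (case p of (x, y) \<Rightarrow> n x y) \<in> U}"
      unfolding openin_prod_topology_alt
    proof (intro allI impI)
      fix x y assume xy: "(x, y) \<in> {p \<in> topspace (prod_topology T T). (case p of (x, y) \<Rightarrow> n x y) \<in> U}"
      then have xX: "x \<in> X" "y \<in> X" and nU: "n x y \<in> U" by (auto simp: tT)
      \<comment> \<open>If both factors differ from \<open>z\<close>, they are isolated. If both are
        \<open>z\<close>, \<open>mulB\<close> gives the neighbourhood; if exactly one is,
        \<open>actB\<close> is applied to the preimage under \<open>h\<close> of the other.\<close>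
      have main: "\<exists>P Q. openin T P \<and> openin T Q \<and> x \<in> P \<and> y \<in> Q \<and> (\<forall>x'\<in>P. \<forall>y'\<in>Q. n x' y' \<in> U)"
      proof (cases "x = z \<or> y = z")
        case False
        then show ?thesis using os xX nU by (intro exI[of _ "{x}"] exI[of _ "{y}"]) auto
      next
        case True
        then have "z \<in> U" using nU by (auto simp: n_def)
        then obtain V where V: "V \<in> \<B>" "h ` V \<subseteq> U" using U by (auto simp: oT opn_def)
        then have hU: "h v \<in> U" if "v \<in> V" for v using that by blast
        show ?thesis
        proof (cases "x = z \<and> y = z")
          case True
          obtain W where W: "W \<in> \<B>" "\<forall>w\<in>W. \<forall>w'\<in>W. m w w' \<in> V"
            using mulB V(1) by meson
          have "n x' y' \<in> U" if w: "x' \<in> insert z (h ` W)" "y' \<in> insert z (h ` W)" for x' y'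
          proof (cases "x' = z \<or> y' = z")
            case False
            then obtain a b where "a \<in> W" "b \<in> W" "x' = h a" "y' = h b" using w by auto
            moreover from this have "a \<in> X" "b \<in> X" using VX(1)[OF W(1)] by (simp_all add: subsetD)
            ultimately show ?thesis using W(2) hX(2) by (simp add: n_def gh hU)
          qed (use \<open>z \<in> U\<close> in \<open>auto simp: n_def\<close>)
          then show ?thesis using True oz[OF W(1)] by blast
        next
          case ne: False
          define a where "a = (if x = z then g y else g x)"
          have aX: "a \<in> X" using ne True xX gX by (auto simp: a_def)
          obtain W where W: "W \<in> \<B>" "\<forall>w\<in>W. m a w \<in> V \<and> m w a \<in> V"
            using actB V(1) aX by meson
          have *: "n x' y' \<in> U" if w: "x' \<in> insert z (h ` W)" "y' = y" "x = z" for x' y'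
          proof (cases "x' = z")
            case False
            then obtain b where "b \<in> W" "x' = h b" using w by auto
            moreover from this have "b \<in> X" using VX(1)[OF W(1)] by (simp add: subsetD)
            ultimately show ?thesis using w(2,3) W(2) hX(2) ne by (simp add: n_def a_def gh hU)
          qed (use \<open>z \<in> U\<close> in \<open>auto simp: n_def\<close>)
          have **: "n x' y' \<in> U" if w: "y' \<in> insert z (h ` W)" "x' = x" "y = z" for x' y'
          proof (cases "y' = z")
            case False
            then obtain b where "b \<in> W" "y' = h b" using w by auto
            moreover from this have "b \<in> X" using VX(1)[OF W(1)] by (simp add: subsetD)
            ultimately show ?thesis using w(2,3) W(2) hX(2) ne by (simp add: n_def a_def gh hU)
          qed (use \<open>z \<in> U\<close> in \<open>auto simp: n_def\<close>)
          show ?thesis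
          proof (cases "x = z")
            case True
            then have "y \<noteq> z" using ne by auto
            then show ?thesis using True * oz[OF W(1)] os[OF xX(2)]
              by (intro exI[of _ "insert z (h ` W)"] exI[of _ "{y}"]) auto
          next
            case False
            then have "y = z" using True by auto
            then show ?thesis using False ** oz[OF W(1)] os[OF xX(1)]
              by (intro exI[of _ "{x}"] exI[of _ "insert z (h ` W)"]) auto
          qed
        qed
      qed
      then obtain P Q where PQ: "openin T P" "openin T Q" "x \<in> P" "y \<in> Q" "\<forall>x'\<in>P. \<forall>y'\<in>Q. n x' y' \<in> U"
        by blast
      then have "P \<subseteq> topspace T" "Q \<subseteq> topspace T" using openin_subset by blast+
      then show "\<exists>P Q. openin T P \<and> openin T Q \<and> x \<in> P \<and> y \<in> Q \<and>
          P \<times> Q \<subseteq> {p \<in> topspace (prod_topology T T). (case p of (x, y) \<Rightarrow> n x y) \<in> U}"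
        using PQ by (intro exI[of _ P] exI[of _ Q]) auto
    qed
  qed
  then have ts: "topological_semigroup (T, n)" using sgn by (simp add: tT)
  have sep: "\<exists>U W. openin T U \<and> openin T W \<and> x \<in> U \<and> z \<in> W \<and> disjnt U W" if x: "x \<in> X" "x \<noteq> z" for x
  proof -
    obtain V where V: "V \<in> \<B>" "g x \<notin> V" using freeB gX(1)[OF x] by meson
    then have "x \<notin> h ` V" using gh subsetD[OF VX(1)[OF V(1)]] by auto
    then show ?thesis
      using os[OF x] oz[OF V(1)] x by (intro exI[of _ "{x}"] exI[of _ "insert z (h ` V)"]) (auto simp: disjnt_def)
  qed
  have haus: "Hausdorff_space T"
    unfolding Hausdorff_space_def
  proof (intro allI impI)
    fix x y assume xy: "x \<in> topspace T \<and> y \<in> topspace T \<and> x \<noteq> y"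
    consider "x = z" | "y = z" | "x \<noteq> z" "y \<noteq> z" by blast
    then show "\<exists>U V. openin T U \<and> openin T V \<and> x \<in> U \<and> y \<in> V \<and> disjnt U V"
    proof cases
      case 1 then show ?thesis using sep[of y] xy by (metis disjnt_sym tT)
    next
      case 2 then show ?thesis using sep[of x] xy by (metis tT)
    next
      case 3 then show ?thesis using os[of x] os[of y] xy
        by (intro exI[of _ "{x}"] exI[of _ "{y}"]) (auto simp: tT)
    qed
  qed
  \<comment> \<open>A neighbourhood of \<open>z\<close> contains the image of a nonempty set, and
    this image misses \<open>z\<close>. So \<open>z\<close> is not isolated, whereas a closed image
    of \<open>h\<close> would make it isolated.\<close>
  have noz: "\<not> opn {z}"
  proof
    assume "opn {z}"
    then obtain V where V: "V \<in> \<B>" "h ` V \<subseteq> {z}" by (auto simp: opn_def)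
    with VX[OF V(1)] hz[OF V(1)] show False by blast
  qed
  then have "{x \<in> topspace T. \<not> openin T {x}} = {z}" using os z by (auto simp: tT oT)
  moreover have "\<forall>x\<in>topspace T. n z x = z \<and> n x z = z" by (simp add: n_def)
  ultimately have zd: "zero_discrete (T, n)" using ts by auto
  have "(T, n) \<in> \<C>" using C zd ts haus by simp
  moreover have "h ` X \<subseteq> topspace T \<and> inj_on h X \<and> (\<forall>x\<in>X. \<forall>y\<in>X. h (m x y) = n (h x) (h y))"
    using hX h gh by (auto simp: tT n_def bij_betw_def)
  ultimately have "closedin T (h ` X)" using inj unfolding injectively_closed_def by blast
  moreover have "h ` X = X - {z}" using h by (simp add: bij_betw_def)
  ultimately have "openin T {z}" using z
    by (metis Diff_Diff_Int Int_insert_right_if1 closedin_def inf_bot_right tT)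
  then show ?thesis using noz oT by simp
qed

section \<open>The group in the minimal ideal\<close>

text \<open>Zorn's lemma for reverse inclusion: a chain of nonempty closed sets has nonempty
  intersection by the finite intersection property, and \<open>int\<close> keeps this intersection
  in the family. Passing to complements turns intersections of chains into unions.\<close>

lemma compact_minimal_closed:
  assumes "compact_space T" "\<F> \<noteq> {}"
    and clo: "\<And>A. A \<in> \<F> \<Longrightarrow> closedin T A \<and> A \<noteq> {}"
    and int: "\<And>\<D>. \<D> \<noteq> {} \<Longrightarrow> \<D> \<subseteq> \<F> \<Longrightarrow> \<Inter>\<D> \<noteq> {} \<Longrightarrow> \<Inter>\<D> \<in> \<F>"
  obtains M where "M \<in> \<F>" "\<And>A. A \<in> \<F> \<Longrightarrow> A \<subseteq> M \<Longrightarrow> A = M"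
proof -
  let ?c = "\<lambda>A. topspace T - A"
  have sub: "A \<subseteq> topspace T" if "A \<in> \<F>" for A using clo[OF that] closedin_subset by blast
  have "\<exists>M\<in>?c ` \<F>. \<forall>X\<in>?c ` \<F>. M \<subseteq> X \<longrightarrow> X = M"
  proof (rule subset_Zorn_nonempty)
    fix \<U> assume ne: "\<U> \<noteq> {}" and ch: "subset.chain (?c ` \<F>) \<U>"
    define \<D> where "\<D> = {A \<in> \<F>. ?c A \<in> \<U>}"
    have UD: "\<U> = ?c ` \<D>" using ch by (auto simp: \<D>_def subset_chain_def)
    then have "\<D> \<noteq> {}" using ne by auto
    have chD: "A \<subseteq> B \<or> B \<subseteq> A" if "A \<in> \<D>" "B \<in> \<D>" for A B
    proof -
      have "?c A \<subseteq> ?c B \<or> ?c B \<subseteq> ?c A" using that ch UD by (auto simp: subset_chain_def)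
      then show ?thesis using that sub by (auto simp: \<D>_def)
    qed
    have fin: "\<Inter>\<G> \<in> \<G>" if "finite \<G>" "\<G> \<noteq> {}" "\<G> \<subseteq> \<D>" for \<G>
      using that
    proof (induction rule: finite_ne_induct)
      case (insert A \<G>)
      then have "A \<subseteq> \<Inter>\<G> \<or> \<Inter>\<G> \<subseteq> A" using chD by (meson insert_subset subsetD)
      then show ?case
      proof
        assume "A \<subseteq> \<Inter>\<G>"
        then have "\<Inter>(insert A \<G>) = A" by auto
        then show ?thesis by simp
      next
        assume "\<Inter>\<G> \<subseteq> A"
        then have "\<Inter>(insert A \<G>) = \<Inter>\<G>" by auto
        then show ?thesis using insert by simp
      qed
    qed simp
    have "\<Inter>\<D> \<noteq> {}"
    proof -
      have "\<Inter>\<G> \<noteq> {}" if "finite \<G>" "\<G> \<subseteq> \<D>" for \<G>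
      proof (cases "\<G> = {}")
        case False
        then have "\<Inter>\<G> \<in> \<F>" using fin that by (auto simp: \<D>_def)
        then show ?thesis using clo by blast
      qed simp
      moreover have "\<forall>A\<in>\<D>. closedin T A" using clo by (auto simp: \<D>_def)
      ultimately show ?thesis
        using assms(1)[unfolded compact_space_fip, rule_format, of \<D>] by simp
    qed
    then have "\<Inter>\<D> \<in> \<F>" using int[of \<D>] \<open>\<D> \<noteq> {}\<close> by (auto simp: \<D>_def)
    moreover have "\<Union>\<U> = ?c (\<Inter>\<D>)" using UD \<open>\<D> \<noteq> {}\<close> by auto
    ultimately show "\<Union>\<U> \<in> ?c ` \<F>" by blast
  qed (use assms(2) in blast)
  then obtain M where M: "M \<in> \<F>" "\<forall>A\<in>\<F>. ?c M \<subseteq> ?c A \<longrightarrow> ?c A = ?c M" by blast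
  show ?thesis
  proof
    fix A assume "A \<in> \<F>" "A \<subseteq> M"
    then show "A = M" using M sub by blast
  qed (rule M(1))
qed

section \<open>Compact semigroups and their minimal left ideals\<close>

locale compact_semigroup =
  fixes T :: "'a topology" and m :: "'a \<Rightarrow> 'a \<Rightarrow> 'a" (infixl \<open>\<odot>\<close> 70)
  assumes compact: "compact_space T"
    and Hausdorff: "Hausdorff_space T"
    and mult_closed: "\<lbrakk>x \<in> topspace T; y \<in> topspace T\<rbrakk> \<Longrightarrow> x \<odot> y \<in> topspace T"
    and assoc: "\<lbrakk>x \<in> topspace T; y \<in> topspace T; z \<in> topspace T\<rbrakk> \<Longrightarrow> x \<odot> y \<odot> z = x \<odot> (y \<odot> z)"
    and cont: "continuous_map (prod_topology T T) T (\<lambda>(x, y). x \<odot> y)"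
begin

abbreviation X :: "'a set" where "X \<equiv> topspace T"

lemma continuous_map_mult:
  assumes "continuous_map S T f" "continuous_map S T g"
  shows "continuous_map S T (\<lambda>x. f x \<odot> g x)"
  using continuous_map_compose[OF continuous_map_pairedI[OF assms] cont] by (simp add: comp_def)

lemma closedin_image:
  assumes "continuous_map T T f" "closedin T C" shows "closedin T (f ` C)"
  by (rule compactin_imp_closedin[OF Hausdorff image_compactin[OF closedin_compact_space[OF compact assms(2)] assms(1)]])

lemma closedin_fibre:
  assumes "continuous_map T T f" "closedin T C" "b \<in> X" shows "closedin T {x \<in> C. f x = b}"
proof -
  have "closedin T {b}" using assms(3) Hausdorff by (simp add: closedin_Hausdorff_singleton)
  then have "closedin T {x \<in> X. f x \<in> {b}}"
    using assms(1) closedin_continuous_map_preimage by blast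
  moreover have "{x \<in> C. f x = b} = C \<inter> {x \<in> X. f x \<in> {b}}"
    using closedin_subset[OF assms(2)] by auto
  ultimately show ?thesis using closedin_Int[OF assms(2)] by simp
qed

text \<open>The idempotent e is found in a minimal closed subsemigroup of a minimal closed left
  ideal \<open>L\<close>. Every c with c e = c lies in \<open>L\<close>, and X c = \<open>L\<close>
  contains e; this is the last conclusion, which will supply inverses.\<close>

lemma minimal_idempotent_ex:
  assumes "X \<noteq> {}"
  obtains e where "e \<in> X" "e \<odot> e = e"
    "\<And>a. a \<in> X \<Longrightarrow> a \<odot> e = a \<Longrightarrow> \<exists>b\<in>X. b \<odot> a = e"
proof -
  define \<L> where "\<L> = {L. closedin T L \<and> L \<noteq> {} \<and> (\<forall>x\<in>X. \<forall>l\<in>L. x \<odot> l \<in> L)}"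
  have "X \<in> \<L>" using assms mult_closed by (auto simp: \<L>_def)
  obtain L where L: "L \<in> \<L>" and Lmin: "\<And>A. A \<in> \<L> \<Longrightarrow> A \<subseteq> L \<Longrightarrow> A = L"
  proof (rule compact_minimal_closed[OF compact, of \<L>])
    show "\<L> \<noteq> {}" using \<open>X \<in> \<L>\<close> by blast
    fix \<D> assume "\<D> \<noteq> {}" "\<D> \<subseteq> \<L>" "\<Inter>\<D> \<noteq> {}"
    then show "\<Inter>\<D> \<in> \<L>" by (auto simp: \<L>_def)
  qed (auto simp: \<L>_def)
  have LX: "L \<subseteq> X" using L closedin_subset by (auto simp: \<L>_def)
  have cr: "continuous_map T T (\<lambda>x. x \<odot> a)" if "a \<in> X" for a
    using that by (intro continuous_map_mult) simp_all
  \<comment> \<open>X a is closed as a continuous image of a compact set, and it is a left ideal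
    inside \<open>L\<close>, so minimality applies.\<close>
  have Xa: "(\<lambda>x. x \<odot> a) ` X = L" if "a \<in> L" for a
  proof (rule Lmin)
    have "a \<in> X" using that LX by blast
    have "x \<odot> l \<in> (\<lambda>x. x \<odot> a) ` X" if "x \<in> X" and l: "l \<in> (\<lambda>x. x \<odot> a) ` X" for x l
    proof -
      obtain y where "y \<in> X" "l = y \<odot> a" using l by blast
      then show ?thesis using that \<open>a \<in> X\<close> by (intro image_eqI[of _ _ "x \<odot> y"]) (simp_all add: assoc mult_closed)
    qed
    then show "(\<lambda>x. x \<odot> a) ` X \<in> \<L>"
      using closedin_image[OF cr[OF \<open>a \<in> X\<close>], of X] assms by (auto simp: \<L>_def)
    show "(\<lambda>x. x \<odot> a) ` X \<subseteq> L" using L that by (auto simp: \<L>_def)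
  qed
  \<comment> \<open>Ellis' argument: for \<open>a\<close> in a minimal closed subsemigroup
    \<open>S\<close>, minimality gives S a = S; then the nonempty closed subsemigroup of all x in
    \<open>S\<close> with x a = a is all of \<open>S\<close>, so it contains
    \<open>a\<close>.\<close>
  define \<S> where "\<S> = {S. closedin T S \<and> S \<noteq> {} \<and> S \<subseteq> L \<and> (\<forall>x\<in>S. \<forall>y\<in>S. x \<odot> y \<in> S)}"
  have "L \<in> \<S>" using L LX by (auto simp: \<S>_def \<L>_def)
  obtain S where S: "S \<in> \<S>" and Smin: "\<And>A. A \<in> \<S> \<Longrightarrow> A \<subseteq> S \<Longrightarrow> A = S"
  proof (rule compact_minimal_closed[OF compact, of \<S>])
    show "\<S> \<noteq> {}" using \<open>L \<in> \<S>\<close> by blast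
    fix \<D> assume D: "\<D> \<noteq> {}" "\<D> \<subseteq> \<S>" "\<Inter>\<D> \<noteq> {}"
    have "\<Inter>\<D> \<subseteq> L" using D(1,2) by (auto simp: \<S>_def)
    then show "\<Inter>\<D> \<in> \<S>" using D by (auto simp: \<S>_def)
  qed (auto simp: \<S>_def)
  then have SX: "S \<subseteq> X" using LX by (auto simp: \<S>_def)
  obtain a where a: "a \<in> S" using S by (auto simp: \<S>_def)
  then have aX: "a \<in> X" using SX by blast
  have SS: "x \<odot> y \<in> S" if "x \<in> S" "y \<in> S" for x y using S that by (auto simp: \<S>_def)
  have "(\<lambda>x. x \<odot> a) ` S = S"
  proof (rule Smin)
    have "x \<odot> y \<in> (\<lambda>x. x \<odot> a) ` S"
      if xy: "x \<in> (\<lambda>x. x \<odot> a) ` S" "y \<in> (\<lambda>x. x \<odot> a) ` S" for x y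
    proof -
      obtain u v where uv: "u \<in> S" "x = u \<odot> a" "v \<in> S" "y = v \<odot> a" using xy by blast
      then have "x \<odot> y = (x \<odot> v) \<odot> a" using SX aX SS a by (simp add: assoc subset_eq)
      moreover have "x \<odot> v \<in> S" using uv SS a by simp
      ultimately show ?thesis by blast
    qed
    moreover have "(\<lambda>x. x \<odot> a) ` S \<subseteq> L" using S SS a by (auto simp: \<S>_def)
    ultimately show "(\<lambda>x. x \<odot> a) ` S \<in> \<S>"
      using closedin_image[OF cr[OF aX], of S] S by (auto simp: \<S>_def)
    show "(\<lambda>x. x \<odot> a) ` S \<subseteq> S" using SS a by auto
  qed
  then obtain s where s: "s \<in> S" "s \<odot> a = a" using a by (metis imageE)
  have "{x \<in> S. x \<odot> a = a} = S"
  proof (rule Smin)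
    have "closedin T {x \<in> S. x \<odot> a = a}" using closedin_fibre[OF cr[OF aX] _ aX] S by (auto simp: \<S>_def)
    moreover have "x \<odot> y \<odot> a = a" if "x \<in> S" "y \<in> S" "x \<odot> a = a" "y \<odot> a = a" for x y
      using that SX aX by (simp add: assoc subset_eq)
    ultimately show "{x \<in> S. x \<odot> a = a} \<in> \<S>" using s S SS by (auto simp: \<S>_def)
  qed blast
  then have "a \<odot> a = a" using a by blast
  moreover have "\<exists>b\<in>X. b \<odot> c = a" if "c \<in> X" "c \<odot> a = c" for c
  proof -
    have "a \<in> L" using a S by (auto simp: \<S>_def)
    then have "c \<in> L" using that L by (metis (lifting) \<L>_def mem_Collect_eq)
    then show ?thesis using Xa[of c] \<open>a \<in> L\<close> by (metis imageE)
  qed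
  ultimately show ?thesis using that aX by blast
qed

end

text \<open>The last assumption expresses that X e is a minimal left ideal: the elements fixed by
  right multiplication with e form X e, and each of them can be multiplied back to e from the
  left.\<close>

locale kernel_semigroup = compact_semigroup +
  fixes e :: 'a
  assumes eX: "e \<in> X" and ee: "e \<odot> e = e"
    and left_inv_ex: "\<lbrakk>a \<in> X; a \<odot> e = a\<rbrakk> \<Longrightarrow> \<exists>b\<in>X. b \<odot> a = e"
begin

text \<open>This is e X e, the fixed set of the retraction x \<mapsto> e x e; the left inverses make
  it a group with unit \<open>e\<close>.\<close>

definition H :: "'a set" where "H = {x \<in> X. e \<odot> x = x \<and> x \<odot> e = x}"

definition iv :: "'a \<Rightarrow> 'a" where "iv a = (SOME b. b \<in> H \<and> b \<odot> a = e)"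

primrec pw :: "nat \<Rightarrow> 'a \<Rightarrow> 'a" where
  "pw 0 x = e"
| "pw (Suc j) x = x \<odot> pw j x"

lemma HX: "x \<in> H \<Longrightarrow> x \<in> X" and eH1: "x \<in> H \<Longrightarrow> e \<odot> x = x" and eH2: "x \<in> H \<Longrightarrow> x \<odot> e = x"
  by (auto simp: H_def)

lemma HI: "\<lbrakk>x \<in> X; e \<odot> x = x; x \<odot> e = x\<rbrakk> \<Longrightarrow> x \<in> H"
  by (simp add: H_def)

lemma eH: "e \<in> H" by (simp add: H_def eX ee)

lemma Hassoc: "\<lbrakk>x \<in> H; y \<in> H; z \<in> H\<rbrakk> \<Longrightarrow> x \<odot> y \<odot> z = x \<odot> (y \<odot> z)"
  by (simp add: assoc HX)

lemma Hmult: "\<lbrakk>x \<in> H; y \<in> H\<rbrakk> \<Longrightarrow> x \<odot> y \<in> H"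
  by (metis HI HX assoc eH1 eH2 eX mult_closed)

lemma retract_H: "x \<in> X \<Longrightarrow> e \<odot> x \<odot> e \<in> H"
  by (rule HI) (simp_all add: mult_closed assoc eX ee, simp add: assoc[symmetric] mult_closed eX ee)

text \<open>A left inverse b found in X need not lie in \<open>H\<close>, but e b e does, and it is
  still a left inverse because e a = a.\<close>

lemma iv: assumes "a \<in> H" shows ivH: "iv a \<in> H" and iv1: "iv a \<odot> a = e"
proof -
  obtain b where b: "b \<in> X" "b \<odot> a = e" using left_inv_ex assms HX eH2 by metis
  have "(e \<odot> b \<odot> e) \<odot> a = e \<odot> (b \<odot> (e \<odot> a))" using b assms HX eX by (simp add: assoc mult_closed)
  then have "(e \<odot> b \<odot> e) \<odot> a = e" using b assms eH1 ee by simp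
  then have "\<exists>b. b \<in> H \<and> b \<odot> a = e" using retract_H b by blast
  then have "iv a \<in> H \<and> iv a \<odot> a = e" unfolding iv_def by (rule someI_ex)
  then show "iv a \<in> H" "iv a \<odot> a = e" by auto
qed

lemma iv2: assumes "a \<in> H" shows "a \<odot> iv a = e"
proof -
  let ?b = "iv a" let ?c = "iv (iv a)"
  have "a \<odot> ?b = (?c \<odot> ?b) \<odot> (a \<odot> ?b)" using assms iv1[OF ivH[OF assms]] by (simp add: eH1 Hmult ivH)
  also have "\<dots> = ?c \<odot> ((?b \<odot> a) \<odot> ?b)" using assms by (simp add: Hassoc Hmult ivH)
  also have "\<dots> = e" using assms by (simp add: iv1 eH1 ivH)
  finally show ?thesis .
qed

lemma iv_cancel: assumes "a \<in> H" "b \<in> H"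
  shows "iv a \<odot> (a \<odot> b) = b" "a \<odot> (iv a \<odot> b) = b" "b \<odot> a \<odot> iv a = b" "b \<odot> iv a \<odot> a = b"
  using assms by (simp_all add: Hassoc[symmetric] iv1 iv2 eH1 ivH)
   (simp_all add: Hassoc iv1 iv2 eH2 ivH)

lemma pwH: "x \<in> H \<Longrightarrow> pw j x \<in> H"
  by (induction j) (simp_all add: eH Hmult)

lemma pw_add: "x \<in> H \<Longrightarrow> pw (i + j) x = pw i x \<odot> pw j x"
  by (induction i) (simp_all add: eH1 pwH Hassoc)

lemma closedin_H: "closedin T H"
proof -
  have c: "continuous_map T T (\<lambda>x. e \<odot> x \<odot> e)" using eX by (intro continuous_map_mult) simp_all
  have "H = (\<lambda>x. e \<odot> x \<odot> e) ` X"
  proof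
    show "H \<subseteq> (\<lambda>x. e \<odot> x \<odot> e) ` X"
    proof
      fix x assume "x \<in> H"
      then show "x \<in> (\<lambda>x. e \<odot> x \<odot> e) ` X" by (intro image_eqI[of _ _ x]) (simp_all add: HX eH1 eH2)
    qed
  qed (use retract_H in blast)
  then show ?thesis using closedin_image[OF c, of X] by simp
qed

section \<open>Polynomial functions on the group\<close>

primrec hpoly :: "nat \<Rightarrow> (nat \<Rightarrow> 'a) \<Rightarrow> 'a \<Rightarrow> 'a" where
  "hpoly 0 p x = p 0"
| "hpoly (Suc n) p x = hpoly n p x \<odot> x \<odot> p (Suc n)"

definition polyfun :: "nat \<Rightarrow> ('a \<Rightarrow> 'a) \<Rightarrow> bool" where
  "polyfun n f \<longleftrightarrow> (\<exists>p. range p \<subseteq> H \<and> (\<forall>x\<in>H. f x = hpoly n p x))"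

lemma hpoly_cong: "(\<And>i. i \<le> n \<Longrightarrow> p i = q i) \<Longrightarrow> hpoly n p x = hpoly n q x"
  by (induction n) simp_all

lemma hpolyH: "range p \<subseteq> H \<Longrightarrow> x \<in> H \<Longrightarrow> hpoly n p x \<in> H"
  by (induction n) (simp_all add: Hmult range_subsetD)

lemma polyfunH: "polyfun n f \<Longrightarrow> x \<in> H \<Longrightarrow> f x \<in> H"
  unfolding polyfun_def using hpolyH by metis

lemma polyfun_hpoly: "range p \<subseteq> H \<Longrightarrow> polyfun n (hpoly n p)"
  unfolding polyfun_def by blast

lemma polyfun_cong: "polyfun n f \<Longrightarrow> (\<And>x. x \<in> H \<Longrightarrow> f x = g x) \<Longrightarrow> polyfun n g"
  unfolding polyfun_def by auto

lemma polyfun_const: "c \<in> H \<Longrightarrow> polyfun 0 (\<lambda>x. c)"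
  unfolding polyfun_def by (intro exI[of _ "\<lambda>_. c"]) auto

lemma polyfun_id: "polyfun 1 (\<lambda>x. x)"
  unfolding polyfun_def by (intro exI[of _ "\<lambda>_. e"]) (auto simp: eH eH1 eH2)

lemma polyfun_mult:
  assumes "polyfun n f" "polyfun k g" shows "polyfun (n + k) (\<lambda>x. f x \<odot> g x)"
proof -
  obtain p q where p: "range p \<subseteq> H" "\<forall>x\<in>H. f x = hpoly n p x"
    and q: "range q \<subseteq> H" "\<forall>x\<in>H. g x = hpoly k q x"
    using assms unfolding polyfun_def by blast
  \<comment> \<open>The last coefficient of f and the first one of g meet; their product becomes the
    single coefficient with index n.\<close>
  define s where "s i = (if i < n then p i else if i = n then p n \<odot> q 0 else q (i - n))" for i
  have s: "range s \<subseteq> H" using p(1) q(1) Hmult by (auto simp: s_def)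
  have base: "hpoly n p x \<odot> q 0 = hpoly n s x" if x: "x \<in> H" for x
  proof (cases n)
    case 0 then show ?thesis by (simp add: s_def)
  next
    case (Suc k)
    have "hpoly k p x = hpoly k s x" by (rule hpoly_cong) (simp add: s_def Suc)
    then show ?thesis using x p(1) q(1) hpolyH[OF s x] by (simp add: Suc s_def Hassoc Hmult subset_eq)
  qed
  have "hpoly n p x \<odot> hpoly j q x = hpoly (n + j) s x" if x: "x \<in> H" for x j
  proof (induction j)
    case 0 then show ?case using base[OF x] by simp
  next
    case (Suc j)
    have "s (Suc (n + j)) = q (Suc j)" by (simp add: s_def)
    then show ?case using Suc x hpolyH[OF p(1) x] hpolyH[OF q(1) x] q(1)
      by (simp add: Hassoc[symmetric] Hmult subset_eq)
  qed
  then show ?thesis unfolding polyfun_def using s p(2) q(2) by (intro exI[of _ s]) auto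
qed

lemma polyfun_comp:
  assumes "polyfun n f" "polyfun k g" shows "polyfun (n * k) (\<lambda>x. f (g x))"
proof -
  obtain p where p: "range p \<subseteq> H" "\<forall>x\<in>H. f x = hpoly n p x"
    using assms unfolding polyfun_def by blast
  have "polyfun (j * k) (\<lambda>x. hpoly j p (g x))" for j
  proof (induction j)
    case 0 then show ?case using p(1) by (simp add: polyfun_const subset_eq)
  next
    case (Suc j)
    from polyfun_mult[OF polyfun_mult[OF Suc assms(2)] polyfun_const[of "p (Suc j)"]] p(1)
    show ?case by (simp add: add.commute subset_eq)
  qed
  then show ?thesis by (rule polyfun_cong) (simp add: p(2) polyfunH[OF assms(2)])
qed

lemma polyfun_pw: "polyfun j (pw j)"
proof (induction j)
  case 0 then show ?case using polyfun_const[OF eH] by simp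
next
  case (Suc j) then show ?case using polyfun_mult[OF polyfun_id Suc] by simp
qed

lemma polyfun_translate:
  "polyfun n f \<Longrightarrow> c \<in> H \<Longrightarrow> polyfun n (\<lambda>x. c \<odot> f x)"
  "polyfun n f \<Longrightarrow> c \<in> H \<Longrightarrow> polyfun n (\<lambda>x. f x \<odot> c)"
  using polyfun_mult[of 0 "\<lambda>_. c" n f] polyfun_mult[of n f 0 "\<lambda>_. c"] polyfun_const by simp_all

text \<open>Both copies of e around x are absorbed by the neighbouring coefficients, which lie in
  \<open>H\<close>; so the word with the same coefficients, evaluated at any x in X, has the value
  of f at e x e.\<close>

lemma semigroup_polynomial_retract:
  assumes "polyfun n f" "n \<ge> 1"
  shows "semigroup_polynomial X (\<odot>) n (\<lambda>x. f (e \<odot> x \<odot> e))"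
proof -
  obtain p where p: "range p \<subseteq> H" "\<forall>x\<in>H. f x = hpoly n p x"
    using assms unfolding polyfun_def by blast
  have "poly_word (\<odot>) (\<lambda>i. Some (p i)) k x = Some (hpoly k p (e \<odot> x \<odot> e))" if x: "x \<in> X" for k x
  proof (induction k)
    case (Suc k)
    have h: "hpoly k p (e \<odot> x \<odot> e) \<in> H" using hpolyH[OF p(1) retract_H[OF x]] .
    have pk: "p (Suc k) \<in> H" using p(1) by auto
    have "hpoly k p (e \<odot> x \<odot> e) \<odot> (e \<odot> x \<odot> e) \<odot> p (Suc k) =
       (hpoly k p (e \<odot> x \<odot> e) \<odot> e) \<odot> x \<odot> (e \<odot> p (Suc k))"
      using HX[OF h] HX[OF pk] x eX by (simp add: assoc mult_closed)
    then show ?case using Suc by (simp add: eH1[OF pk] eH2[OF h])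
  qed simp
  moreover have "p i \<in> X" for i using p(1) HX by blast
  ultimately show ?thesis unfolding semigroup_polynomial_def
    using assms(2) p(2) retract_H by (auto simp: adjoin_one_def intro!: exI[of _ "\<lambda>i. Some (p i)"])
qed

text \<open>A translation x \<mapsto> x g turns f into another polynomial of the same degree, so a
  covering of \<open>H\<close> by translates of one fibre becomes a covering of X by fibres of
  several polynomials over the common value b.\<close>

lemma polyboundedI:
  assumes "polyfun n f" "n \<ge> 1" "b \<in> H" "finite G" "G \<subseteq> H"
    and cov: "\<And>x. x \<in> H \<Longrightarrow> \<exists>g\<in>G. f (x \<odot> g) = b"
  shows "polybounded X (\<odot>)"
proof -
  let ?A = "\<lambda>g. {x \<in> X. f (e \<odot> x \<odot> e \<odot> g) = b}"
  have "semigroup_polynomial X (\<odot>) n (\<lambda>x. f (e \<odot> x \<odot> e \<odot> g))" if "g \<in> G" for g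
  proof -
    have "polyfun 1 (\<lambda>x. x \<odot> g)" using polyfun_translate(2)[OF polyfun_id] that assms(5) by blast
    from polyfun_comp[OF assms(1) this] have "polyfun n (\<lambda>x. f (x \<odot> g))" by simp
    then show ?thesis using semigroup_polynomial_retract assms(2) by fastforce
  qed
  then have "\<forall>A\<in>?A ` G. \<exists>n f b. semigroup_polynomial X (\<odot>) n f \<and> b \<in> X \<and> A = {x \<in> X. f x = b}"
    using HX[OF assms(3)] by blast
  moreover have "X = \<Union>(?A ` G)" using cov retract_H by fastforce
  ultimately show ?thesis unfolding polybounded_def using assms(4)
    by (intro exI[of _ "?A ` G"] conjI) simp_all
qed

text \<open>Retract both points to x, y in \<open>H\<close> and take z = y x^-1. The polynomial
  sending t to f(a)^-1 f((t x^-1)^j a) is e at x because (x x^-1)^j = e, and e at y by recurrence.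
  Its degree n j is at most n N.\<close>

lemma polyfiniteI:
  assumes f: "polyfun n f" "n \<ge> 1"
    and rec: "\<And>z. z \<in> H \<Longrightarrow> \<exists>j a. 1 \<le> j \<and> j \<le> N \<and> a \<in> H \<and> f a = f (pw j z \<odot> a)"
  shows "polyfinite X (\<odot>)"
  unfolding polyfinite_def
proof (rule exI[of _ "n * N"], rule exI[of _ "{e}"], intro conjI ballI)
  show "finite {e}" "{e} \<subseteq> X" using eX by auto
  fix x0 y0 assume xy: "x0 \<in> X" "y0 \<in> X"
  define x where "x = e \<odot> x0 \<odot> e"
  define y where "y = e \<odot> y0 \<odot> e"
  have H: "x \<in> H" "y \<in> H" unfolding x_def y_def using retract_H xy by auto
  obtain j a where ja: "1 \<le> j" "j \<le> N" "a \<in> H" "f a = f (pw j (y \<odot> iv x) \<odot> a)"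
    using rec[of "y \<odot> iv x"] H Hmult ivH by blast
  define g where "g t = iv (f a) \<odot> f (pw j (t \<odot> iv x) \<odot> a)" for t
  have "polyfun j (\<lambda>t. pw j (t \<odot> iv x))"
    using polyfun_comp[OF polyfun_pw polyfun_translate(2)[OF polyfun_id ivH[OF H(1)]]] by simp
  then have "polyfun (n * j) (\<lambda>t. f (pw j (t \<odot> iv x) \<odot> a))"
    using polyfun_comp[OF f(1) polyfun_translate(2)] ja(3) by blast
  then have g: "polyfun (n * j) g"
    unfolding g_def using polyfun_translate(1) ivH polyfunH[OF f(1) ja(3)] by blast
  have "pw j e = e" for j by (induction j) (simp_all add: ee)
  then have "g x = e" "g y = e"
    using ja H iv1[OF polyfunH[OF f(1) ja(3)]] by (simp_all add: g_def iv2 eH1)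
  then have "{g (e \<odot> x0 \<odot> e), g (e \<odot> y0 \<odot> e)} \<subseteq> {e}" by (simp add: x_def y_def)
  moreover have "semigroup_polynomial X (\<odot>) (n * j) (\<lambda>t. g (e \<odot> t \<odot> e))"
    using semigroup_polynomial_retract[OF g] f(2) ja by simp
  moreover have "n * j \<le> n * N" using ja by simp
  ultimately show "\<exists>k f. k \<le> n * N \<and> semigroup_polynomial X (\<odot>) k f \<and> {f x0, f y0} \<subseteq> {e}"
    by (intro exI[of _ "n * j"] exI[of _ "\<lambda>t. g (e \<odot> t \<odot> e)"]) simp
qed

end

section \<open>Subinvariant pseudometrics\<close>

text \<open>The finite subcover property in a form suited to claims that finitely many data work for
  all points of a set: data for two sets are combined.\<close>

lemma compact_space_induct:
  assumes "compact_space T"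
    and loc: "\<And>x. x \<in> topspace T \<Longrightarrow> \<exists>U. openin T U \<and> x \<in> U \<and> G U"
    and emp: "G {}" and Un: "\<And>U V. G U \<Longrightarrow> G V \<Longrightarrow> G (U \<union> V)"
  shows "G (topspace T)"
proof -
  let ?U = "{U. openin T U \<and> G U}"
  have "\<Union>?U = topspace T" using loc openin_subset by fastforce
  then obtain \<F> where F: "finite \<F>" "\<F> \<subseteq> ?U" "\<Union>\<F> = topspace T"
    using assms(1)[unfolded compact_space, rule_format, of ?U] by auto
  from F(1,2) have "G (\<Union>\<F>)" by (induction rule: finite_induct) (auto simp: emp Un)
  then show ?thesis using F(3) by simp
qed

text \<open>Urysohn functions separate the two values at one pair (p, a), hence on a neighbourhood.
  Compactness is applied first to a, with p and its witness x fixed, and then to p: the witness may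
  depend on p but not on a.\<close>

lemma finite_separating_family:
  fixes u v :: "nat \<Rightarrow> 'p \<Rightarrow> 'x \<Rightarrow> 'q \<Rightarrow> 'a"
  assumes P: "compact_space P" and Q: "compact_space Q" and T: "compact_space T" "Hausdorff_space T"
    and cu: "\<And>x j. x \<in> S \<Longrightarrow> continuous_map (prod_topology P Q) T (\<lambda>(p, a). u j p x a)"
    and cv: "\<And>x j. x \<in> S \<Longrightarrow> continuous_map (prod_topology P Q) T (\<lambda>(p, a). v j p x a)"
    and ne: "\<And>p. p \<in> topspace P \<Longrightarrow> \<exists>x\<in>S. \<forall>a\<in>topspace Q. \<forall>j<N. u j p x a \<noteq> v j p x a"
  shows "\<exists>\<Phi>. finite \<Phi> \<and> (\<forall>\<phi>\<in>\<Phi>. continuous_map T (top_of_set {0..1::real}) \<phi>) \<and>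
    (\<forall>p\<in>topspace P. \<exists>x\<in>S. \<forall>a\<in>topspace Q. \<forall>j<N. \<exists>\<phi>\<in>\<Phi>. \<bar>\<phi> (u j p x a) - \<phi> (v j p x a)\<bar> \<ge> 1 / 3)"
proof -
  define fam where "fam \<Phi> \<longleftrightarrow> finite \<Phi> \<and> (\<forall>\<phi>\<in>\<Phi>. continuous_map T (top_of_set {0..1::real}) \<phi>)" for \<Phi>
  define sp where "sp \<Phi> p x a \<longleftrightarrow> (\<forall>j<N. \<exists>\<phi>\<in>\<Phi>. \<bar>\<phi> (u j p x a) - \<phi> (v j p x a)\<bar> \<ge> 1 / 3)" for \<Phi> :: "('a \<Rightarrow> real) set" and p x a
  have famUn: "fam (\<Phi> \<union> \<Psi>)" if "fam \<Phi>" "fam \<Psi>" for \<Phi> \<Psi> using that by (auto simp: fam_def)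
  have sp_mono: "sp \<Psi> p x a" if "sp \<Phi> p x a" "\<Phi> \<subseteq> \<Psi>" for \<Phi> \<Psi> p x a
    using that unfolding sp_def by (meson subsetD)
  have norm: "normal_space T" using T compact_Hausdorff_or_regular_imp_normal_space by blast
  have pt: "\<exists>\<Phi> U V. fam \<Phi> \<and> openin P U \<and> openin Q V \<and> p \<in> U \<and> a \<in> V \<and> (\<forall>p'\<in>U. \<forall>a'\<in>V. sp \<Phi> p' x a')"
    if p: "p \<in> topspace P" and a: "a \<in> topspace Q" and x: "x \<in> S"
      and ne: "\<forall>j<N. u j p x a \<noteq> v j p x a" for p a x
  proof -
    have "\<exists>\<phi>. continuous_map T (top_of_set {0..1::real}) \<phi> \<and> \<phi> (u j p x a) = 0 \<and> \<phi> (v j p x a) = 1" if "j < N" for j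
    proof -
      have "u j p x a \<in> topspace T" "v j p x a \<in> topspace T"
        using continuous_map_funspace[OF cu[OF x, of j]] continuous_map_funspace[OF cv[OF x, of j]] p a
        by (auto simp: Pi_iff)
      then have "closedin T {u j p x a}" "closedin T {v j p x a}"
        using T(2) by (simp_all add: closedin_Hausdorff_singleton)
      moreover have "disjnt {u j p x a} {v j p x a}" using ne that by (auto simp: disjnt_def)
      ultimately obtain f where "continuous_map T (top_of_set {0..1::real}) f"
          "f ` {u j p x a} \<subseteq> {0}" "f ` {v j p x a} \<subseteq> {1}"
        using norm[unfolded normal_space_iff_Urysohn, rule_format, of "{u j p x a}" "{v j p x a}"] by metis
      then show ?thesis by auto
    qed
    then obtain f where f: "\<And>j. j < N \<Longrightarrow> continuous_map T (top_of_set {0..1::real}) (f j)"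
      "\<And>j. j < N \<Longrightarrow> f j (u j p x a) = 0" "\<And>j. j < N \<Longrightarrow> f j (v j p x a) = 1" by metis
    \<comment> \<open>The difference at (p, a) itself is 1, so asking for more than 1/3 defines an
      open neighbourhood.\<close>
    define W where "W j = {z \<in> topspace (prod_topology P Q).
      f j ((\<lambda>(p, a). v j p x a) z) - f j ((\<lambda>(p, a). u j p x a) z) \<in> {1/3<..}}" for j
    have oW: "openin (prod_topology P Q) (W j)" if "j < N" for j
    proof -
      have fe: "continuous_map T euclideanreal (f j)" using f(1)[OF that] continuous_map_into_fulltopology by blast
      have "continuous_map (prod_topology P Q) euclideanreal
          (\<lambda>z. f j ((\<lambda>(p, a). v j p x a) z) - f j ((\<lambda>(p, a). u j p x a) z))"
        using continuous_map_compose[OF cv[OF x, of j] fe] continuous_map_compose[OF cu[OF x, of j] fe]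
        by (intro continuous_map_diff) (simp_all add: comp_def)
      then show ?thesis unfolding W_def by (rule openin_continuous_map_preimage) simp
    qed
    define W' where "W' = (\<Inter>j\<in>{..<N}. W j) \<inter> topspace (prod_topology P Q)"
    have "openin (prod_topology P Q) W'"
      unfolding W'_def by (rule openin_INT) (auto intro: oW)
    moreover have "(p, a) \<in> W'"
      using p a f by (auto simp: W_def W'_def)
    ultimately obtain U V where UV: "openin P U" "openin Q V" "p \<in> U" "a \<in> V"
      "U \<times> V \<subseteq> W'"
      unfolding openin_prod_topology_alt by meson
    have "sp (f ` {..<N}) p' x a'" if "p' \<in> U" "a' \<in> V" for p' a'
      unfolding sp_def
    proof (intro allI impI)
      fix j assume "j < N"
      moreover have "(p', a') \<in> (\<Inter>j\<in>{..<N}. W j)" using UV(5) that by (auto simp: W'_def)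
      ultimately have "(p', a') \<in> W j" by blast
      then show "\<exists>\<phi>\<in>f ` {..<N}. \<bar>\<phi> (u j p' x a') - \<phi> (v j p' x a')\<bar> \<ge> 1 / 3"
        using \<open>j < N\<close> by (intro bexI[of _ "f j"]) (auto simp: W_def)
    qed
    moreover have "fam (f ` {..<N})" using f by (auto simp: fam_def)
    ultimately show ?thesis using UV by blast
  qed
  have "\<exists>\<Phi>. fam \<Phi> \<and> (\<forall>p\<in>topspace P. \<exists>x\<in>S. \<forall>a\<in>topspace Q. sp \<Phi> p x a)"
  proof (rule compact_space_induct[OF P])
    fix p assume p: "p \<in> topspace P"
    then obtain x where x: "x \<in> S" "\<And>a. a \<in> topspace Q \<Longrightarrow> \<forall>j<N. u j p x a \<noteq> v j p x a" using ne by blast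
    \<comment> \<open>Each of the finitely many neighbourhoods needed in \<open>Q\<close> may shrink
      the neighbourhood of p and enlarge the family; x stays the same.\<close>
    have "\<exists>\<Phi> U. fam \<Phi> \<and> openin P U \<and> p \<in> U \<and> (\<forall>p'\<in>U. \<forall>a\<in>topspace Q. sp \<Phi> p' x a)"
    proof (rule compact_space_induct[OF Q])
      fix a assume "a \<in> topspace Q"
      from pt[OF p this x(1) x(2)[OF this]]
      show "\<exists>V. openin Q V \<and> a \<in> V \<and> (\<exists>\<Phi> U. fam \<Phi> \<and> openin P U \<and> p \<in> U \<and> (\<forall>p'\<in>U. \<forall>a\<in>V. sp \<Phi> p' x a))"
        by blast
    next
      show "\<exists>\<Phi> U. fam \<Phi> \<and> openin P U \<and> p \<in> U \<and> (\<forall>p'\<in>U. \<forall>a\<in>{}. sp \<Phi> p' x a)"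
        using p by (intro exI[of _ "{}"] exI[of _ "topspace P"]) (auto simp: fam_def)
    next
      fix V V'
      assume "\<exists>\<Phi> U. fam \<Phi> \<and> openin P U \<and> p \<in> U \<and> (\<forall>p'\<in>U. \<forall>a\<in>V. sp \<Phi> p' x a)"
        and "\<exists>\<Phi> U. fam \<Phi> \<and> openin P U \<and> p \<in> U \<and> (\<forall>p'\<in>U. \<forall>a\<in>V'. sp \<Phi> p' x a)"
      then obtain \<Phi> U \<Phi>' U' where *: "fam \<Phi>" "openin P U" "p \<in> U" "\<forall>p'\<in>U. \<forall>a\<in>V. sp \<Phi> p' x a"
         "fam \<Phi>'" "openin P U'" "p \<in> U'" "\<forall>p'\<in>U'. \<forall>a\<in>V'. sp \<Phi>' p' x a" by (elim exE conjE)
      have "\<forall>p'\<in>U \<inter> U'. \<forall>a\<in>V \<union> V'. sp (\<Phi> \<union> \<Phi>') p' x a"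
        using *(4,8) sp_mono by (meson IntE UnE Un_upper1 Un_upper2)
      then show "\<exists>\<Phi> U. fam \<Phi> \<and> openin P U \<and> p \<in> U \<and> (\<forall>p'\<in>U. \<forall>a\<in>V \<union> V'. sp \<Phi> p' x a)"
        using * famUn by (intro exI[of _ "\<Phi> \<union> \<Phi>'"] exI[of _ "U \<inter> U'"]) auto
    qed
    then show "\<exists>U. openin P U \<and> p \<in> U \<and> (\<exists>\<Phi>. fam \<Phi> \<and> (\<forall>p\<in>U. \<exists>x\<in>S. \<forall>a\<in>topspace Q. sp \<Phi> p x a))"
      using x(1) by blast
  next
    show "\<exists>\<Phi>. fam \<Phi> \<and> (\<forall>p\<in>{}. \<exists>x\<in>S. \<forall>a\<in>topspace Q. sp \<Phi> p x a)"
      by (intro exI[of _ "{}"]) (auto simp: fam_def)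
  next
    fix U V
    assume "\<exists>\<Phi>. fam \<Phi> \<and> (\<forall>p\<in>U. \<exists>x\<in>S. \<forall>a\<in>topspace Q. sp \<Phi> p x a)"
      and "\<exists>\<Phi>. fam \<Phi> \<and> (\<forall>p\<in>V. \<exists>x\<in>S. \<forall>a\<in>topspace Q. sp \<Phi> p x a)"
    then obtain \<Phi> \<Psi> where *: "fam \<Phi>" "\<forall>p\<in>U. \<exists>x\<in>S. \<forall>a\<in>topspace Q. sp \<Phi> p x a"
      "fam \<Psi>" "\<forall>p\<in>V. \<exists>x\<in>S. \<forall>a\<in>topspace Q. sp \<Psi> p x a" by (elim exE conjE)
    have "\<forall>p\<in>U \<union> V. \<exists>x\<in>S. \<forall>a\<in>topspace Q. sp (\<Phi> \<union> \<Psi>) p x a"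
    proof
      fix p assume "p \<in> U \<union> V"
      then obtain x \<Phi>' where x: "x \<in> S" "\<forall>a\<in>topspace Q. sp \<Phi>' p x a" "\<Phi>' \<subseteq> \<Phi> \<union> \<Psi>"
        using *(2,4) by (metis UnE Un_upper1 Un_upper2)
      then show "\<exists>x\<in>S. \<forall>a\<in>topspace Q. sp (\<Phi> \<union> \<Psi>) p x a"
        using sp_mono[OF _ x(3)] by (intro bexI[OF _ x(1)]) simp
    qed
    then show "\<exists>\<Phi>. fam \<Phi> \<and> (\<forall>p\<in>U \<union> V. \<exists>x\<in>S. \<forall>a\<in>topspace Q. sp \<Phi> p x a)"
      using famUn[OF *(1,3)] by (intro exI[of _ "\<Phi> \<union> \<Psi>"] conjI)
  qed
  then show ?thesis by (simp add: fam_def sp_def)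
qed

text \<open>Translations of X need not be injective, so only subinvariance can be asked for; on the
  group \<open>H\<close> it becomes invariance. \<open>D_cont\<close> makes D-balls neighbourhoods,
  so that compactness yields total boundedness.\<close>

locale invariant_pseudometric = kernel_semigroup +
  fixes D :: "'a \<Rightarrow> 'a \<Rightarrow> real"
  assumes D_refl: "x \<in> X \<Longrightarrow> D x x = 0"
    and D_sym: "\<lbrakk>x \<in> X; y \<in> X\<rbrakk> \<Longrightarrow> D x y = D y x"
    and D_tri: "\<lbrakk>x \<in> X; y \<in> X; z \<in> X\<rbrakk> \<Longrightarrow> D x z \<le> D x y + D y z"
    and D_left: "\<lbrakk>a \<in> X; x \<in> X; y \<in> X\<rbrakk> \<Longrightarrow> D (a \<odot> x) (a \<odot> y) \<le> D x y"
    and D_right: "\<lbrakk>a \<in> X; x \<in> X; y \<in> X\<rbrakk> \<Longrightarrow> D (x \<odot> a) (y \<odot> a) \<le> D x y"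
    and D_cont: "\<lbrakk>y \<in> X; r > 0\<rbrakk> \<Longrightarrow> \<exists>U. openin T U \<and> y \<in> U \<and> (\<forall>x\<in>U. D x y < r)"

section \<open>A pseudometric from countably many functions\<close>

context kernel_semigroup
begin

abbreviation TH where "TH \<equiv> subtopology T H"
abbreviation PH :: "(nat \<Rightarrow> 'a) topology" where "PH \<equiv> product_topology (\<lambda>_. TH) UNIV"

lemma topspace_TH: "topspace TH = H"
  using HX by (auto simp: topspace_subtopology)

lemma topspace_PH: "p \<in> topspace PH \<longleftrightarrow> range p \<subseteq> H"
  unfolding topspace_product_topology topspace_TH by (auto simp: PiE_def)

lemma compact_TH: "compact_space TH"
  using closedin_compact_space[OF compact closedin_H] compact_space_subtopology by blast

lemma compact_PH: "compact_space PH"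
  using compact_TH by (simp add: compact_space_product_topology)

lemma continuous_map_TH: "continuous_map TH T (\<lambda>x. x)"
  by (simp add: continuous_map_from_subtopology)

lemma continuous_map_coord: "continuous_map PH T (\<lambda>p. p i)"
  using continuous_map_compose[OF continuous_map_product_projection[of i UNIV "\<lambda>_. TH"] continuous_map_TH]
  by (simp add: comp_def)

lemma continuous_map_hpoly:
  assumes "continuous_map S PH p" "continuous_map S T f"
  shows "continuous_map S T (\<lambda>z. hpoly n (p z) (f z))"
proof (induction n)
  case 0
  then show ?case using continuous_map_compose[OF assms(1) continuous_map_coord] by (simp add: comp_def)
next
  case (Suc n)
  then show ?case using continuous_map_compose[OF assms(1) continuous_map_coord] assms(2)
    by (simp add: comp_def continuous_map_mult)
qed

text \<open>The supremum over all k and all c, d in X of the differences at c x d and c y d,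
  weighted by 2^-k, is subinvariant because a translation only restricts the pairs (c, d). On
  \<open>H\<close> the choice c = d = e recovers the functions themselves.\<close>

lemma invariant_pseudometric_of_family:
  fixes \<phi> :: "nat \<Rightarrow> 'a \<Rightarrow> real"
  assumes \<phi>: "\<And>k. continuous_map T (top_of_set {0..1}) (\<phi> k)"
  obtains D where "invariant_pseudometric T (\<odot>) e D"
    "\<And>k x y. x \<in> H \<Longrightarrow> y \<in> H \<Longrightarrow> \<bar>\<phi> k x - \<phi> k y\<bar> / 2 ^ k \<le> D x y"
proof -
  define I where "I = (UNIV :: nat set) \<times> X \<times> X"
  define F where "F x y i = (case i of (k, c, d) \<Rightarrow> \<bar>\<phi> k (c \<odot> x \<odot> d) - \<phi> k (c \<odot> y \<odot> d)\<bar> / 2 ^ k)" for x y i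
  define D where "D x y = (SUP i\<in>I. F x y i)" for x y
  have I: "I \<noteq> {}" using eX by (auto simp: I_def)
  have \<phi>01: "0 \<le> \<phi> k x \<and> \<phi> k x \<le> 1" if "x \<in> X" for k x
    using continuous_map_funspace[OF \<phi>[of k]] that by (auto simp: Pi_iff)
  have Fk: "F x y (k, c, d) \<le> 1 / 2 ^ k" if "x \<in> X" "y \<in> X" "c \<in> X" "d \<in> X" for x y k c d
  proof -
    have "\<bar>\<phi> k (c \<odot> x \<odot> d) - \<phi> k (c \<odot> y \<odot> d)\<bar> \<le> 1"
      using \<phi>01[of "c \<odot> x \<odot> d" k] \<phi>01[of "c \<odot> y \<odot> d" k] that mult_closed by (simp add: abs_le_iff)
    then show ?thesis by (simp add: F_def divide_right_mono)
  qed
  have F1: "F x y i \<le> 1" if xy: "x \<in> X" "y \<in> X" and i: "i \<in> I" for x y i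
  proof -
    obtain k c d where kcd: "i = (k, c, d)" "c \<in> X" "d \<in> X" using i by (auto simp: I_def)
    have "F x y i \<le> 1 / 2 ^ k" using Fk[OF xy kcd(2,3)] kcd(1) by simp
    also have "\<dots> \<le> 1" by simp
    finally show ?thesis .
  qed
  then have bdd: "bdd_above (F x y ` I)" if "x \<in> X" "y \<in> X" for x y using that by (intro bdd_aboveI[of _ 1]) auto
  have up: "F x y i \<le> D x y" if "x \<in> X" "y \<in> X" "i \<in> I" for x y i
    unfolding D_def using cSUP_upper[OF that(3) bdd] that by blast
  have least: "D x y \<le> b" if "\<And>i. i \<in> I \<Longrightarrow> F x y i \<le> b" for x y b
    unfolding D_def using I that by (intro cSUP_least)
  have "invariant_pseudometric T (\<odot>) e D"
  proof unfold_locales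
    fix x assume "x \<in> X" then show "D x x = 0" using I by (simp add: D_def F_def case_prod_unfold)
  next
    fix x y assume "x \<in> X" "y \<in> X" then show "D x y = D y x" unfolding D_def F_def by (simp add: abs_minus_commute)
  next
    fix x y z assume xyz: "x \<in> X" "y \<in> X" "z \<in> X"
    show "D x z \<le> D x y + D y z"
    proof (rule least)
      fix i assume i: "i \<in> I"
      obtain k c d where kcd: "i = (k, c, d)" by (cases i) auto
      have "F x z i \<le> F x y i + F y z i"
        unfolding F_def kcd by (simp add: add_divide_distrib[symmetric] divide_right_mono)
      then show "F x z i \<le> D x y + D y z" using up[OF xyz(1,2) i] up[OF xyz(2,3) i] by linarith
    qed
  next
    fix a x y assume axy: "a \<in> X" "x \<in> X" "y \<in> X"
    show "D (a \<odot> x) (a \<odot> y) \<le> D x y"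
    proof (rule least)
      fix i assume i: "i \<in> I"
      then obtain k c d where kcd: "i = (k, c, d)" "c \<in> X" "d \<in> X" by (auto simp: I_def)
      have "F (a \<odot> x) (a \<odot> y) i = F x y (k, c \<odot> a, d)"
        using axy kcd by (simp add: F_def assoc mult_closed)
      then show "F (a \<odot> x) (a \<odot> y) i \<le> D x y"
        using up[OF axy(2,3), of "(k, c \<odot> a, d)"] kcd axy mult_closed by (simp add: I_def)
    qed
    show "D (x \<odot> a) (y \<odot> a) \<le> D x y"
    proof (rule least)
      fix i assume i: "i \<in> I"
      then obtain k c d where kcd: "i = (k, c, d)" "c \<in> X" "d \<in> X" by (auto simp: I_def)
      have "F (x \<odot> a) (y \<odot> a) i = F x y (k, c, a \<odot> d)"
        using axy kcd by (simp add: F_def assoc mult_closed)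
      then show "F (x \<odot> a) (y \<odot> a) i \<le> D x y"
        using up[OF axy(2,3), of "(k, c, a \<odot> d)"] kcd axy mult_closed by (simp add: I_def)
    qed
  next
    fix y and r :: real assume y: "y \<in> X" and r: "r > 0"
    \<comment> \<open>Terms with index at least \<open>K\<close> are uniformly small since the
      functions have values in [0, 1]; the finitely many others are handled by neighbourhoods of
      y.\<close>
    obtain K where K: "(1/2) ^ K < r / 2" using real_arch_pow_inv[of "r / 2" "1 / 2"] r by auto
    have "\<exists>U. openin T U \<and> y \<in> U \<and> (\<forall>x\<in>U. \<forall>c\<in>X. \<forall>d\<in>X. \<bar>\<phi> k (c \<odot> x \<odot> d) - \<phi> k (c \<odot> y \<odot> d)\<bar> < r / 2)" for k
    proof -
      let ?TT = "prod_topology T (prod_topology T T)"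
      let ?g = "\<lambda>z. \<phi> k (fst (snd z) \<odot> fst z \<odot> snd (snd z)) - \<phi> k (fst (snd z) \<odot> y \<odot> snd (snd z))"
      have \<phi>e: "continuous_map T euclideanreal (\<phi> k)" using \<phi> continuous_map_into_fulltopology by blast
      have c1: "continuous_map ?TT T (\<lambda>z. fst (snd z))" "continuous_map ?TT T (\<lambda>z. snd (snd z))"
        "continuous_map ?TT T fst"
        using continuous_map_compose[OF continuous_map_snd continuous_map_fst, of T T T]
          continuous_map_compose[OF continuous_map_snd continuous_map_snd, of T T T]
        by (simp_all add: comp_def continuous_map_fst)
      have "continuous_map ?TT T (\<lambda>z. fst (snd z) \<odot> fst z \<odot> snd (snd z))"
        "continuous_map ?TT T (\<lambda>z. fst (snd z) \<odot> y \<odot> snd (snd z))"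
        using y c1 by (intro continuous_map_mult; simp)+
      then have cg: "continuous_map ?TT euclideanreal ?g"
        using continuous_map_compose[OF _ \<phi>e] by (intro continuous_map_diff) (simp_all add: comp_def)
      define W where "W = {z \<in> topspace ?TT. ?g z \<in> {- r / 2<..<r / 2}}"
      have "openin ?TT W"
        unfolding W_def by (rule openin_continuous_map_preimage[OF cg]) simp
      moreover have "compactin (prod_topology T T) (X \<times> X)"
        using compact compact_space_prod_topology[of T T] unfolding compact_space_def by simp
      moreover have "{y} \<times> (X \<times> X) \<subseteq> W"
        using y r by (auto simp: W_def)
      \<comment> \<open>The tube lemma makes the estimate uniform in the pairs (c, d), which range
        over a compact set.\<close>
      ultimately have "\<exists>U V. openin T U \<and> openin (prod_topology T T) V \<and> y \<in> U \<and> X \<times> X \<subseteq> V \<and> U \<times> V \<subseteq> W"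
        by (intro tube_lemma_right y)
      then obtain U V where UV: "openin T U" "y \<in> U" "X \<times> X \<subseteq> V" "U \<times> V \<subseteq> W"
        by (elim exE conjE)
      have "\<bar>\<phi> k (c \<odot> x \<odot> d) - \<phi> k (c \<odot> y \<odot> d)\<bar> < r / 2" if "x \<in> U" "c \<in> X" "d \<in> X" for x c d
      proof -
        have "(x, c, d) \<in> U \<times> V" using that UV(3) by auto
        then have "(x, c, d) \<in> W" using UV(4) by blast
        then show ?thesis by (auto simp: W_def abs_if)
      qed
      then show ?thesis using UV(1,2) by blast
    qed
    then obtain U where U: "\<And>k. openin T (U k)" "\<And>k. y \<in> U k"
      "\<And>k x c d. \<lbrakk>x \<in> U k; c \<in> X; d \<in> X\<rbrakk> \<Longrightarrow> \<bar>\<phi> k (c \<odot> x \<odot> d) - \<phi> k (c \<odot> y \<odot> d)\<bar> < r / 2" by metis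
    let ?U = "(\<Inter>k\<in>{..<K}. U k) \<inter> X"
    have "openin T ?U" by (rule openin_INT) (auto intro: U)
    moreover have "D x y < r" if x: "x \<in> ?U" for x
    proof -
      have "D x y \<le> r / 2"
      proof (rule least)
        fix i assume "i \<in> I"
        then obtain k c d where kcd: "i = (k, c, d)" "c \<in> X" "d \<in> X" by (auto simp: I_def)
        show "F x y i \<le> r / 2"
        proof (cases "k < K")
          case True
          have "F x y i \<le> \<bar>\<phi> k (c \<odot> x \<odot> d) - \<phi> k (c \<odot> y \<odot> d)\<bar>"
            unfolding F_def kcd by (simp add: divide_le_eq mult_le_cancel_left1)
          also have "\<dots> < r / 2" using U(3) x True kcd by blast
          finally show ?thesis by simp
        next
          case False
          have "F x y i \<le> 1 / 2 ^ k" using Fk[of x y c d k] kcd x y by blast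
          also have "\<dots> \<le> 1 / 2 ^ K" using False by (simp add: field_simps)
          also have "\<dots> < r / 2" using K by (simp add: power_divide)
          finally show ?thesis by simp
        qed
      qed
      then show ?thesis using r by linarith
    qed
    ultimately show "\<exists>U. openin T U \<and> y \<in> U \<and> (\<forall>x\<in>U. D x y < r)"
      using U(2) y by (intro exI[of _ ?U]) auto
  qed
  moreover have "\<bar>\<phi> k x - \<phi> k y\<bar> / 2 ^ k \<le> D x y" if "x \<in> H" "y \<in> H" for k x y
    using up[of x y "(k, e, e)"] that HX eX by (simp add: I_def F_def eH1 eH2)
  ultimately show ?thesis using that by blast
qed

text \<open>Here t indexes countably many failures, p is a parameter, x the witness of the failure
  and a an auxiliary point. Each t needs finitely many separating functions; together they are
  countably many, so one pseudometric gives a uniform lower bound for every t.\<close>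

lemma metrization:
  fixes u v :: "'t::countable \<Rightarrow> nat \<Rightarrow> (nat \<Rightarrow> 'a) \<Rightarrow> 'a \<Rightarrow> 'a \<Rightarrow> 'a"
  assumes cu: "\<And>t j x. x \<in> H \<Longrightarrow> continuous_map (prod_topology PH TH) T (\<lambda>(p, a). u t j p x a)"
    and cv: "\<And>t j x. x \<in> H \<Longrightarrow> continuous_map (prod_topology PH TH) T (\<lambda>(p, a). v t j p x a)"
    and uH: "\<And>t j p x a. \<lbrakk>range p \<subseteq> H; x \<in> H; a \<in> H\<rbrakk> \<Longrightarrow> u t j p x a \<in> H"
    and vH: "\<And>t j p x a. \<lbrakk>range p \<subseteq> H; x \<in> H; a \<in> H\<rbrakk> \<Longrightarrow> v t j p x a \<in> H"
    and ne: "\<And>t p. range p \<subseteq> H \<Longrightarrow> \<exists>x\<in>H. \<forall>a\<in>H. \<forall>j<N t. u t j p x a \<noteq> v t j p x a"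
  obtains D where "invariant_pseudometric T (\<odot>) e D"
    "\<And>t. \<exists>\<eta>>0. \<forall>p. range p \<subseteq> H \<longrightarrow> (\<exists>x\<in>H. \<forall>a\<in>H. \<forall>j<N t. \<eta> \<le> D (u t j p x a) (v t j p x a))"
proof -
  have "\<exists>\<Phi>. finite \<Phi> \<and> (\<forall>\<phi>\<in>\<Phi>. continuous_map T (top_of_set {0..1::real}) \<phi>) \<and>
    (\<forall>p\<in>topspace PH. \<exists>x\<in>H. \<forall>a\<in>topspace TH. \<forall>j<N t. \<exists>\<phi>\<in>\<Phi>. \<bar>\<phi> (u t j p x a) - \<phi> (v t j p x a)\<bar> \<ge> 1 / 3)" for t
    by (rule finite_separating_family[OF compact_PH compact_TH compact Hausdorff cu cv])
      (use ne in \<open>simp_all only: topspace_PH topspace_TH\<close>)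
  then obtain \<Phi> where \<Phi>: "\<And>t. finite (\<Phi> t)"
    "\<And>t \<phi>. \<phi> \<in> \<Phi> t \<Longrightarrow> continuous_map T (top_of_set {0..1::real}) \<phi>"
    "\<And>t p. range p \<subseteq> H \<Longrightarrow> \<exists>x\<in>H. \<forall>a\<in>H. \<forall>j<N t. \<exists>\<phi>\<in>\<Phi> t. \<bar>\<phi> (u t j p x a) - \<phi> (v t j p x a)\<bar> \<ge> 1 / 3"
    unfolding topspace_TH Ball_def topspace_PH by metis
  \<comment> \<open>The zero function makes the family nonempty, so that it can be
    enumerated.\<close>
  define \<Psi> where "\<Psi> = insert (\<lambda>_. 0) (\<Union>t. \<Phi> t)"
  have \<Psi>: "countable \<Psi>" "\<Psi> \<noteq> {}" using \<Phi>(1) by (auto simp: \<Psi>_def countable_finite)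
  have "continuous_map T (top_of_set {0..1::real}) \<phi>" if "\<phi> \<in> \<Psi>" for \<phi>
    using that \<Phi>(2) by (auto simp: \<Psi>_def continuous_map_in_subtopology)
  then have "continuous_map T (top_of_set {0..1::real}) (from_nat_into \<Psi> k)" for k
    using from_nat_into[OF \<Psi>(2)] by blast
  then obtain D where D: "invariant_pseudometric T (\<odot>) e D"
    "\<And>k x y. x \<in> H \<Longrightarrow> y \<in> H \<Longrightarrow> \<bar>from_nat_into \<Psi> k x - from_nat_into \<Psi> k y\<bar> / 2 ^ k \<le> D x y"
    using invariant_pseudometric_of_family by metis
  have "\<exists>\<eta>>0. \<forall>p. range p \<subseteq> H \<longrightarrow> (\<exists>x\<in>H. \<forall>a\<in>H. \<forall>j<N t. \<eta> \<le> D (u t j p x a) (v t j p x a))" for t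
  proof -
    \<comment> \<open>\<open>M\<close> bounds the positions in the enumeration of the functions used
      for \<open>t\<close>, so a difference of 1/3 survives the weights as
      \<open>1 / 3 / 2 ^ M\<close>.\<close>
    define M where "M = Max (insert 0 (to_nat_on \<Psi> ` \<Phi> t))"
    have M: "to_nat_on \<Psi> \<phi> \<le> M" if "\<phi> \<in> \<Phi> t" for \<phi>
      using that \<Phi>(1) by (simp add: M_def)
    have "\<exists>x\<in>H. \<forall>a\<in>H. \<forall>j<N t. 1 / 3 / 2 ^ M \<le> D (u t j p x a) (v t j p x a)" if p: "range p \<subseteq> H" for p
    proof -
      obtain x where x: "x \<in> H" "\<forall>a\<in>H. \<forall>j<N t. \<exists>\<phi>\<in>\<Phi> t. \<bar>\<phi> (u t j p x a) - \<phi> (v t j p x a)\<bar> \<ge> 1 / 3"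
        using \<Phi>(3)[OF p] by blast
      have "1 / 3 / 2 ^ M \<le> D (u t j p x a) (v t j p x a)" if aj: "a \<in> H" "j < N t" for a j
      proof -
        obtain \<phi> where \<phi>: "\<phi> \<in> \<Phi> t" "\<bar>\<phi> (u t j p x a) - \<phi> (v t j p x a)\<bar> \<ge> 1 / 3" using x aj by blast
        let ?k = "to_nat_on \<Psi> \<phi>"
        have k: "from_nat_into \<Psi> ?k = \<phi>" using \<phi>(1) \<Psi>(1) by (intro from_nat_into_to_nat_on) (auto simp: \<Psi>_def)
        have "1 / 3 / 2 ^ M \<le> 1 / 3 / (2::real) ^ ?k" using M[OF \<phi>(1)] by (intro divide_left_mono) simp_all
        also have "\<dots> \<le> \<bar>\<phi> (u t j p x a) - \<phi> (v t j p x a)\<bar> / 2 ^ ?k" using \<phi>(2) by (intro divide_right_mono) simp_all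
        also have "\<dots> \<le> D (u t j p x a) (v t j p x a)"
          using D(2)[of "u t j p x a" "v t j p x a" ?k] uH[OF p x(1) aj(1)] vH[OF p x(1) aj(1)] by (simp add: k)
        finally show ?thesis .
      qed
      then show ?thesis using x(1) by blast
    qed
    then show ?thesis by (intro exI[of _ "1 / 3 / 2 ^ M"]) simp
  qed
  then show ?thesis using that D(1) by blast
qed

end

section \<open>Covers by few polynomial fibres\<close>

context kernel_semigroup
begin

text \<open>X may lack a unit: \<open>e\<close> is only a dummy value for the empty list, and a
  one-letter list has its letter itself as product. Products are therefore joined only for nonempty
  lists.\<close>

fun lprod :: "'a list \<Rightarrow> 'a" where
  "lprod [] = e"
| "lprod [x] = x"
| "lprod (x # y # zs) = x \<odot> lprod (y # zs)"

lemma lprod_closed: "set l \<subseteq> X \<Longrightarrow> lprod l \<in> X"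
  by (induction l rule: lprod.induct) (auto simp: eX mult_closed)

lemma lprod_append:
  "u \<noteq> [] \<Longrightarrow> v \<noteq> [] \<Longrightarrow> set u \<subseteq> X \<Longrightarrow> set v \<subseteq> X \<Longrightarrow> lprod (u @ v) = lprod u \<odot> lprod v"
proof (induction u rule: lprod.induct)
  case (2 x)
  then show ?case by (cases v) auto
next
  case (3 x y zs)
  then show ?case using lprod_closed[of "y # zs"] lprod_closed[of v] by (simp add: assoc)
qed simp

text \<open>In a word over \<open>'a option\<close> the letter \<open>None\<close> stands for the variable.\<close>
definition wval :: "'a \<Rightarrow> 'a option list \<Rightarrow> 'a" where
  "wval x w = lprod (map (\<lambda>l. case l of None \<Rightarrow> x | Some a \<Rightarrow> a) w)"

lemma wval_closed: "set w \<subseteq> insert None (Some ` X) \<Longrightarrow> x \<in> X \<Longrightarrow> wval x w \<in> X"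
  unfolding wval_def by (rule lprod_closed) (auto split: option.splits)

lemma wval_snoc:
  assumes "w \<noteq> []" "set w \<subseteq> insert None (Some ` X)" "l \<in> insert None (Some ` X)" "x \<in> X"
  shows "wval x (w @ [l]) = wval x w \<odot> (case l of None \<Rightarrow> x | Some a \<Rightarrow> a)"
  unfolding wval_def map_append using assms
  by (subst lprod_append) (auto split: option.splits)

text \<open>The factor c generalizes the claim for an induction that removes the last letter: a
  constant letter is moved into c, while a variable x = e x splits off a polynomial of degree
  1.\<close>

lemma polyfun_wval_aux:
  assumes "w \<noteq> []" "set w \<subseteq> insert None (Some ` X)" "c \<in> X"
  shows "polyfun (count_list w None) (\<lambda>x. e \<odot> (wval x w \<odot> c) \<odot> e)"
  using assms
proof (induction w arbitrary: c rule: rev_induct)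
  case (snoc l w)
  have xece: "x \<odot> (e \<odot> c \<odot> e) = e \<odot> (x \<odot> c) \<odot> e" if "x \<in> H" "c \<in> X" for x c
  proof -
    have "e \<odot> (x \<odot> c) \<odot> e = (e \<odot> x) \<odot> (c \<odot> e)" "x \<odot> (e \<odot> c \<odot> e) = (x \<odot> e) \<odot> (c \<odot> e)"
      using that HX eX by (simp_all add: assoc mult_closed)
    then show ?thesis using that by (simp add: eH1 eH2)
  qed
  have px: "polyfun 1 (\<lambda>x. e \<odot> (x \<odot> c) \<odot> e)" if "c \<in> X" for c
    by (rule polyfun_cong[OF polyfun_translate(2)[OF polyfun_id retract_H[OF that]]])
      (use that xece in simp)
  show ?case
  proof (cases "w = []")
    case True
    show ?thesis
    proof (cases l)
      case None then show ?thesis using True px[OF snoc(4)] by (simp add: wval_def)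
    next
      case (Some a)
      then have "e \<odot> (a \<odot> c) \<odot> e \<in> H" using snoc retract_H mult_closed by auto
      then show ?thesis using polyfun_const True Some by (simp add: wval_def)
    qed
  next
    case False
    have w: "set w \<subseteq> insert None (Some ` X)" "l \<in> insert None (Some ` X)" using snoc(3) by auto
    show ?thesis
    proof (cases l)
      case None
      have "polyfun (count_list w None + 1) (\<lambda>x. (e \<odot> (wval x w \<odot> e) \<odot> e) \<odot> (e \<odot> (x \<odot> c) \<odot> e))"
        using polyfun_mult[OF snoc(1)[OF False w(1) eX] px[OF snoc(4)]] .
      moreover have "(e \<odot> (wval x w \<odot> e) \<odot> e) \<odot> (e \<odot> (x \<odot> c) \<odot> e) = e \<odot> (wval x (w @ [l]) \<odot> c) \<odot> e"
        if x: "x \<in> H" for x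
      proof -
        have v: "wval x w \<in> X" using wval_closed[OF w(1) HX[OF x]] .
        have "(e \<odot> (wval x w \<odot> e) \<odot> e) \<odot> (e \<odot> (x \<odot> c) \<odot> e) =
            e \<odot> (wval x w \<odot> (e \<odot> (e \<odot> (e \<odot> x)) \<odot> c)) \<odot> e"
          using v HX[OF x] eX snoc(4) by (simp add: assoc mult_closed)
        then show ?thesis using wval_snoc[OF False w HX[OF x]] None v x eX snoc(4) HX[OF x]
          by (simp add: eH1 assoc mult_closed)
      qed
      ultimately show ?thesis using None by (auto intro: polyfun_cong)
    next
      case (Some a)
      then have a: "a \<in> X" using w(2) by auto
      have "polyfun (count_list w None) (\<lambda>x. e \<odot> (wval x w \<odot> (a \<odot> c)) \<odot> e)"
        using snoc(1)[OF False w(1)] mult_closed[OF a snoc(4)] by blast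
      then have "polyfun (count_list w None) (\<lambda>x. e \<odot> (wval x (w @ [l]) \<odot> c) \<odot> e)"
        by (rule polyfun_cong)
          (use wval_snoc[OF False w] wval_closed[OF w(1)] Some a snoc(4) HX in \<open>simp add: assoc\<close>)
      then show ?thesis using Some by simp
    qed
  qed
qed simp

lemma polyfun_wval:
  assumes "w \<noteq> []" "set w \<subseteq> insert None (Some ` X)"
  shows "polyfun (count_list w None) (\<lambda>x. e \<odot> wval x w \<odot> e)"
proof (rule polyfun_cong[OF polyfun_wval_aux[OF assms eX]])
  fix x assume "x \<in> H"
  then have "wval x w \<in> X" using wval_closed assms(2) HX by blast
  then show "e \<odot> (wval x w \<odot> e) \<odot> e = e \<odot> wval x w \<odot> e" using eX ee by (simp add: assoc mult_closed)
qed

end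

section \<open>Estimates and classes modulo the pseudometric\<close>

context invariant_pseudometric
begin

lemma D_nonneg: "\<lbrakk>x \<in> X; y \<in> X\<rbrakk> \<Longrightarrow> 0 \<le> D x y"
  using D_tri[of x y x] D_refl[of x] D_sym[of x y] by simp

lemma D_mult_le:
  "\<lbrakk>x \<in> X; y \<in> X; x' \<in> X; y' \<in> X\<rbrakk> \<Longrightarrow> D (x \<odot> y) (x' \<odot> y') \<le> D x x' + D y y'"
  using D_tri[of "x \<odot> y" "x' \<odot> y" "x' \<odot> y'"] D_left[of x' y y'] D_right[of y x x']
  by (simp add: mult_closed)

lemma D_invariant:
  assumes "a \<in> H" "x \<in> H" "y \<in> H"
  shows "D (a \<odot> x) (a \<odot> y) = D x y" "D (x \<odot> a) (y \<odot> a) = D x y"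
  using D_left[of a x y] D_left[of "iv a" "a \<odot> x" "a \<odot> y"] D_right[of a x y]
    D_right[of "iv a" "x \<odot> a" "y \<odot> a"] assms HX iv_cancel ivH Hmult
  by (simp_all add: order_antisym)

text \<open>Each occurrence of the variable contributes \<open>D x y\<close> once, and coefficients
  contribute nothing by subinvariance.\<close>

lemma hpoly_Lipschitz:
  assumes "range p \<subseteq> H" "x \<in> H" "y \<in> H"
  shows "D (hpoly n p x) (hpoly n p y) \<le> n * D x y"
proof (induction n)
  case 0
  then show ?case using assms HX by (simp add: D_refl range_subsetD)
next
  case (Suc n)
  have h: "hpoly n p x \<in> H" "hpoly n p y \<in> H" "p (Suc n) \<in> H" using assms hpolyH by auto
  have "D (hpoly (Suc n) p x) (hpoly (Suc n) p y) \<le> D (hpoly n p x \<odot> x) (hpoly n p y \<odot> y)"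
    using h assms by (simp add: D_right HX Hmult)
  also have "\<dots> \<le> D (hpoly n p x) (hpoly n p y) + D x y"
    using h assms by (intro D_mult_le) (simp_all add: HX)
  also have "\<dots> \<le> n * D x y + D x y" using Suc by simp
  finally show ?case by (simp add: algebra_simps)
qed

lemma totally_bounded:
  assumes "closedin T S" "\<epsilon> > 0"
  shows "\<exists>F. finite F \<and> F \<subseteq> S \<and> (\<forall>x\<in>S. \<exists>y\<in>F. D x y < \<epsilon>)"
proof -
  have SX: "S \<subseteq> X" using assms(1) closedin_subset by blast
  then have tS: "topspace (subtopology T S) = S" by (auto simp: topspace_subtopology)
  have "compact_space (subtopology T S)"
    using closedin_compact_space[OF compact assms(1)] compact_space_subtopology by blast
  then have "\<exists>F. finite F \<and> F \<subseteq> S \<and> (\<forall>x\<in>topspace (subtopology T S). \<exists>y\<in>F. D x y < \<epsilon>)"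
  proof (rule compact_space_induct)
    fix y assume "y \<in> topspace (subtopology T S)"
    then have y: "y \<in> S" using tS by simp
    then obtain U where U: "openin T U" "y \<in> U" "\<forall>x\<in>U. D x y < \<epsilon>" using D_cont[of y \<epsilon>] SX assms(2) by blast
    have "openin (subtopology T S) (U \<inter> S)" using U(1) by (auto simp: openin_subtopology)
    then show "\<exists>U. openin (subtopology T S) U \<and> y \<in> U \<and>
         (\<exists>F. finite F \<and> F \<subseteq> S \<and> (\<forall>x\<in>U. \<exists>y\<in>F. D x y < \<epsilon>))"
      using U y by (intro exI[of _ "U \<inter> S"] conjI exI[of _ "{y}"]) auto
  next
    fix U V
    assume "\<exists>F. finite F \<and> F \<subseteq> S \<and> (\<forall>x\<in>U. \<exists>y\<in>F. D x y < \<epsilon>)"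
      and "\<exists>F. finite F \<and> F \<subseteq> S \<and> (\<forall>x\<in>V. \<exists>y\<in>F. D x y < \<epsilon>)"
    then obtain F F' where "finite F" "F \<subseteq> S" "\<forall>x\<in>U. \<exists>y\<in>F. D x y < \<epsilon>"
      "finite F'" "F' \<subseteq> S" "\<forall>x\<in>V. \<exists>y\<in>F'. D x y < \<epsilon>" by (elim exE conjE)
    then show "\<exists>F. finite F \<and> F \<subseteq> S \<and> (\<forall>x\<in>U \<union> V. \<exists>y\<in>F. D x y < \<epsilon>)"
      by (intro exI[of _ "F \<union> F'"]) auto
  qed auto
  then show ?thesis using tS by simp
qed

text \<open>A class modulo D is determined by the balls of radius 1/(k+1), about points of a
  countable dense set, that contain it; hence by a set of natural numbers.\<close>

lemma representatives:
  obtains Y where "Y \<subseteq> X" "\<And>x. x \<in> X \<Longrightarrow> \<exists>y\<in>Y. D x y = 0" "|Y| \<le>o |UNIV :: real set|"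
proof -
  have "\<exists>F. finite F \<and> F \<subseteq> X \<and> (\<forall>x\<in>X. \<exists>y\<in>F. D x y < 1 / Suc k)" for k
    by (rule totally_bounded) auto
  then obtain F where F: "\<And>k. finite (F k)" "\<And>k. F k \<subseteq> X" "\<And>k x. x \<in> X \<Longrightarrow> \<exists>y\<in>F k. D x y < 1 / Suc k"
    by metis
  define Q where "Q = (\<Union>k. F k)"
  have Q: "countable Q" "Q \<subseteq> X" using F(1,2) by (auto simp: Q_def countable_finite)
  have Q_ne: "Q \<noteq> {}" using F(3)[OF eX, of 0] unfolding Q_def by blast
  define d where "d = from_nat_into Q"
  have d: "\<exists>i. d i = q" if "q \<in> Q" for q using from_nat_into_surj[OF Q(1) that] by (simp add: d_def)
  have dX: "d i \<in> X" for i using from_nat_into[OF Q_ne] Q(2) by (auto simp: d_def)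
  define code where "code x = {prod_encode (i, k) | i k. D x (d i) < 1 / Suc k}" for x
  have code_iff: "prod_encode (i, k) \<in> code x \<longleftrightarrow> D x (d i) < 1 / Suc k" for i k x
    by (auto simp: code_def)
  have code: "D x y = 0" if xy: "x \<in> X" "y \<in> X" "code x = code y" for x y
  proof -
    have "D x y \<le> 2 / Suc k" for k
    proof -
      obtain i where i: "D x (d i) < 1 / Suc k" using F(3)[OF xy(1), of k] d by (metis Q_def UN_I UNIV_I)
      then have "D y (d i) < 1 / Suc k" using xy(3) code_iff by blast
      then show ?thesis using i D_tri[of x "d i" y] D_sym[of y "d i"] xy dX by simp
    qed
    then have "D x y / 2 \<le> inverse (real (Suc k))" for k by (simp add: field_simps)
    then have "D x y \<le> 0" using reals_Archimedean[of "D x y / 2"] by (meson half_gt_zero linorder_not_less)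
    then show ?thesis using D_nonneg xy by (simp add: order_antisym)
  qed
  \<comment> \<open>Points equivalent modulo D give equal predicates, so the choice depends only on
    the class.\<close>
  define rep where "rep x = (SOME y. y \<in> X \<and> D x y = 0)" for x
  have rep: "rep x \<in> X" "D x (rep x) = 0" if "x \<in> X" for x
    using someI[of "\<lambda>y. y \<in> X \<and> D x y = 0" x] that D_refl by (auto simp: rep_def)
  have "inj_on code (rep ` X)"
  proof (rule inj_onI, elim imageE)
    fix u v x y assume *: "code u = code v" "u = rep x" "v = rep y" "x \<in> X" "y \<in> X"
    then have uv: "D u v = 0" using code rep by blast
    have "D x z = 0 \<longleftrightarrow> D y z = 0" if "z \<in> X" for z
      using * uv rep[of x] rep[of y] that D_tri[of x u z] D_tri[of u v z] D_tri[of v y z] D_tri[of y v z] D_tri[of v u z] D_tri[of u x z]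
        D_sym[of u v] D_sym[of x u] D_sym[of y v] D_nonneg[of x z] D_nonneg[of y z] by force
    then have "(\<lambda>z. z \<in> X \<and> D x z = 0) = (\<lambda>z. z \<in> X \<and> D y z = 0)" by blast
    then show "u = v" using * by (simp add: rep_def)
  qed
  then have "|rep ` X| \<le>o |UNIV :: nat set set|" using card_of_ordLeq by blast
  moreover have "|UNIV :: nat set set| =o |UNIV :: real set|"
    using nat_sets_eqpoll_reals card_of_ordIso unfolding eqpoll_def by blast
  ultimately have "|rep ` X| \<le>o |UNIV :: real set|" using ordLeq_ordIso_trans by blast
  then show ?thesis using that[of "rep ` X"] rep by blast
qed

text \<open>
  Otherwise choose for every representative \<open>y\<close>, by transfinite recursion, a point \<open>f y \<in> H\<close> such that
  no product containing \<open>f y\<close> of earlier points agrees modulo \<open>D\<close> with a product of earlier points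
  alone.  The former products form sets \<open>I y\<close>, each multiplied into itself by all earlier points and
  by all earlier \<open>I x\<close>, so the tails of \<open>y \<mapsto> I y\<close> generate the neighbourhoods of an adjoined zero.
\<close>
lemma small_polynomial_cover:
  fixes \<C> :: "'a top_semigroup set"
  assumes C: "\<forall>S. zero_discrete S \<and> Hausdorff_semigroup S \<longrightarrow> S \<in> \<C>"
    and inj: "injectively_closed \<C> X (\<odot>)"
  shows "\<exists>\<Theta>. |\<Theta>| <o |UNIV :: real set| \<and>
    (\<forall>f b. (f, b) \<in> \<Theta> \<longrightarrow> b \<in> H \<and> (\<exists>n\<ge>1. polyfun n f)) \<and>
    (\<forall>x\<in>H. \<exists>(f, b)\<in>\<Theta>. D (f x) b = 0)"
proof (rule ccontr)
  assume none: "\<not> ?thesis"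
  have avoid: "\<exists>x\<in>H. \<forall>(f, b)\<in>\<Theta>. D (f x) b \<noteq> 0"
    if "|\<Theta>| <o |UNIV :: real set|" "\<And>f b. (f, b) \<in> \<Theta> \<Longrightarrow> b \<in> H \<and> (\<exists>n\<ge>1. polyfun n f)" for \<Theta>
    using that none by blast
  obtain Y where Y: "Y \<subseteq> X" "\<And>x. x \<in> X \<Longrightarrow> \<exists>y\<in>Y. D x y = 0" "|Y| \<le>o |UNIV :: real set|"
    using representatives by blast
  have infY: "infinite Y"
  proof
    assume "finite Y"
    \<comment> \<open>Finitely many representatives y would give finitely many equations x = e y e
      modulo D whose solutions cover \<open>H\<close>.\<close>
    let ?\<Theta> = "(\<lambda>y. (\<lambda>x. x, e \<odot> y \<odot> e)) ` Y"
    have "|?\<Theta>| <o |UNIV :: real set|" using \<open>finite Y\<close> by (simp add: ordLess_real_if_countable countable_finite)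
    moreover have "b \<in> H \<and> (\<exists>n\<ge>1. polyfun n f)" if "(f, b) \<in> ?\<Theta>" for f b
      using that Y(1) retract_H polyfun_id by blast
    ultimately obtain x where x: "x \<in> H" "\<forall>(f, b)\<in>?\<Theta>. D (f x) b \<noteq> 0" using avoid by blast
    then obtain y where y: "y \<in> Y" "D x y = 0" using Y(2) HX by blast
    have "D (e \<odot> x \<odot> e) (e \<odot> y \<odot> e) \<le> D x y"
      using D_right[of e "e \<odot> x" "e \<odot> y"] D_left[of e x y] x(1) y(1) HX Y(1) eX mult_closed by (meson order_trans subsetD)
    then have "D x (e \<odot> y \<odot> e) = 0"
      using x(1) y D_nonneg[of x "e \<odot> y \<odot> e"] retract_H HX Y(1) by (simp add: eH1 eH2 subset_iff)
    then show False using x(2) y(1) by auto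
  qed
  then have infX: "infinite X" using Y(1) finite_subset by blast
  \<comment> \<open>A well-order with the order type of a cardinal has initial segments of smaller
    cardinality, hence below the continuum.\<close>
  define r where "r = |Y|"
  have r: "Card_order r" "Field r = Y" by (simp_all add: r_def card_of_card_order_on Field_card_of)
  then have wo: "well_order_on Y r" using card_of_well_order_on[of Y] by (simp add: r_def)
  then have wf: "wf (r - Id)" and refl: "\<And>y. y \<in> Y \<Longrightarrow> (y, y) \<in> r" and trans: "trans r"
    and total: "\<And>x y. x \<in> Y \<Longrightarrow> y \<in> Y \<Longrightarrow> (x, y) \<in> r \<or> (y, x) \<in> r"
    unfolding well_order_on_def linear_order_on_def partial_order_on_def preorder_on_def
    by (auto simp: refl_on_def total_on_def) metis
  have rY: "a \<in> Y" "b \<in> Y" if "(a, b) \<in> r" for a b using that r(2) by (auto simp: Field_def)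
  \<comment> \<open>At stage y the available points are the representatives up to y, including y
    itself, and the values chosen strictly before y.\<close>
  define W where "W f y = {y'. (y', y) \<in> r} \<union> f ` {y'. (y', y) \<in> r - Id}" for f :: "'a \<Rightarrow> 'a" and y
  define ok where "ok A x \<longleftrightarrow> (\<forall>l\<in>lists (insert x A). x \<in> set l \<longrightarrow>
    (\<forall>v\<in>lists A. v \<noteq> [] \<longrightarrow> D (lprod l) (lprod v) \<noteq> 0))" for A x
  have ok_ex: "\<exists>x\<in>H. ok A x" if A: "A \<subseteq> X" "|A| <o |UNIV :: real set|" for A
  proof -
    \<comment> \<open>Each pair of a word with a variable and a constant word excludes the solutions
      of one equation, which multiplication by e on both sides turns into a polynomial equation on
      \<open>H\<close>. There are fewer than continuum many pairs.\<close>
    define ws where "ws = {w \<in> lists (insert None (Some ` A)). None \<in> set w}"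
    define vs where "vs = {v \<in> lists A. v \<noteq> []}"
    define \<Theta> where "\<Theta> = (\<lambda>(w, v). (\<lambda>x. e \<odot> wval x w \<odot> e, e \<odot> lprod v \<odot> e)) ` (ws \<times> vs)"
    have "|insert None (Some ` A)| <o |UNIV :: real set|"
      using Un_ordLess_real[of "{None}" "Some ` A"] image_ordLess[OF A(2), of Some]
      by (simp add: ordLess_real_if_countable)
    then have "|ws| <o |UNIV :: real set|"
      using lists_ordLess_real card_of_mono1[of ws] ordLeq_ordLess_trans unfolding ws_def by blast
    moreover have "|vs| <o |UNIV :: real set|"
      using lists_ordLess_real[OF A(2)] card_of_mono1[of vs] ordLeq_ordLess_trans unfolding vs_def by blast
    ultimately have "|ws \<times> vs| <o |UNIV :: real set|"
      using Times_ordLess_infinite infinite_UNIV_char_0 by blast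
    then have "|\<Theta>| <o |UNIV :: real set|" unfolding \<Theta>_def by (rule image_ordLess)
    moreover have "b \<in> H \<and> (\<exists>n\<ge>1. polyfun n f)" if fb: "(f, b) \<in> \<Theta>" for f b
    proof -
      obtain w v where wv: "w \<in> ws" "v \<in> vs" "f = (\<lambda>x. e \<odot> wval x w \<odot> e)" "b = e \<odot> lprod v \<odot> e"
        using fb by (auto simp: \<Theta>_def)
      have "set w \<subseteq> insert None (Some ` A)" using wv(1) by (auto simp: ws_def)
      then have "set w \<subseteq> insert None (Some ` X)" using A(1) by blast
      moreover have "w \<noteq> []" "count_list w None \<ge> 1"
        using wv(1) count_list_0_iff[of w None] by (auto simp: ws_def Suc_le_eq)
      ultimately have "\<exists>n\<ge>1. polyfun n f" using polyfun_wval wv(3) by blast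
      moreover have "b \<in> H" using wv(2,4) A(1) by (auto simp: vs_def intro!: retract_H lprod_closed)
      ultimately show ?thesis by blast
    qed
    ultimately obtain x where x: "x \<in> H" "\<forall>(f, b)\<in>\<Theta>. D (f x) b \<noteq> 0" using avoid by blast
    have "D (lprod l) (lprod v) \<noteq> 0" if l: "l \<in> lists (insert x A)" "x \<in> set l" and v: "v \<in> lists A" "v \<noteq> []" for l v
    proof
      assume z: "D (lprod l) (lprod v) = 0"
      define w where "w = map (\<lambda>c. if c = x then None else Some c) l"
      have "map (\<lambda>l. case l of None \<Rightarrow> x | Some a \<Rightarrow> a) w = l"
        unfolding w_def by (auto intro: map_idI)
      then have wl: "wval x w = lprod l" by (simp add: wval_def)
      have "None \<in> set w" unfolding w_def set_map using l(2) by (intro image_eqI[of _ _ x]) auto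
      moreover have "a \<in> insert None (Some ` A)" if aw: "a \<in> set w" for a
      proof -
        obtain c where "c \<in> set l" and a: "a = (if c = x then None else Some c)"
          using aw unfolding w_def set_map by blast
        then have "c \<in> insert x A" using l(1) by blast
        then show ?thesis using a by (cases "c = x") auto
      qed
      ultimately have "w \<in> ws" "v \<in> vs" using v by (auto simp only: ws_def vs_def in_lists_conv_set mem_Collect_eq)
      then have "((\<lambda>x. e \<odot> wval x w \<odot> e), e \<odot> lprod v \<odot> e) \<in> \<Theta>"
        unfolding \<Theta>_def by (intro image_eqI[of _ _ "(w, v)"]) auto
      then have "D (e \<odot> lprod l \<odot> e) (e \<odot> lprod v \<odot> e) \<noteq> 0" using x(2) wl by fastforce
      moreover have lv: "lprod l \<in> X" "lprod v \<in> X"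
        using l v A(1) HX[OF x(1)] by (auto intro!: lprod_closed)
      then have "D (e \<odot> lprod l \<odot> e) (e \<odot> lprod v \<odot> e) \<le> D (lprod l) (lprod v)"
        using D_right[of e "e \<odot> lprod l" "e \<odot> lprod v"] D_left[of e "lprod l" "lprod v"] eX mult_closed
        by (meson order_trans)
      ultimately show False
        using z D_nonneg[of "e \<odot> lprod l \<odot> e" "e \<odot> lprod v \<odot> e"] lv eX mult_closed by simp
    qed
    then show ?thesis using x(1) unfolding ok_def by blast
  qed
  have "\<exists>f. \<forall>y. y \<in> Y \<longrightarrow> f y \<in> H \<and> ok (W f y) (f y)"
  proof (rule dependent_wf_choice[OF wf])
    fix f g :: "'a \<Rightarrow> 'a" and y x
    assume "\<And>z. (z, y) \<in> r - Id \<Longrightarrow> f z = g z"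
    then have "W f y = W g y" unfolding W_def by (metis (no_types, lifting) image_cong mem_Collect_eq)
    then show "(y \<in> Y \<longrightarrow> x \<in> H \<and> ok (W f y) x) = (y \<in> Y \<longrightarrow> x \<in> H \<and> ok (W g y) x)" by simp
  next
    fix y and f :: "'a \<Rightarrow> 'a"
    assume IH: "\<And>z. (z, y) \<in> r - Id \<Longrightarrow> z \<in> Y \<longrightarrow> f z \<in> H \<and> ok (W f z) (f z)"
    show "\<exists>x. y \<in> Y \<longrightarrow> x \<in> H \<and> ok (W f y) x"
    proof (cases "y \<in> Y")
      case True
      have "W f y \<subseteq> X" using IH rY Y(1) HX unfolding W_def by blast
      moreover have "|W f y| <o |UNIV :: real set|"
      proof -
        have "underS r y = {y'. (y', y) \<in> r - Id}" by (auto simp: underS_def)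
        then have u: "|{y'. (y', y) \<in> r - Id}| <o |UNIV :: real set|"
          using card_of_underS[OF r(1), of y] True r(2) Y(3) ordLess_ordLeq_trans unfolding r_def by metis
        moreover have "{y'. (y', y) \<in> r} \<subseteq> {y'. (y', y) \<in> r - Id} \<union> {y}" by auto
        ultimately have "|{y'. (y', y) \<in> r}| <o |UNIV :: real set|"
          using Un_ordLess_real[OF u, of "{y}"] card_of_mono1 ordLeq_ordLess_trans
          by (metis countable_finite finite.emptyI finite_insert ordLess_real_if_countable)
        then show ?thesis unfolding W_def using image_ordLess[OF u] Un_ordLess_real by blast
      qed
      ultimately show ?thesis using ok_ex by blast
    qed simp
  qed
  then obtain f where f: "\<And>y. y \<in> Y \<Longrightarrow> f y \<in> H" "\<And>y. y \<in> Y \<Longrightarrow> ok (W f y) (f y)" by blast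
  define V where "V y = W f y" for y
  define I where "I y = {lprod l | l. l \<in> lists (insert (f y) (V y)) \<and> f y \<in> set l}" for y
  \<comment> \<open>\<open>N c\<close> is saturated modulo D, since only representatives, and not
    all points of X, take part in the recursion.\<close>
  define N where "N c = {x \<in> X. \<exists>y\<in>Y. (c, y) \<in> r \<and> (\<exists>u\<in>I y. D x u = 0)}" for c
  have VX: "insert (f y) (V y) \<subseteq> X" if "y \<in> Y" for y
    using that f(1) rY Y(1) HX unfolding V_def W_def by blast
  have IX: "I y \<subseteq> X" if "y \<in> Y" for y
  proof
    fix u assume "u \<in> I y"
    then obtain l where "u = lprod l" "set l \<subseteq> insert (f y) (V y)" by (auto simp: I_def)
    then show "u \<in> X" using lprod_closed[of l] VX[OF that] by blast
  qed
  have V_mono: "insert (f x) (V x) \<subseteq> insert (f y) (V y)" if "(x, y) \<in> r" for x y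
  proof (cases "x = y")
    case False
    then have "f x \<in> V y" using that by (auto simp: V_def W_def)
    moreover have "V x \<subseteq> V y"
    proof
      fix z assume "z \<in> V x"
      then consider "(z, x) \<in> r" | y' where "z = f y'" "(y', x) \<in> r" by (auto simp: V_def W_def)
      then show "z \<in> V y"
      proof cases
        case 1 then show ?thesis using trans that by (auto simp: V_def W_def dest: transD)
      next
        case 2
        have "antisym r" using wo by (simp add: well_order_on_def linear_order_on_def partial_order_on_def)
        then have "(y', y) \<in> r - Id" using 2 that trans False by (auto dest: transD antisymD)
        then show ?thesis using 2 by (auto simp: V_def W_def)
      qed
    qed
    ultimately show ?thesis by blast
  qed simp
  have I_app: "lprod k \<odot> u \<in> I y" "u \<odot> lprod k \<in> I y"
    if u: "u \<in> I y" and k: "k \<noteq> []" "k \<in> lists (insert (f y) (V y))" and y: "y \<in> Y" for u k y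
  proof -
    obtain l where l: "u = lprod l" "l \<in> lists (insert (f y) (V y))" "f y \<in> set l" using u by (auto simp: I_def)
    then have "l \<noteq> []" "set l \<subseteq> X" "set k \<subseteq> X" using k VX[OF y] by auto
    then have eq: "lprod k \<odot> u = lprod (k @ l)" "u \<odot> lprod k = lprod (l @ k)" using k l by (simp_all add: lprod_append)
    show "lprod k \<odot> u \<in> I y" unfolding eq I_def using k l by (intro CollectI exI[of _ "k @ l"]) auto
    show "u \<odot> lprod k \<in> I y" unfolding eq I_def using k l by (intro CollectI exI[of _ "l @ k"]) auto
  qed
  \<comment> \<open>A word of the earlier stage uses only letters allowed at the later stage; joined
    to a word containing \<open>f y\<close>, it gives a word that still contains
    \<open>f y\<close>.\<close>
  have I_le: "a \<odot> u \<in> I y \<and> u \<odot> a \<in> I y" if a: "a \<in> I x" and u: "u \<in> I y" and xy: "(x, y) \<in> r" for a u x y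
  proof -
    obtain l where l: "a = lprod l" "l \<in> lists (insert (f x) (V x))" "f x \<in> set l" using a by (auto simp: I_def)
    then have "l \<in> lists (insert (f y) (V y))" "l \<noteq> []" using V_mono[OF xy] by auto
    then show ?thesis using I_app[OF u] rY(2)[OF xy] l(1) by blast
  qed
  have N_anti: "N y \<subseteq> N x" if "(x, y) \<in> r" for x y
    using that trans unfolding N_def by (blast dest: transD)
  have max: "\<exists>z\<in>Y. (x, z) \<in> r \<and> (y, z) \<in> r" if "x \<in> Y" "y \<in> Y" for x y
    using that total refl by blast
  have NE: thesis if "x \<in> N c" and "\<And>y u. \<lbrakk>x \<in> X; y \<in> Y; (c, y) \<in> r; u \<in> I y; u \<in> X; D x u = 0\<rbrakk> \<Longrightarrow> thesis" for x c thesis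
  proof -
    obtain y u where "x \<in> X" "y \<in> Y" "(c, y) \<in> r" "u \<in> I y" "D x u = 0" using \<open>x \<in> N c\<close> by (auto simp: N_def)
    then show thesis using that(2) IX by blast
  qed
  have NI: "x \<in> N c" if "x \<in> X" "y \<in> Y" "(c, y) \<in> r" "u \<in> I y" "D x u = 0" for x c y u
    using that by (auto simp: N_def)
  have prod0: "D (a \<odot> x) (b \<odot> y) = 0" if "a \<in> X" "b \<in> X" "x \<in> X" "y \<in> X" "D a b = 0" "D x y = 0" for a b x y
    using D_mult_le[of a x b y] D_nonneg[of "a \<odot> x" "b \<odot> y"] that by (simp add: mult_closed)
  show False
  proof (rule injectively_closed_no_zero_base[OF C inj _ infX, of "N ` Y"])
    show "semigroup_on X (\<odot>)" by (simp add: semigroup_on_def mult_closed assoc)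
    show "N ` Y \<noteq> {}" using infY by auto
    show "\<forall>U\<in>N ` Y. U \<noteq> {} \<and> U \<subseteq> X"
    proof
      fix U assume "U \<in> N ` Y"
      then obtain y where y: "y \<in> Y" "U = N y" by blast
      have "f y \<in> I y" unfolding I_def by (intro CollectI exI[of _ "[f y]"]) simp
      then have "f y \<in> N y" using NI[of "f y" y y "f y"] y(1) refl f(1) HX D_refl by blast
      then show "U \<noteq> {} \<and> U \<subseteq> X" using y by (auto simp: N_def)
    qed
    show "\<forall>U\<in>N ` Y. \<forall>U'\<in>N ` Y. \<exists>U''\<in>N ` Y. U'' \<subseteq> U \<inter> U'"
    proof (intro ballI, elim imageE)
      fix U U' x y assume *: "U = N x" "U' = N y" "x \<in> Y" "y \<in> Y"
      then obtain z where "z \<in> Y" "(x, z) \<in> r" "(y, z) \<in> r" using max by blast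
      then show "\<exists>U''\<in>N ` Y. U'' \<subseteq> U \<inter> U'" using N_anti * by (intro bexI[of _ "N z"]) auto
    qed
    show "\<forall>b\<in>X. \<exists>U\<in>N ` Y. b \<notin> U"
    proof
      fix b assume b: "b \<in> X"
      then obtain y where y: "y \<in> Y" "D b y = 0" using Y(2) by blast
      \<comment> \<open>The one-letter word \<open>[y]\<close> is among the constant words avoided
        at every stage z from y on, so no point of \<open>I z\<close> agrees with b modulo
        D.\<close>
      have "b \<notin> N y"
      proof
        assume "b \<in> N y"
        then obtain z u where z: "z \<in> Y" "(y, z) \<in> r" "u \<in> I z" "u \<in> X" "D b u = 0" by (rule NE)
        obtain l where l: "u = lprod l" "l \<in> lists (insert (f z) (W f z))" "f z \<in> set l"
          using z(3) by (auto simp: I_def V_def)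
        have "[y] \<in> lists (W f z)" using z(2) by (auto simp: W_def)
        then have "D u (lprod [y]) \<noteq> 0"
          using f(2)[OF z(1), unfolded ok_def, rule_format, OF l(2,3), of "[y]"] l(1) by simp
        then have "D u y \<noteq> 0" by simp
        moreover have "D u y \<le> D u b + D b y" using z(4) b subsetD[OF Y(1) y(1)] by (intro D_tri)
        ultimately show False using D_sym[of u b] z(4,5) b y(2) D_nonneg[of u y] subsetD[OF Y(1) y(1)] by simp
      qed
      then show "\<exists>U\<in>N ` Y. b \<notin> U" using y(1) by blast
    qed
    show "\<forall>a\<in>X. \<forall>U\<in>N ` Y. \<exists>U'\<in>N ` Y. \<forall>w\<in>U'. a \<odot> w \<in> U \<and> w \<odot> a \<in> U"
    proof (intro ballI, elim imageE)
      fix a U c assume a: "a \<in> X" and U: "U = N c" "c \<in> Y"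
      obtain y where y: "y \<in> Y" "D a y = 0" using Y(2) a by blast
      obtain d where d: "d \<in> Y" "(c, d) \<in> r" "(y, d) \<in> r" using max U(2) y(1) by blast
      have "a \<odot> w \<in> U \<and> w \<odot> a \<in> U" if "w \<in> N d" for w
      proof (rule NE[OF that])
        fix z u assume z: "w \<in> X" "z \<in> Y" "(d, z) \<in> r" "u \<in> I z" "u \<in> X" "D w u = 0"
        have cz: "(c, z) \<in> r" and yz: "(y, z) \<in> r" using d z(3) trans by (auto dest: transD)
        have "[y] \<in> lists (insert (f z) (V z))" using yz by (auto simp: V_def W_def)
        then have "y \<odot> u \<in> I z" "u \<odot> y \<in> I z" using I_app[OF z(4) _ _ z(2), of "[y]"] by auto
        moreover have "D (a \<odot> w) (y \<odot> u) = 0" "D (w \<odot> a) (u \<odot> y) = 0"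
          using prod0 a z y Y(1) by (auto simp: subset_iff)
        ultimately show ?thesis unfolding U(1)
          using NI[OF _ z(2) cz] mult_closed a z(1) by blast
      qed
      then show "\<exists>U'\<in>N ` Y. \<forall>w\<in>U'. a \<odot> w \<in> U \<and> w \<odot> a \<in> U" using d(1) by blast
    qed
    show "\<forall>U\<in>N ` Y. \<exists>U'\<in>N ` Y. \<forall>w\<in>U'. \<forall>w'\<in>U'. w \<odot> w' \<in> U"
    proof (intro ballI, elim imageE)
      fix U c assume U: "U = N c" "c \<in> Y"
      have "w \<odot> w' \<in> U" if w: "w \<in> N c" "w' \<in> N c" for w w'
      proof (rule NE[OF w(1)], rule NE[OF w(2)])
        fix z u z' u' assume z: "w \<in> X" "z \<in> Y" "(c, z) \<in> r" "u \<in> I z" "u \<in> X" "D w u = 0"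
          and z': "w' \<in> X" "z' \<in> Y" "(c, z') \<in> r" "u' \<in> I z'" "u' \<in> X" "D w' u' = 0"
        have "D (w \<odot> w') (u \<odot> u') = 0" using prod0 z z' by blast
        \<comment> \<open>The set \<open>I\<close> at the larger of the two stages absorbs the other
          factor, so the same index c works.\<close>
        moreover have "u \<odot> u' \<in> I z \<or> u \<odot> u' \<in> I z'"
          using total[OF z(2) z'(2)] I_le[OF z(4) z'(4)] I_le[OF z'(4) z(4)] by blast
        ultimately show ?thesis unfolding U(1) using NI z z' mult_closed by blast
      qed
      then show "\<exists>U'\<in>N ` Y. \<forall>w\<in>U'. \<forall>w'\<in>U'. w \<odot> w' \<in> U" using U by blast
    qed
  qed
qed

end

section \<open>Binary trees and subdivisions of the unit interval\<close>

text \<open>Integer translates of a cover of [0, 1] cover the line, and countably many translates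
  keep the cardinality below the continuum.\<close>

lemma covering_number_unit_interval:
  fixes \<I> \<B> :: "real set set"
  assumes cov: "cov \<I> =o continuum"
    and trans: "\<And>B (k::int). B \<in> \<B> \<Longrightarrow> (+) (of_int k) ` B \<in> \<I>"
    and unit: "{0..1} \<subseteq> \<Union>\<B>"
  shows "\<not> |\<B>| <o |UNIV :: real set|"
proof
  assume "|\<B>| <o |UNIV :: real set|"
  moreover have "|UNIV :: int set| <o |UNIV :: real set|" by (simp add: ordLess_real_if_countable)
  ultimately have "|(UNIV :: int set) \<times> \<B>| <o |UNIV :: real set|"
    using Times_ordLess_infinite infinite_UNIV_char_0 by blast
  moreover define \<A> where "\<A> = (\<lambda>(k::int, B). (+) (of_int k :: real) ` B) ` (UNIV \<times> \<B>)"
  ultimately have small: "|\<A>| <o |UNIV :: real set|" using image_ordLess by blast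
  have "x \<in> \<Union>\<A>" for x
  proof -
    have "frac x \<in> {0..1}" by (simp add: frac_lt_1 less_imp_le)
    then obtain B where B: "B \<in> \<B>" "frac x \<in> B" using unit by blast
    have "x = of_int \<lfloor>x\<rfloor> + frac x" by (simp add: frac_def)
    then have "x \<in> (+) (of_int \<lfloor>x\<rfloor>) ` B" using B(2) by (metis imageI)
    moreover have "(+) (of_int \<lfloor>x\<rfloor>) ` B \<in> \<A>"
      unfolding \<A>_def using B(1) by (intro image_eqI[of _ _ "(\<lfloor>x\<rfloor>, B)"]) auto
    ultimately show ?thesis by blast
  qed
  moreover have "\<A> \<subseteq> \<I>" using trans by (auto simp: \<A>_def)
  ultimately have "cov \<I> \<le>o |\<A>|" by (intro cov_least) (auto simp: cover_by_def)
  then have "cov \<I> <o |UNIV :: real set|" using small ordLeq_ordLess_trans by blast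
  then have "cov \<I> <o cov \<I>"
    using cov ordIso_symmetric ordLess_ordIso_trans unfolding continuum_def by blast
  then show False using ordLess_irreflexive by blast
qed

text \<open>
  A mass distribution on the binary tree splits the unit interval into consecutive intervals at
  every level.  Nodes are listed with the most recent digit first.
\<close>
locale tree_weight =
  fixes w :: "bool list \<Rightarrow> real"
  assumes w_Nil: "w [] = 1" and w_nonneg: "0 \<le> w s" and w_split: "w s = w (False # s) + w (True # s)"
begin

primrec lo :: "bool list \<Rightarrow> real" where
  "lo [] = 0"
| "lo (b # s) = lo s + (if b then w (False # s) else 0)"

definition ivl :: "bool list \<Rightarrow> real set" where "ivl s = {lo s..lo s + w s}"

lemma ivl_split: "x \<in> ivl s \<Longrightarrow> \<exists>b. x \<in> ivl (b # s)"
  using w_split[of s] by (cases "x \<le> lo s + w (False # s)") (force simp: ivl_def)+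

lemma ivl_Cons: "ivl (b # s) \<subseteq> ivl s"
  using w_split[of s] w_nonneg[of "False # s"] w_nonneg[of "True # s"] by (auto simp: ivl_def)

lemma ivl_append: "ivl (t @ s) \<subseteq> ivl s"
  using ivl_Cons by (induction t) fastforce+

lemma ivl_separated:
  "length s = length t \<Longrightarrow> s \<noteq> t \<Longrightarrow> lo s + w s \<le> lo t \<or> lo t + w t \<le> lo s"
proof (induction s arbitrary: t)
  case (Cons b s)
  obtain c t' where t: "t = c # t'" using Cons(2) by (cases t) auto
  show ?case
  proof (cases "s = t'")
    case True
    then show ?thesis using Cons(3) t by (cases b; cases c) auto
  next
    case False
    then have "lo s + w s \<le> lo t' \<or> lo t' + w t' \<le> lo s" using Cons t by auto
    then show ?thesis
      using t w_split[of s] w_split[of t'] w_nonneg[of "False # s"] w_nonneg[of "True # s"]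
        w_nonneg[of "False # t'"] w_nonneg[of "True # t'"] by auto
  qed
qed simp

text \<open>When M s says that the piece at node s meets a set A, this set of reals stands for A.
  The node may be chosen afresh at each level; no single branch is asked for, so the set is an
  intersection of finite unions of closed intervals.\<close>

definition trace :: "(bool list \<Rightarrow> bool) \<Rightarrow> real set" where
  "trace M = {x \<in> {0..1}. \<forall>n. \<exists>s. length s = n \<and> x \<in> ivl s \<and> M s}"

lemma finite_level: "finite {s :: bool list. length s = n \<and> M s}"
  using finite_lists_length_eq[of "UNIV :: bool set" n] by (rule rev_finite_subset) auto

lemma trace_eq: "trace M = {0..1} \<inter> (\<Inter>n. \<Union>s\<in>{s. length s = n \<and> M s}. ivl s)"
  by (auto simp: trace_def)

lemma closed_trace: "closed (trace M)"
  unfolding trace_eq using finite_level by (intro closed_Int closed_INT ballI closed_UN) (auto simp: ivl_def)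

text \<open>Each level covers the trace by finitely many intervals whose total length is the total
  weight of the marked nodes.\<close>

lemma null_trace:
  assumes "\<And>\<epsilon>. \<epsilon> > 0 \<Longrightarrow> \<exists>n. sum w {s. length s = n \<and> M s} \<le> \<epsilon>"
  shows "trace M \<in> null_sets lebesgue"
  unfolding negligible_iff_null_sets[symmetric] negligible_outer_le
proof (intro allI impI)
  fix \<epsilon> :: real assume "\<epsilon> > 0"
  then obtain n where n: "sum w {s. length s = n \<and> M s} \<le> \<epsilon>" using assms by blast
  let ?L = "{s. length s = n \<and> M s}"
  have m: "ivl s \<in> lmeasurable" for s by (simp add: ivl_def)
  then have "(\<Union>s\<in>?L. ivl s) \<in> lmeasurable" using finite_level by (intro fmeasurable.finite_UN) auto
  moreover have "measure lebesgue (\<Union>s\<in>?L. ivl s) \<le> (\<Sum>s\<in>?L. measure lebesgue (ivl s))"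
    using finite_level m by (intro measure_UNION_le) (auto simp: fmeasurableD)
  moreover have "measure lebesgue (ivl s) = w s" for s using w_nonneg by (simp add: ivl_def)
  ultimately show "\<exists>T. trace M \<subseteq> T \<and> T \<in> lmeasurable \<and> measure lebesgue T \<le> \<epsilon>"
    using n by (intro exI[of _ "\<Union>s\<in>?L. ivl s"]) (auto simp: trace_eq)
qed

end

section \<open>Closures and open sets modulo the pseudometric, and a tree of closed pieces\<close>

context invariant_pseudometric
begin

definition Dcl :: "'a set \<Rightarrow> 'a set" where
  "Dcl U = {x \<in> H. \<forall>r>0. \<exists>u\<in>U. D x u < r}"

definition Dopen :: "'a set \<Rightarrow> bool" where
  "Dopen U \<longleftrightarrow> U \<subseteq> H \<and> (\<forall>x\<in>U. \<exists>r>0. \<forall>y\<in>H. D x y < r \<longrightarrow> y \<in> U)"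

lemma Dcl_H: "Dcl U \<subseteq> H" by (auto simp: Dcl_def)

lemma DclD: "x \<in> Dcl U \<Longrightarrow> r > 0 \<Longrightarrow> \<exists>u\<in>U. D x u < r" by (simp add: Dcl_def)

lemma not_DclD: "x \<in> H \<Longrightarrow> x \<notin> Dcl U \<Longrightarrow> \<exists>r>0. \<forall>u\<in>U. r \<le> D x u"
  by (auto simp: Dcl_def not_less)

lemma Dcl_mono: "U \<subseteq> V \<Longrightarrow> Dcl U \<subseteq> Dcl V" unfolding Dcl_def by blast

lemma subset_Dcl: assumes "U \<subseteq> H" shows "U \<subseteq> Dcl U"
proof
  fix x assume "x \<in> U"
  then have "D x x = 0" "x \<in> H" using assms HX D_refl by auto
  then show "x \<in> Dcl U" using \<open>x \<in> U\<close> by (auto simp: Dcl_def intro!: bexI[of _ x])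
qed

lemma closedin_Dcl: assumes "U \<subseteq> H" shows "closedin T (Dcl U)"
proof -
  have "openin T (X - Dcl U)"
  proof (subst openin_subopen, intro ballI)
    fix x assume x: "x \<in> X - Dcl U"
    show "\<exists>V. openin T V \<and> x \<in> V \<and> V \<subseteq> X - Dcl U"
    proof (cases "x \<in> H")
      case False
      then show ?thesis using x closedin_H Dcl_H by (intro exI[of _ "X - H"]) (auto simp: closedin_def)
    next
      case True
      then obtain r where r: "r > 0" "\<forall>u\<in>U. r \<le> D x u" using x not_DclD by blast
      obtain V where V: "openin T V" "x \<in> V" "\<forall>y\<in>V. D y x < r / 2" using D_cont[of x "r / 2"] x r(1) by auto
      have "y \<notin> Dcl U" if y: "y \<in> V" for y
      proof
        assume "y \<in> Dcl U"
        then obtain u where u: "u \<in> U" "D y u < r / 2" "y \<in> H"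
          using DclD[of y U "r / 2"] r(1) Dcl_H by auto
        have "D x u \<le> D x y + D y u" "D x y = D y x" using u assms x HX by (auto intro!: D_tri D_sym)
        then show False using u V(3) y r(2) by fastforce
      qed
      then show ?thesis using V openin_subset[OF V(1)] by blast
    qed
  qed
  moreover have "Dcl U \<subseteq> X" using Dcl_H HX by blast
  ultimately show ?thesis by (simp add: closedin_def)
qed

lemma Dopen_Diff_Dcl: assumes "Dopen U" "V \<subseteq> H" shows "Dopen (U - Dcl V)"
  unfolding Dopen_def
proof (intro conjI ballI)
  show "U - Dcl V \<subseteq> H" using assms by (auto simp: Dopen_def)
  fix x assume x: "x \<in> U - Dcl V"
  then obtain r where r: "r > 0" "\<forall>y\<in>H. D x y < r \<longrightarrow> y \<in> U" using assms(1) by (auto simp: Dopen_def)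
  have xH: "x \<in> H" using x assms by (auto simp: Dopen_def)
  obtain q where q: "q > 0" "\<forall>v\<in>V. q \<le> D x v" using x xH not_DclD by blast
  have "y \<in> U - Dcl V" if y: "y \<in> H" "D x y < min r (q / 2)" for y
  proof -
    have "y \<notin> Dcl V"
    proof
      assume "y \<in> Dcl V"
      then obtain v where v: "v \<in> V" "D y v < q / 2" using q(1) DclD[of y V "q / 2"] by auto
      then show False using D_tri[of x y v] q(2) y xH HX assms(2) by fastforce
    qed
    then show ?thesis using y r by auto
  qed
  then show "\<exists>r>0. \<forall>y\<in>H. D x y < r \<longrightarrow> y \<in> U - Dcl V"
    using r(1) q(1) by (intro exI[of _ "min r (q / 2)"]) simp
qed

lemma Dopen_ball: assumes "q \<in> H" shows "Dopen {x \<in> H. D x q < r}"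
  unfolding Dopen_def
proof (intro conjI ballI)
  fix x assume x: "x \<in> {x \<in> H. D x q < r}"
  have "D y q < r" if "y \<in> H" "D x y < r - D x q" for y
    using that x assms D_tri[of y x q] D_sym[of x y] HX by simp
  then show "\<exists>r'>0. \<forall>y\<in>H. D x y < r' \<longrightarrow> y \<in> {x \<in> H. D x q < r}"
    using x by (intro exI[of _ "r - D x q"]) auto
qed auto

lemma Dopen_Int: assumes "Dopen U" "Dopen V" shows "Dopen (U \<inter> V)"
  unfolding Dopen_def
proof (intro conjI ballI)
  show "U \<inter> V \<subseteq> H" using assms by (auto simp: Dopen_def)
  fix x assume "x \<in> U \<inter> V"
  then obtain r r' where "r > 0" "\<forall>y\<in>H. D x y < r \<longrightarrow> y \<in> U" "r' > 0" "\<forall>y\<in>H. D x y < r' \<longrightarrow> y \<in> V"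
    using assms unfolding Dopen_def by blast
  then show "\<exists>r>0. \<forall>y\<in>H. D x y < r \<longrightarrow> y \<in> U \<inter> V" by (intro exI[of _ "min r r'"]) auto
qed

text \<open>Balls of radius 1/(k+1) about finite nets are listed in one sequence; an initial segment
  containing the k-th net serves all points of \<open>H\<close> at once.\<close>

lemma ball_sequence:
  obtains q :: "nat \<Rightarrow> 'a" and \<rho> :: "nat \<Rightarrow> real"
  where "range q \<subseteq> H" "\<forall>\<epsilon>>0. \<exists>n. \<forall>x\<in>H. \<exists>i<n. \<rho> i < \<epsilon> \<and> D x (q i) < \<rho> i"
proof -
  have "\<exists>F. finite F \<and> F \<subseteq> H \<and> (\<forall>x\<in>H. \<exists>y\<in>F. D x y < 1 / Suc k)" for k
    by (rule totally_bounded[OF closedin_H]) auto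
  then obtain F where F: "\<And>k. finite (F k)" "\<And>k. F k \<subseteq> H" "\<And>k x. x \<in> H \<Longrightarrow> \<exists>y\<in>F k. D x y < 1 / Suc k"
    by metis
  define Q where "Q = (\<Union>k. (\<lambda>y. (y, 1 / real (Suc k))) ` F k)"
  have Q: "countable Q" using F(1) by (auto simp: Q_def countable_finite)
  have Q_ne: "Q \<noteq> {}" using F(3)[OF eH, of 0] unfolding Q_def by blast
  have QH: "fst z \<in> H" if "z \<in> Q" for z using that subsetD[OF F(2)] by (auto simp: Q_def)
  define g where "g = from_nat_into Q"
  show ?thesis
  proof
    show "range (\<lambda>i. fst (g i)) \<subseteq> H" using QH[OF from_nat_into[OF Q_ne]] by (auto simp: g_def)
    show "\<forall>\<epsilon>>0. \<exists>n. \<forall>x\<in>H. \<exists>i<n. snd (g i) < \<epsilon> \<and> D x (fst (g i)) < snd (g i)"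
    proof (intro allI impI)
      fix \<epsilon> :: real assume "\<epsilon> > 0"
      then obtain k where k: "1 / real (Suc k) < \<epsilon>" using reals_Archimedean[of \<epsilon>] by (auto simp: inverse_eq_divide)
      define n where "n = Suc (Max (insert 0 (to_nat_on Q ` (\<lambda>y. (y, 1 / real (Suc k))) ` F k)))"
      have "\<exists>i<n. snd (g i) < \<epsilon> \<and> D x (fst (g i)) < snd (g i)" if x: "x \<in> H" for x
      proof -
        obtain y where y: "y \<in> F k" "D x y < 1 / Suc k" using F(3)[OF x] by blast
        let ?z = "(y, 1 / real (Suc k))"
        have "g (to_nat_on Q ?z) = ?z" unfolding g_def using y(1) by (intro from_nat_into_to_nat_on Q) (auto simp: Q_def)
        moreover have "to_nat_on Q ?z < n" using y(1) F(1) by (simp add: n_def less_Suc_eq_le)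
        ultimately show ?thesis using k y(2) by (intro exI[of _ "to_nat_on Q ?z"]) simp
      qed
      then show "\<exists>n. \<forall>x\<in>H. \<exists>i<n. snd (g i) < \<epsilon> \<and> D x (fst (g i)) < snd (g i)" by blast
    qed
  qed
qed

text \<open>At level i a D-open set is cut by the i-th ball into the part inside the ball and the
  part outside its closure; \<open>C\<close> consists of the closures of these sets
  \<open>U\<close>. Nonempty open sets at all nodes later provide points off a set without
  interior.\<close>

lemma binary_tree:
  obtains U C :: "bool list \<Rightarrow> 'a set" where
    "C [] = H" "\<And>s. C s = C (False # s) \<union> C (True # s)" "\<And>s. closedin T (C s)" "\<And>s. C s \<noteq> {}"
    "\<And>\<epsilon>. \<epsilon> > 0 \<Longrightarrow> \<exists>n. \<forall>s. n \<le> length s \<longrightarrow> (\<forall>x\<in>C s. \<forall>y\<in>C s. D x y < \<epsilon>)"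
    "\<And>s. U s \<subseteq> C s" "\<And>s. Dopen (U s)" "\<And>s. U s \<noteq> {}"
proof -
  obtain q :: "nat \<Rightarrow> 'a" and \<rho> :: "nat \<Rightarrow> real" where q: "range q \<subseteq> H" and
    balls: "\<forall>\<epsilon>>0. \<exists>n. \<forall>x\<in>H. \<exists>i<n. \<rho> i < \<epsilon> \<and> D x (q i) < \<rho> i"
    by (rule ball_sequence)
  define B where "B i = {x \<in> H. D x (q i) < \<rho> i}" for i :: nat
  have B: "Dopen (B i)" "B i \<subseteq> H" for i using q Dopen_ball by (auto simp: B_def range_subsetD)
  \<comment> \<open>If one of the two parts is empty, both children keep the whole set, so all nodes
    stay nonempty and siblings may coincide.\<close>
  define U where "U = rec_list H (\<lambda>b s V.
    if V \<inter> B (length s) = {} \<or> V - Dcl (B (length s)) = {} then V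
    else if b then V \<inter> B (length s) else V - Dcl (B (length s)))"
  have U0: "U [] = H" by (simp add: U_def)
  have US: "U (b # s) = (if U s \<inter> B (length s) = {} \<or> U s - Dcl (B (length s)) = {} then U s
    else if b then U s \<inter> B (length s) else U s - Dcl (B (length s)))" for b s
    by (simp add: U_def)
  have U: "Dopen (U s) \<and> U s \<noteq> {}" for s
  proof (induction s)
    case Nil
    have "Dopen H" unfolding Dopen_def by (auto intro!: exI[of _ "1::real"])
    then show ?case using eH by (auto simp: U0)
  next
    case (Cons b s)
    then show ?case using Dopen_Int[OF _ B(1)] Dopen_Diff_Dcl[OF _ B(2)] by (simp add: US)
  qed
  then have UH: "U s \<subseteq> H" for s by (simp add: Dopen_def)
  have U_sub: "U (b # s) \<subseteq> U s" for b s by (auto simp: US)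
  define C where "C s = Dcl (U s)" for s
  have split: "C s = C (False # s) \<union> C (True # s)" for s
  proof
    show "C (False # s) \<union> C (True # s) \<subseteq> C s" unfolding C_def using U_sub Dcl_mono by blast
    show "C s \<subseteq> C (False # s) \<union> C (True # s)"
    proof (cases "U s \<inter> B (length s) = {} \<or> U s - Dcl (B (length s)) = {}")
      case True then show ?thesis by (auto simp: C_def US)
    next
      case False
      let ?P = "U s \<inter> B (length s)" and ?Q = "U s - Dcl (B (length s))"
      \<comment> \<open>A point u of \<open>U s\<close> close to x must lie in the closure of the
        ball; as \<open>U s\<close> is open, the ball has a point v in \<open>U s\<close> still
        close to x.\<close>
      have "x \<in> Dcl ?P \<union> Dcl ?Q" if x: "x \<in> Dcl (U s)" for x
      proof (rule ccontr)
        assume "x \<notin> Dcl ?P \<union> Dcl ?Q"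
        moreover have xH: "x \<in> H" using x Dcl_H by blast
        ultimately obtain r r' where r: "r > 0" "\<forall>u\<in>?P. r \<le> D x u" "r' > 0" "\<forall>u\<in>?Q. r' \<le> D x u"
          using not_DclD[of x ?P] not_DclD[of x ?Q] by blast
        obtain u where u: "u \<in> U s" "D x u < min (r / 2) r'" using DclD[OF x, of "min (r / 2) r'"] r by auto
        then have "u \<in> Dcl (B (length s))" using r(4) by force
        moreover obtain d where d: "d > 0" "\<forall>y\<in>H. D u y < d \<longrightarrow> y \<in> U s" using U u(1) unfolding Dopen_def by blast
        ultimately obtain v where v: "v \<in> B (length s)" "D u v < min d (r / 2)"
          using r(1) DclD[of u "B (length s)" "min d (r / 2)"] by auto
        then have "v \<in> ?P" using d(2) B(2) by auto
        then have "r \<le> D x v" using r(2) by blast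
        moreover have "D x v \<le> D x u + D u v" using xH u(1) v(1) UH B(2) HX by (intro D_tri) blast+
        ultimately show False using u(2) v(2) by simp
      qed
      then show ?thesis using False by (auto simp: C_def US)
    qed
  qed
  have cut: "U s \<subseteq> Dcl (B i) \<or> U s \<inter> B i = {}" if "i < length s" for s i
    using that
  proof (induction s)
    case (Cons b s)
    show ?case
    proof (cases "i = length s")
      case True
      then show ?thesis using subset_Dcl[OF B(2)[of i]] by (auto simp: US)
    next
      case False
      then have "U s \<subseteq> Dcl (B i) \<or> U s \<inter> B i = {}" using Cons by simp
      then show ?thesis using U_sub[of b s] by blast
    qed
  qed simp
  have mesh: "\<exists>n. \<forall>s. n \<le> length s \<longrightarrow> (\<forall>x\<in>C s. \<forall>y\<in>C s. D x y < \<epsilon>)" if "\<epsilon> > 0" for \<epsilon>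
  proof -
    obtain n where n: "\<forall>x\<in>H. \<exists>i<n. \<rho> i < \<epsilon> / 2 \<and> D x (q i) < \<rho> i" using balls[rule_format, of "\<epsilon> / 2"] \<open>\<epsilon> > 0\<close> by auto
    have "D x y < \<epsilon>" if s: "n \<le> length s" and xy: "x \<in> C s" "y \<in> C s" for s x y
    proof -
      \<comment> \<open>A point of \<open>U s\<close> lies in a small ball with index i below the
        level, so \<open>cut\<close> places all of \<open>U s\<close> in the closure of this
        ball.\<close>
      obtain x0 where x0: "x0 \<in> U s" using U by blast
      then obtain i where i: "i < n" "\<rho> i < \<epsilon> / 2" "x0 \<in> B i" using n UH unfolding B_def by blast
      then have sub: "U s \<subseteq> Dcl (B i)" using cut[of i s] s x0 by auto
      have qH: "q i \<in> H" using q by auto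
      have le: "D z (q i) \<le> \<rho> i" if z: "z \<in> C s" for z
      proof (rule field_le_epsilon)
        fix d :: real assume "0 < d"
        then obtain u where u: "u \<in> U s" "D z u < d / 2" "z \<in> H" 
          using z DclD[of z "U s" "d / 2"] Dcl_H by (auto simp: C_def)
        then obtain v where v: "v \<in> B i" "D u v < d / 2" 
          using sub \<open>0 < d\<close> DclD[of u "B i" "d / 2"] by auto
        have "z \<in> X" "u \<in> X" "v \<in> X" "q i \<in> X" using u v UH B(2) qH HX by blast+
        then show "D z (q i) \<le> \<rho> i + d" using D_tri[of z u "q i"] D_tri[of u v "q i"] u v by (simp add: B_def)
      qed
      have "x \<in> X" "y \<in> X" "q i \<in> X" using xy Dcl_H qH HX by (auto simp: C_def)
      then show ?thesis using D_tri[of x "q i" y] D_sym[of y "q i"] le[OF xy(1)] le[OF xy(2)] i(2) by simp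
    qed
    then show ?thesis by blast
  qed
  show ?thesis
  proof (rule that[of C U])
    show "C [] = H" unfolding C_def U0 using Dcl_H subset_Dcl[of H] by blast
    show "\<And>s. C s = C (False # s) \<union> C (True # s)" by (rule split)
    show "closedin T (C s)" for s unfolding C_def by (rule closedin_Dcl[OF UH])
    show "U s \<subseteq> C s" for s unfolding C_def by (rule subset_Dcl[OF UH])
    then show "C s \<noteq> {}" for s using U by blast
  qed (use U mesh in auto)
qed

end

section \<open>Transfer of covers to the real line\<close>

context invariant_pseudometric
begin

text \<open>Choosing digits so that the intervals contain x gives a decreasing sequence of nonempty
  closed pieces, which have a common point by compactness.\<close>

lemma branch_covers:
  fixes C :: "bool list \<Rightarrow> 'a set"
  assumes w: "tree_weight w"
    and C: "C [] = H" "\<And>s. C s = C (False # s) \<union> C (True # s)" "\<And>s. closedin T (C s)" "\<And>s. C s \<noteq> {}"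
    and x: "x \<in> {0..1}"
  shows "\<exists>h\<in>H. \<forall>n. \<exists>s. length s = n \<and> x \<in> tree_weight.ivl w s \<and> h \<in> C s"
proof -
  interpret tree_weight w by (rule w)
  define sq where "sq = rec_nat [] (\<lambda>_ s. (SOME b. x \<in> ivl (b # s)) # s)"
  have sq: "sq 0 = []" "sq (Suc n) = (SOME b. x \<in> ivl (b # sq n)) # sq n" for n by (simp_all add: sq_def)
  have len: "length (sq n) = n" for n by (induction n) (simp_all add: sq)
  have ivl: "x \<in> ivl (sq n)" for n
  proof (induction n)
    case 0
    then show ?case using x by (simp add: sq ivl_def w_Nil)
  next
    case (Suc n)
    then show ?case unfolding sq using ivl_split by (metis someI_ex)
  qed
  have "C (b # s) \<subseteq> C s" for b s using C(2)[of s] by (cases b) auto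
  then have "decseq (\<lambda>n. C (sq n))" by (intro decseq_SucI) (simp add: sq)
  then have "(\<Inter>n. C (sq n)) \<noteq> {}" using C(3,4) by (intro compact_space_imp_nest[OF compact]) auto
  then obtain h where h: "\<And>n. h \<in> C (sq n)" by blast
  then have "h \<in> H" using C(1) sq(1) by metis
  then show ?thesis using h len ivl by blast
qed

lemma cover_trace:
  fixes C :: "bool list \<Rightarrow> 'a set"
  assumes w: "tree_weight w"
    and C: "C [] = H" "\<And>s. C s = C (False # s) \<union> C (True # s)" "\<And>s. closedin T (C s)" "\<And>s. C s \<noteq> {}"
    and cov: "H \<subseteq> \<Union>\<A>"
  shows "{0..1} \<subseteq> \<Union>((\<lambda>A. tree_weight.trace w (\<lambda>s. C s \<inter> A \<noteq> {})) ` \<A>)"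
proof
  fix x :: real assume x: "x \<in> {0..1}"
  obtain h where h: "h \<in> H" "\<forall>n. \<exists>s. length s = n \<and> x \<in> tree_weight.ivl w s \<and> h \<in> C s"
    using branch_covers[OF w C x] by blast
  then obtain A where A: "A \<in> \<A>" "h \<in> A" using cov by blast
  have "\<forall>n. \<exists>s. length s = n \<and> x \<in> tree_weight.ivl w s \<and> C s \<inter> A \<noteq> {}" using h(2) A(2) by blast
  then have "x \<in> tree_weight.trace w (\<lambda>s. C s \<inter> A \<noteq> {})"
    using x by (simp add: tree_weight.trace_def[OF w])
  then show "x \<in> \<Union>((\<lambda>A. tree_weight.trace w (\<lambda>s. C s \<inter> A \<noteq> {})) ` \<A>)" using A(1) by blast
qed

text \<open>With dyadic weights, the trace of a D-closed set A without D-interior is nowhere dense: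
  below any node there is a point of \<open>H\<close> off A, and a deep enough piece around it
  misses A.\<close>

lemma cov_meager_interior:
  assumes cov: "cov meager_sets =o continuum"
    and small: "|\<A>| <o |UNIV :: real set|" and cover: "H \<subseteq> \<Union>\<A>"
    and clo: "\<And>A x. A \<in> \<A> \<Longrightarrow> x \<in> H \<Longrightarrow> x \<notin> A \<Longrightarrow> \<exists>r>0. \<forall>a\<in>A. r \<le> D x a"
  shows "\<exists>A\<in>\<A>. \<exists>x\<in>H. \<exists>r>0. \<forall>y\<in>H. D x y < r \<longrightarrow> y \<in> A"
proof (rule ccontr)
  assume none: "\<not> ?thesis"
  define w where "w s = (1 / 2 :: real) ^ length s" for s :: "bool list"
  have w: "tree_weight w" by unfold_locales (simp_all add: w_def)
  interpret tree_weight w by (rule w)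
  show False
  proof (rule binary_tree)
    fix U C :: "bool list \<Rightarrow> 'a set"
    assume C: "C [] = H" "\<And>s. C s = C (False # s) \<union> C (True # s)" "\<And>s. closedin T (C s)" "\<And>s. C s \<noteq> {}"
      and mesh: "\<And>\<epsilon>. \<epsilon> > 0 \<Longrightarrow> \<exists>n. \<forall>s. n \<le> length s \<longrightarrow> (\<forall>x\<in>C s. \<forall>y\<in>C s. D x y < \<epsilon>)"
      and U: "\<And>s. U s \<subseteq> C s" "\<And>s. Dopen (U s)" "\<And>s. U s \<noteq> {}"
    define B where "B A = trace (\<lambda>s. C s \<inter> A \<noteq> {})" for A
    have extend: "\<exists>t. length t = k \<and> h \<in> C (t @ s)" if "h \<in> C s" for h k s
    proof (induction k)
      case 0 then show ?case using that by simp
    next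
      case (Suc k)
      then obtain t where "length t = k" "h \<in> C (t @ s)" by blast
      then obtain b where "h \<in> C (b # t @ s)" using C(2)[of "t @ s"] by blast
      then show ?case using \<open>length t = k\<close> by (intro exI[of _ "b # t"]) simp
    qed
    have nd: "interior (B A) = {}" if A: "A \<in> \<A>" for A
    proof (rule ccontr)
      assume "interior (B A) \<noteq> {}"
      then obtain x \<rho> where x: "\<rho> > 0" "ball x \<rho> \<subseteq> B A" by (meson ex_in_conv mem_interior)
      obtain n where n: "(1 / 2) ^ n < \<rho>" using real_arch_pow_inv[of \<rho> "1 / 2"] x(1) by auto
      have "x \<in> B A" using x by auto
      then obtain s where s: "length s = n" "x \<in> ivl s" unfolding B_def trace_def by blast
      have "ivl s \<subseteq> ball x \<rho>" using s n by (auto simp: ivl_def w_def dist_real_def)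
      then have sB: "ivl s \<subseteq> B A" using x(2) by blast
      obtain u where u: "u \<in> U s" using U(3) by blast
      then obtain r where r: "r > 0" "\<forall>y\<in>H. D u y < r \<longrightarrow> y \<in> U s" and uH: "u \<in> H"
        using U(2)[of s] unfolding Dopen_def by blast
      then have "\<not> (\<forall>y\<in>H. D u y < r \<longrightarrow> y \<in> A)" using none A by blast
      then obtain h where h: "h \<in> H" "h \<in> C s" "h \<notin> A" using r(2) U(1)[of s] by blast
      then obtain d where d: "d > 0" "\<forall>a\<in>A. d \<le> D h a" using clo[OF A h(1,3)] by blast
      \<comment> \<open>At this depth the piece around h has diameter below the distance from h to
        A.\<close>
      obtain k where k: "\<forall>s. k \<le> length s \<longrightarrow> (\<forall>x\<in>C s. \<forall>y\<in>C s. D x y < d)" using mesh[OF d(1)] by blast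
      obtain t where t: "length t = k" "h \<in> C (t @ s)" using extend[OF h(2)] by blast
      define t' where "t' = t @ s"
      have empty: "C t' \<inter> A = {}"
      proof -
        have "D h a < d" if "a \<in> C t'" for a
          using k[rule_format, of t' h a] t that by (simp add: t'_def)
        then show ?thesis using d(2) by fastforce
      qed
      have wt: "w t' > 0" by (simp add: w_def)
      \<comment> \<open>Neighbouring intervals share end points; the midpoint belongs to no other
        interval of its level.\<close>
      define y where "y = lo t' + w t' / 2"
      have "y \<in> ivl t'" using wt by (simp add: ivl_def y_def)
      then have "y \<in> B A" using ivl_append sB unfolding t'_def by blast
      then obtain t'' where t'': "length t'' = length t'" "y \<in> ivl t''" "C t'' \<inter> A \<noteq> {}"
        unfolding B_def trace_def by blast
      then have "t'' \<noteq> t'" using empty by blast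
      then have "lo t'' + w t'' \<le> lo t' \<or> lo t' + w t' \<le> lo t''" using ivl_separated t''(1) by blast
      then show False using t''(2) wt by (auto simp: ivl_def y_def)
    qed
    have "\<not> |B ` \<A>| <o |UNIV :: real set|"
    proof (rule covering_number_unit_interval[OF cov])
      show "{0..1} \<subseteq> \<Union>(B ` \<A>)" unfolding B_def by (rule cover_trace[OF w C cover])
      fix E and k :: int assume "E \<in> B ` \<A>"
      then obtain A where A: "A \<in> \<A>" "E = B A" by blast
      have "closed E" using A(2) closed_trace by (simp add: B_def)
      then have "interior (closure ((+) (of_int k) ` E)) = {}"
        using nd[OF A(1)] A(2) by (simp add: closure_translation interior_translation)
      then have "meager ((+) (of_int k) ` E)" unfolding meager_def nowhere_dense_def
        by (intro exI[of _ "{(+) (of_int k) ` E}"]) auto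
      then show "(+) (of_int k) ` E \<in> meager_sets" by (simp add: meager_sets_def)
    qed
    then show False using image_ordLess[OF small] by blast
  qed
qed

text \<open>
  Sets all of whose long progressions of translates \<open>A, z A, \<dots>, z\<^sup>N A\<close> may be uniformly disjoint.
  They play the role of closed sets of Haar measure zero.
\<close>
definition dispersed :: "'a set \<Rightarrow> bool" where
  "dispersed A \<longleftrightarrow> (\<forall>N. \<exists>z\<in>H. \<exists>\<delta>>0. \<forall>a\<in>A. \<forall>a'\<in>A. \<forall>j\<in>{1..N}. \<delta> \<le> D a (pw j z \<odot> a'))"

section \<open>Counting in maximal separated sets\<close>

definition separated :: "real \<Rightarrow> 'a set \<Rightarrow> bool" where
  "separated \<epsilon> S \<longleftrightarrow> finite S \<and> S \<subseteq> H \<and> (\<forall>x\<in>S. \<forall>y\<in>S. x \<noteq> y \<longrightarrow> \<epsilon> \<le> D x y)"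

lemma max_separated:
  assumes "\<epsilon> > 0"
  obtains S where "separated \<epsilon> S" "\<And>S'. separated \<epsilon> S' \<Longrightarrow> card S' \<le> card S" "card S > 0"
proof -
  obtain F where F: "finite F" "F \<subseteq> H" "\<forall>x\<in>H. \<exists>y\<in>F. D x y < \<epsilon> / 2"
    using totally_bounded[OF closedin_H, of "\<epsilon> / 2"] assms by auto
  have bound: "card S \<le> card F" if S: "separated \<epsilon> S" for S
  proof -
    have SH: "S \<subseteq> H" using S by (simp add: separated_def)
    then have "\<forall>x\<in>S. \<exists>y\<in>F. D x y < \<epsilon> / 2" using F(3) by (meson subsetD)
    then obtain g where g: "\<forall>x\<in>S. g x \<in> F \<and> D x (g x) < \<epsilon> / 2" by metis
    have "inj_on g S"
    proof (rule inj_onI, rule ccontr)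
      fix x y assume xy: "x \<in> S" "y \<in> S" "g x = g y" "x \<noteq> y"
      then have "x \<in> X" "y \<in> X" "g x \<in> X" using S g F(2) HX unfolding separated_def by blast+
      then have "D x y \<le> D x (g x) + D y (g y)" using D_tri[of x "g x" y] D_sym[of y "g y"] xy(3) by simp
      moreover have "\<epsilon> \<le> D x y" using S xy unfolding separated_def by blast
      moreover have "D x (g x) < \<epsilon> / 2" "D y (g y) < \<epsilon> / 2" using g xy by auto
      ultimately show False by linarith
    qed
    then show ?thesis using g F(1) by (intro card_inj_on_le[of g]) auto
  qed
  define K where "K = card ` {S. separated \<epsilon> S}"
  have "{e} \<in> {S. separated \<epsilon> S}" using eH by (simp add: separated_def)
  then have one: "1 \<in> K" unfolding K_def by (intro image_eqI[of _ _ "{e}"]) auto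
  have fin: "finite K" using bound by (intro finite_subset[of K "{..card F}"]) (auto simp: K_def)
  then have "Max K \<in> K" using one by (intro Max_in) auto
  then obtain S where S: "separated \<epsilon> S" "card S = Max K" by (auto simp: K_def)
  show ?thesis
  proof
    show "card S' \<le> card S" if "separated \<epsilon> S'" for S' using that S fin by (auto simp: K_def)
    show "card S > 0" using Max_ge[OF fin one] S(2) by simp
  qed (rule S(1))
qed

text \<open>The translates of E by z^0, ..., z^N are pairwise more than \<delta>/3 apart, because E
  is close to A. Their union is again \<epsilon>-separated, so maximality of S bounds its
  cardinality.\<close>

lemma dispersed_count:
  assumes S: "separated \<epsilon> S" "\<And>S'. separated \<epsilon> S' \<Longrightarrow> card S' \<le> card S"
    and A: "A \<subseteq> H" and z: "z \<in> H" "\<delta> > 0" "\<forall>a\<in>A. \<forall>a'\<in>A. \<forall>j\<in>{1..N}. \<delta> \<le> D a (pw j z \<odot> a')"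
    and \<epsilon>: "\<epsilon> \<le> \<delta> / 3"
    and E: "E \<subseteq> S" "\<And>h. h \<in> E \<Longrightarrow> \<exists>a\<in>A. D h a < \<delta> / 3"
  shows "Suc N * card E \<le> card S"
proof -
  have SH: "S \<subseteq> H" and finS: "finite S" using S(1) by (auto simp: separated_def)
  have EH: "E \<subseteq> H" using E(1) SH by blast
  have finE: "finite E" using E(1) finS finite_subset by blast
  \<comment> \<open>By invariance only the difference j = i' - i matters; replacing h and h' by
    nearby points of A costs less than \<delta>/3 each out of \<delta>.\<close>
  have far: "\<delta> / 3 < D (pw i z \<odot> h) (pw i' z \<odot> h')" if hh: "h \<in> E" "h' \<in> E" and ii: "i < i'" "i' \<le> N" for h h' i i'
  proof -
    define j where "j = i' - i"
    have j: "j \<in> {1..N}" "i' = i + j" using ii by (auto simp: j_def)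
    obtain a a' where a: "a \<in> A" "D h a < \<delta> / 3" "a' \<in> A" "D h' a' < \<delta> / 3" using E(2) hh by blast
    have H: "h \<in> H" "h' \<in> H" "a \<in> H" "a' \<in> H" "pw i z \<in> H" "pw j z \<in> H" using hh EH a A pwH[OF z(1)] by auto
    have "D (pw i z \<odot> h) (pw i' z \<odot> h') = D (pw i z \<odot> h) (pw i z \<odot> (pw j z \<odot> h'))"
      using j(2) pw_add[OF z(1), of i j] H by (simp add: Hassoc)
    also have "\<dots> = D h (pw j z \<odot> h')" using H by (simp add: D_invariant Hmult)
    finally have eq: "D (pw i z \<odot> h) (pw i' z \<odot> h') = D h (pw j z \<odot> h')" .
    have "D (pw j z \<odot> h') (pw j z \<odot> a') = D h' a'" using H by (simp add: D_invariant)
    moreover have "D a (pw j z \<odot> a') \<le> D a h + D h (pw j z \<odot> h') + D (pw j z \<odot> h') (pw j z \<odot> a')"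
      using D_tri[of a h "pw j z \<odot> a'"] D_tri[of h "pw j z \<odot> h'" "pw j z \<odot> a'"] H HX Hmult by fastforce
    moreover have "D a h = D h a" using D_sym H HX by blast
    moreover have "\<delta> \<le> D a (pw j z \<odot> a')" using z(3) a(1,3) j(1) by blast
    ultimately show ?thesis using a eq by linarith
  qed
  define F where "F i = (\<lambda>h. pw i z \<odot> h) ` E" for i
  have FH: "F i \<subseteq> H" for i using EH pwH[OF z(1)] Hmult by (auto simp: F_def)
  have inj: "inj_on (\<lambda>h. pw i z \<odot> h) E" for i
    using EH iv_cancel(1) pwH[OF z(1)] by (intro inj_on_inverseI[of _ "\<lambda>x. iv (pw i z) \<odot> x"]) blast
  have farF: "\<delta> / 3 < D u v" if uv: "u \<in> F i" "v \<in> F i'" and ii: "i \<noteq> i'" "i \<le> N" "i' \<le> N" for u v i i'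
  proof -
    obtain h h' where h: "h \<in> E" "u = pw i z \<odot> h" "h' \<in> E" "v = pw i' z \<odot> h'" using uv by (auto simp: F_def)
    show ?thesis
    proof (cases "i < i'")
      case True then show ?thesis using far h ii by blast
    next
      case False
      then have "\<delta> / 3 < D v u" using far[of h' h i' i] h ii by simp
      then show ?thesis using D_sym[of u v] HX[OF subsetD[OF FH uv(1)]] HX[OF subsetD[OF FH uv(2)]] by simp
    qed
  qed
  define G where "G = (\<Union>i\<in>{..N}. F i)"
  have "separated \<epsilon> G"
    unfolding separated_def
  proof (intro conjI ballI impI)
    show "finite G" using finE by (simp add: G_def F_def)
    show "G \<subseteq> H" using FH by (auto simp: G_def)
    fix u v assume uv: "u \<in> G" "v \<in> G" "u \<noteq> v"
    then obtain i i' where i: "u \<in> F i" "i \<le> N" "v \<in> F i'" "i' \<le> N" by (auto simp: G_def)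
    show "\<epsilon> \<le> D u v"
    proof (cases "i = i'")
      case True
      then obtain h h' where h: "h \<in> E" "u = pw i z \<odot> h" "h' \<in> E" "v = pw i z \<odot> h'" using i by (auto simp: F_def)
      then have "D u v = D h h'" using D_invariant(1)[of "pw i z" h h'] pwH[OF z(1)] EH by auto
      moreover have "h \<noteq> h'" using uv h by blast
      ultimately show ?thesis using S(1) h E(1) unfolding separated_def by auto
    next
      case False
      then show ?thesis using farF[OF i(1,3)] i \<epsilon> by fastforce
    qed
  qed
  then have "card G \<le> card S" by (rule S(2))
  moreover have "card G = (\<Sum>i\<in>{..N}. card (F i))"
    unfolding G_def
  proof (rule card_UN_disjoint)
    show "\<forall>i\<in>{..N}. finite (F i)" using finE by (simp add: F_def)
    show "\<forall>i\<in>{..N}. \<forall>j\<in>{..N}. i \<noteq> j \<longrightarrow> F i \<inter> F j = {}"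
    proof (intro ballI impI)
      fix i j assume ij: "i \<in> {..N}" "j \<in> {..N}" "i \<noteq> j"
      have "u \<notin> F j" if u: "u \<in> F i" for u
      proof
        assume "u \<in> F j"
        then have "\<delta> / 3 < D u u" using farF[OF u] ij by auto
        moreover have "D u u = 0" using D_refl FH HX u by blast
        ultimately show False using z(2) by simp
      qed
      then show "F i \<inter> F j = {}" by blast
    qed
  qed simp
  moreover have "card (F i) = card E" for i unfolding F_def by (rule card_image[OF inj])
  ultimately show ?thesis by simp
qed

text \<open>The weights are limits of normalized counting measures of maximal 1/(k+1)-separated
  sets. By \<open>dispersed_count\<close>, the nodes meeting a dispersed set have arbitrarily small
  total weight at suitable levels, so its trace is null.\<close>

lemma cov_closed_null_not_dispersed:
  assumes cov: "cov closed_null_sets =o continuum"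
    and small: "|\<A>| <o |UNIV :: real set|" and cover: "H \<subseteq> \<Union>\<A>" and AH: "\<And>A. A \<in> \<A> \<Longrightarrow> A \<subseteq> H"
  shows "\<exists>A\<in>\<A>. \<not> dispersed A"
proof (rule ccontr)
  assume none: "\<not> ?thesis"
  show False
  proof (rule binary_tree)
    fix U C :: "bool list \<Rightarrow> 'a set"
    assume C: "C [] = H" "\<And>s. C s = C (False # s) \<union> C (True # s)" "\<And>s. closedin T (C s)" "\<And>s. C s \<noteq> {}"
      and mesh: "\<And>\<epsilon>. \<epsilon> > 0 \<Longrightarrow> \<exists>n. \<forall>s. n \<le> length s \<longrightarrow> (\<forall>x\<in>C s. \<forall>y\<in>C s. D x y < \<epsilon>)"
    \<comment> \<open>The two pieces below a node may overlap; fixing one branch for each point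
      makes the counts additive.\<close>
    define br where "br h = rec_nat [] (\<lambda>_ s. (SOME b. h \<in> C (b # s)) # s)" for h
    have br: "br h 0 = []" "br h (Suc n) = (SOME b. h \<in> C (b # br h n)) # br h n" for h n by (simp_all add: br_def)
    have len: "length (br h n) = n" for h n by (induction n) (simp_all add: br)
    have brC: "h \<in> C (br h n)" if "h \<in> H" for h n
    proof (induction n)
      case 0 then show ?case using that C(1) by (simp add: br)
    next
      case (Suc n)
      then have "\<exists>b. h \<in> C (b # br h n)" using C(2)[of "br h n"] by blast
      then show ?case unfolding br by (rule someI_ex)
    qed
    have "\<forall>k. \<exists>S. separated (1 / Suc k) S \<and> (\<forall>S'. separated (1 / Suc k) S' \<longrightarrow> card S' \<le> card S) \<and> card S > 0"
    proof
      fix k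
      have "1 / real (Suc k) > 0" by simp
      then show "\<exists>S. separated (1 / Suc k) S \<and> (\<forall>S'. separated (1 / Suc k) S' \<longrightarrow> card S' \<le> card S) \<and> card S > 0"
        using max_separated by metis
    qed
    then obtain S where S: "\<And>k. separated (1 / Suc k) (S k)"
      "\<And>k S'. separated (1 / Suc k) S' \<Longrightarrow> card S' \<le> card (S k)" "\<And>k. card (S k) > 0" by metis
    have finS: "finite (S k)" and SH: "S k \<subseteq> H" for k using S(1)[of k] by (auto simp: separated_def)
    define v where "v k s = real (card {h \<in> S k. br h (length s) = s}) / card (S k)" for k s
    have v0: "0 \<le> v k s" for k s by (simp add: v_def)
    have v1: "v k s \<le> 1" for k s
    proof -
      have "card {h \<in> S k. br h (length s) = s} \<le> card (S k)" using finS by (intro card_mono) auto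
      then show ?thesis using S(3)[of k] by (simp add: v_def)
    qed
    have vNil: "v k [] = 1" for k using S(3)[of k] by (simp add: v_def br)
    have vsplit: "v k s = v k (False # s) + v k (True # s)" for k s
    proof -
      have "{h \<in> S k. br h (length s) = s} =
          {h \<in> S k. br h (length (False # s)) = False # s} \<union> {h \<in> S k. br h (length (True # s)) = True # s}"
        by (auto simp: br)
      moreover have "card \<dots> = card {h \<in> S k. br h (length (False # s)) = False # s} + card {h \<in> S k. br h (length (True # s)) = True # s}"
        using finS by (intro card_Un_disjoint) auto
      ultimately show ?thesis by (simp add: v_def add_divide_distrib)
    qed
    \<comment> \<open>There are countably many nodes, so a diagonal argument gives one subsequence
      along which all weights converge.\<close>
    obtain g where g: "strict_mono (g :: nat \<Rightarrow> nat)" "\<And>s. s \<in> UNIV \<Longrightarrow> \<exists>l. (\<lambda>k. v (g k) s) \<longlonglongrightarrow> l"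
    proof (rule function_convergent_subsequence[of UNIV v 1])
      show "norm (v k s) \<le> 1" for k s using v0 v1 by simp
    qed auto
    then obtain w where lim: "\<And>s. (\<lambda>k. v (g k) s) \<longlonglongrightarrow> w s" by (metis UNIV_I)
    have w: "tree_weight w"
    proof
      show "w [] = 1" using LIMSEQ_unique[OF lim[of "[]"], of 1] vNil by simp
      show "0 \<le> w s" for s by (rule LIMSEQ_le_const[OF lim[of s]]) (use v0 in auto)
      show "w s = w (False # s) + w (True # s)" for s
      proof (rule LIMSEQ_unique[OF lim])
        show "(\<lambda>k. v (g k) s) \<longlonglongrightarrow> w (False # s) + w (True # s)"
          unfolding vsplit[of _ s] by (intro tendsto_add lim)
      qed
    qed
    interpret tree_weight w by (rule w)
    define B where "B A = trace (\<lambda>s. C s \<inter> A \<noteq> {})" for A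
    have null: "B A \<in> null_sets lebesgue" if A: "A \<in> \<A>" for A
      unfolding B_def
    proof (rule null_trace)
      fix \<epsilon> :: real assume "\<epsilon> > 0"
      then obtain N where N: "1 / real (Suc N) < \<epsilon>" using reals_Archimedean[of \<epsilon>] by (auto simp: inverse_eq_divide)
      have "dispersed A" using none A by blast
      then obtain z \<delta> where z: "z \<in> H" "\<delta> > 0" "\<forall>a\<in>A. \<forall>a'\<in>A. \<forall>j\<in>{1..N}. \<delta> \<le> D a (pw j z \<odot> a')"
        unfolding dispersed_def by blast
      \<comment> \<open>At level \<open>n\<close> every point of a piece that meets A is within
        \<delta>/3 of A. This level does not depend on k, so the estimate passes to the
        limit.\<close>
      obtain n where n: "\<forall>s. n \<le> length s \<longrightarrow> (\<forall>x\<in>C s. \<forall>y\<in>C s. D x y < \<delta> / 3)" using mesh[of "\<delta> / 3"] z(2) by auto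
      obtain k0 where k0: "1 / real (Suc k0) < \<delta> / 3" using reals_Archimedean[of "\<delta> / 3"] z(2) by (auto simp: inverse_eq_divide)
      let ?L = "{s. length s = n \<and> C s \<inter> A \<noteq> {}}"
      have fL: "finite ?L" by (rule finite_level)
      have bound: "(\<Sum>s\<in>?L. v k s) \<le> 1 / real (Suc N)" if k: "k0 \<le> k" for k
      proof -
        define E where "E = {h \<in> S k. br h n \<in> ?L}"
        have "E = (\<Union>s\<in>?L. {h \<in> S k. br h (length s) = s})" by (auto simp: E_def len)
        moreover have "card \<dots> = (\<Sum>s\<in>?L. card {h \<in> S k. br h (length s) = s})"
          using fL finS by (intro card_UN_disjoint) auto
        ultimately have cE: "(\<Sum>s\<in>?L. v k s) = card E / card (S k)"
          by (simp add: v_def sum_divide_distrib[symmetric])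
        have "1 / real (Suc k) \<le> 1 / real (Suc k0)" using k by (intro divide_left_mono) auto
        then have "Suc N * card E \<le> card (S k)"
        proof (intro dispersed_count[OF S(1) S(2) AH[OF A] z])
          fix h assume h: "h \<in> E"
          then obtain a where a: "a \<in> C (br h n)" "a \<in> A" by (auto simp: E_def)
          have "h \<in> C (br h n)" using h SH brC by (auto simp: E_def)
          then have "D h a < \<delta> / 3" using n[rule_format, of "br h n" h a] a(1) by (simp add: len)
          then show "\<exists>a\<in>A. D h a < \<delta> / 3" using a(2) by blast
        qed (use k0 in \<open>auto simp: E_def\<close>)
        then have "real (Suc N) * card E \<le> card (S k)" by (metis of_nat_le_iff of_nat_mult)
        then show ?thesis unfolding cE using S(3)[of k] by (simp add: field_simps)
      qed
      have "(\<lambda>k. \<Sum>s\<in>?L. v (g k) s) \<longlonglongrightarrow> (\<Sum>s\<in>?L. w s)" by (intro tendsto_sum lim)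
      moreover have "\<exists>K. \<forall>k\<ge>K. (\<Sum>s\<in>?L. v (g k) s) \<le> 1 / real (Suc N)"
        using bound seq_suble[OF g(1)] by (meson order_trans)
      ultimately have "sum w ?L \<le> 1 / real (Suc N)" by (rule LIMSEQ_le_const2)
      then show "\<exists>n. sum w {s. length s = n \<and> C s \<inter> A \<noteq> {}} \<le> \<epsilon>" using N by (intro exI[of _ n]) simp
    qed
    have "\<not> |B ` \<A>| <o |UNIV :: real set|"
    proof (rule covering_number_unit_interval[OF cov])
      show "{0..1} \<subseteq> \<Union>(B ` \<A>)" unfolding B_def by (rule cover_trace[OF w C cover])
      fix E and k :: int assume "E \<in> B ` \<A>"
      then obtain A where A: "A \<in> \<A>" "E = B A" by blast
      have "closed ((+) (of_int k) ` E)" using A(2) closed_trace by (simp add: B_def closed_translation)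
      moreover have "(+) (of_int k) ` E \<in> null_sets lebesgue"
        using null[OF A(1)] A(2) negligible_translation by (simp flip: negligible_iff_null_sets)
      ultimately show "(+) (of_int k) ` E \<in> closed_null_sets" by (simp add: closed_null_sets_def)
    qed
    then show False using image_ordLess[OF small] by blast
  qed
qed

end

section \<open>Polyboundedness and polyfiniteness\<close>

context kernel_semigroup
begin

text \<open>The index t = (n, k) concerns polynomials of degree n + 1 and k translations.
  \<open>metrization\<close> preserves the failure modulo D: no k translates of one fibre cover
  \<open>H\<close>. By total boundedness this is violated by a fibre with D-interior.\<close>

lemma polybounded_of_injectively_closed:
  fixes \<C> :: "'a top_semigroup set"
  assumes C: "\<forall>S. zero_discrete S \<and> Hausdorff_semigroup S \<longrightarrow> S \<in> \<C>"
    and inj: "injectively_closed \<C> X (\<odot>)"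
    and cov: "cov meager_sets =o continuum"
  shows "polybounded X (\<odot>)"
proof (rule ccontr)
  assume npb: "\<not> polybounded X (\<odot>)"
  text \<open>The parameter \<open>p\<close> codes the coefficients \<open>p 0, \<dots>, p (n + 1)\<close> of a polynomial, its prescribed
    value \<open>p (n + 2)\<close> and the translations \<open>p (n + 3), p (n + 4), \<dots>\<close>.\<close>
  define u where "u t j p x a = (case t of (n, k) \<Rightarrow> hpoly (Suc n) p (x \<odot> p (n + 3 + j)))"
    for t :: "nat \<times> nat" and j :: nat and p and x a :: 'a
  define v where "v t j p x a = (case t of (n, k) \<Rightarrow> p (n + 2))"
    for t :: "nat \<times> nat" and j :: nat and p :: "nat \<Rightarrow> 'a" and x a :: 'a
  have coord: "continuous_map (prod_topology PH TH) T (\<lambda>z. fst z i)" for i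
    using continuous_map_compose[OF continuous_map_fst continuous_map_coord] by (simp add: comp_def)
  show False
  proof (rule metrization[of u v snd])
    show "continuous_map (prod_topology PH TH) T (\<lambda>(p, a). u t j p x a)" if x: "x \<in> H" for t j x
      using x HX coord by (cases t)
        (auto simp: u_def case_prod_unfold intro!: continuous_map_mult continuous_map_hpoly continuous_map_fst)
    show "continuous_map (prod_topology PH TH) T (\<lambda>(p, a). v t j p x a)" if x: "x \<in> H" for t j x
      using coord by (cases t) (simp add: v_def case_prod_unfold)
    show "u t j p x a \<in> H" if "range p \<subseteq> H" "x \<in> H" "a \<in> H" for t j p x a
      using hpolyH[OF that(1) Hmult[OF that(2) range_subsetD[OF that(1)]]] unfolding u_def
      by (simp split: prod.split del: hpoly.simps)
    show "v t j p x a \<in> H" if "range p \<subseteq> H" "x \<in> H" "a \<in> H" for t j p x a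
      using that unfolding v_def by (auto split: prod.split)
    show "\<exists>x\<in>H. \<forall>a\<in>H. \<forall>j<snd t. u t j p x a \<noteq> v t j p x a" if p: "range p \<subseteq> H" for t p
    proof (rule ccontr)
      assume neg: "\<not> ?thesis"
      obtain n k where t: "t = (n, k)" by (cases t)
      have "polybounded X (\<odot>)"
      proof (rule polyboundedI[OF polyfun_hpoly[OF p]])
        show "p (n + 2) \<in> H" "(\<lambda>j. p (n + 3 + j)) ` {..<k} \<subseteq> H" using p by auto
        show "\<exists>g\<in>(\<lambda>j. p (n + 3 + j)) ` {..<k}. hpoly (Suc n) p (x \<odot> g) = p (n + 2)" if "x \<in> H" for x
          using neg that by (auto simp: t u_def v_def)
      qed auto
      then show False using npb by blast
    qed
  next
    fix D
    assume D: "invariant_pseudometric T (\<odot>) e D"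
      and sep: "\<And>t. \<exists>\<eta>>0. \<forall>p. range p \<subseteq> H \<longrightarrow> (\<exists>x\<in>H. \<forall>a\<in>H. \<forall>j<snd t. \<eta> \<le> D (u t j p x a) (v t j p x a))"
    interpret invariant_pseudometric T "(\<odot>)" e D by (rule D)
    obtain \<Theta> where \<Theta>: "|\<Theta>| <o |UNIV :: real set|"
      "\<And>f b. (f, b) \<in> \<Theta> \<Longrightarrow> b \<in> H \<and> (\<exists>n\<ge>1. polyfun n f)" "\<forall>x\<in>H. \<exists>(f, b)\<in>\<Theta>. D (f x) b = 0"
      using small_polynomial_cover[OF C inj] by blast
    define Z where "Z = (\<lambda>(f, b). {x \<in> H. D (f x) b = 0})"
    have "\<exists>A\<in>Z ` \<Theta>. \<exists>x\<in>H. \<exists>r>0. \<forall>y\<in>H. D x y < r \<longrightarrow> y \<in> A"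
    proof (rule cov_meager_interior[OF cov])
      show "|Z ` \<Theta>| <o |UNIV :: real set|" using \<Theta>(1) by (rule image_ordLess)
      show "H \<subseteq> \<Union>(Z ` \<Theta>)" using \<Theta>(3) by (fastforce simp: Z_def)
      fix A x assume A: "A \<in> Z ` \<Theta>" and x: "x \<in> H" "x \<notin> A"
      then obtain f b where fb: "(f, b) \<in> \<Theta>" "A = {x \<in> H. D (f x) b = 0}" by (auto simp: Z_def)
      then obtain n where b: "b \<in> H" and n: "n \<ge> 1" "polyfun n f" using \<Theta>(2) by blast
      then obtain p where p: "range p \<subseteq> H" "\<forall>x\<in>H. f x = hpoly n p x" unfolding polyfun_def by blast
      have fH: "f y \<in> X" if "y \<in> H" for y using polyfunH[OF n(2) that] HX by blast
      have pos: "D (f x) b > 0" using D_nonneg[of "f x" b] fH[OF x(1)] HX[OF b] x fb(2) by auto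
      \<comment> \<open>A polynomial of degree n is n-Lipschitz, so a point off the fibre keeps a
        positive distance from it.\<close>
      have "D (f x) b / n \<le> D x a" if a: "a \<in> A" for a
      proof -
        have aH: "a \<in> H" "D (f a) b = 0" using a fb(2) by auto
        have "D (f x) b \<le> D (f x) (f a) + D (f a) b" using fH x(1) aH(1) HX[OF b] by (intro D_tri) auto
        also have "D (f x) (f a) \<le> n * D x a" using hpoly_Lipschitz[OF p(1) x(1) aH(1)] p(2) x(1) aH(1) by simp
        finally show ?thesis using aH(2) n(1) by (simp add: field_simps)
      qed
      then show "\<exists>r>0. \<forall>a\<in>A. r \<le> D x a" using pos n(1) by (intro exI[of _ "D (f x) b / n"]) auto
    qed
    then obtain f b x0 r where fb: "(f, b) \<in> \<Theta>" and x0: "x0 \<in> H" and r: "r > 0"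
      and ball: "\<forall>y\<in>H. D x0 y < r \<longrightarrow> D (f y) b = 0" by (force simp: Z_def)
    then obtain n where b: "b \<in> H" and n: "n \<ge> 1" "polyfun n f" using \<Theta>(2) by blast
    then obtain p where p: "range p \<subseteq> H" "\<forall>x\<in>H. f x = hpoly n p x" unfolding polyfun_def by blast
    obtain F where F: "finite F" "F \<subseteq> H" "\<forall>x\<in>H. \<exists>y\<in>F. D x y < r" using totally_bounded[OF closedin_H r] by blast
    obtain ys where ys: "set ys = F" using F(1) finite_list by blast
    obtain n' where n': "n = Suc n'" using n(1) by (cases n) auto
    \<comment> \<open>The coefficients and the value of the fibre are followed by translations y^-1
      x0 for y in a finite r-net; these carry points near y into the ball about x0. The tail is
      filled with \<open>e\<close>.\<close>
    define q where "q i = (if i \<le> n then p i else if i = Suc n then b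
      else if i - (n + 2) < length ys then iv (ys ! (i - (n + 2))) \<odot> x0 else e)" for i
    have ysH: "ys ! j \<in> H" if "j < length ys" for j using that F(2) ys nth_mem by blast
    have q: "range q \<subseteq> H" using p(1) b eH ysH x0 Hmult ivH by (auto simp: q_def)
    have hq: "hpoly n q y = f y" if "y \<in> H" for y
    proof -
      have "hpoly n q y = hpoly n p y" by (rule hpoly_cong) (simp add: q_def)
      then show ?thesis using p(2) that by simp
    qed
    obtain \<eta> where \<eta>: "\<eta> > 0" "\<forall>p. range p \<subseteq> H \<longrightarrow>
        (\<exists>x\<in>H. \<forall>a\<in>H. \<forall>j<length ys. \<eta> \<le> D (u (n', length ys) j p x a) (v (n', length ys) j p x a))"
      using sep[of "(n', length ys)"] by (simp del: hpoly.simps) blast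
    then obtain x where x: "x \<in> H"
      "\<forall>a\<in>H. \<forall>j<length ys. \<eta> \<le> D (u (n', length ys) j q x a) (v (n', length ys) j q x a)"
      using q by blast
    obtain y where "y \<in> F" "D x y < r" using F(3) x(1) by blast
    then obtain j where j: "j < length ys" "D x (ys ! j) < r" using ys by (metis in_set_conv_nth)
    define g where "g = iv (ys ! j) \<odot> x0"
    have yj: "ys ! j \<in> H" using j(1) ys F(2) by auto
    then have gH: "g \<in> H" using ivH Hmult x0 by (simp add: g_def)
    have "D x0 (x \<odot> g) = D (ys ! j \<odot> g) (x \<odot> g)" using yj x0 by (simp add: g_def iv_cancel)
    also have "\<dots> = D (ys ! j) x" using D_invariant(2) gH yj x(1) by blast
    also have "\<dots> < r" using j(2) D_sym yj x(1) HX by simp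
    finally have "D (f (x \<odot> g)) b = 0" using ball x(1) gH Hmult by blast
    moreover have "u (n', length ys) j q x e = f (x \<odot> g)"
    proof -
      have "q (n' + 3 + j) = g" using j(1) by (simp add: q_def n' g_def)
      then show ?thesis using hq[OF Hmult[OF x(1) gH]] by (simp add: u_def n')
    qed
    moreover have "v (n', length ys) j q x e = b" by (simp add: v_def q_def n')
    ultimately show False using x(2) eH j(1) \<eta> by fastforce
  qed
qed

text \<open>Failure of the recurrence in \<open>polyfiniteI\<close> gives, for every polynomial f
  and every k, some z with f(a) \<noteq> f(z^j a) for all a and 1 \<le> j \<le> k. Its uniform
  version modulo D makes every fibre dispersed.\<close>

lemma polyfinite_of_injectively_closed:
  fixes \<C> :: "'a top_semigroup set"
  assumes C: "\<forall>S. zero_discrete S \<and> Hausdorff_semigroup S \<longrightarrow> S \<in> \<C>"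
    and inj: "injectively_closed \<C> X (\<odot>)"
    and cov: "cov closed_null_sets =o continuum"
  shows "polyfinite X (\<odot>)"
proof (rule ccontr)
  assume npf: "\<not> polyfinite X (\<odot>)"
  define u where "u t j p x a = (case t of (n, k) \<Rightarrow> hpoly (Suc n) p a)"
    for t :: "nat \<times> nat" and j :: nat and p and x a :: 'a
  \<comment> \<open>The index j starts at 0, and \<open>Suc j\<close> ensures that only positive
    powers occur.\<close>
  define v where "v t j p x a = (case t of (n, k) \<Rightarrow> hpoly (Suc n) p (pw (Suc j) x \<odot> a))"
    for t :: "nat \<times> nat" and j :: nat and p and x a :: 'a
  have snd: "continuous_map (prod_topology PH TH) T snd"
    using continuous_map_compose[OF continuous_map_snd continuous_map_TH] by (simp add: comp_def)
  show False
  proof (rule metrization[of u v snd])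
    show "continuous_map (prod_topology PH TH) T (\<lambda>(p, a). u t j p x a)" if x: "x \<in> H" for t j x
      using snd by (cases t)
        (simp add: u_def case_prod_unfold continuous_map_mult continuous_map_hpoly continuous_map_fst del: hpoly.simps)
    show "continuous_map (prod_topology PH TH) T (\<lambda>(p, a). v t j p x a)" if x: "x \<in> H" for t j x
    proof -
      have "pw (Suc j) x \<in> X" using pwH[OF x] HX by blast
      then show ?thesis using snd by (cases t)
        (simp add: v_def case_prod_unfold continuous_map_mult continuous_map_hpoly continuous_map_fst del: hpoly.simps pw.simps)
    qed
    show "u t j p x a \<in> H" if "range p \<subseteq> H" "x \<in> H" "a \<in> H" for t j p x a
      using hpolyH[OF that(1,3)] unfolding u_def by (simp split: prod.split del: hpoly.simps)
    show "v t j p x a \<in> H" if "range p \<subseteq> H" "x \<in> H" "a \<in> H" for t j p x a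
      using hpolyH[OF that(1) Hmult[OF pwH[OF that(2)] that(3)]] unfolding v_def
      by (simp split: prod.split del: hpoly.simps pw.simps)
    show "\<exists>x\<in>H. \<forall>a\<in>H. \<forall>j<snd t. u t j p x a \<noteq> v t j p x a" if p: "range p \<subseteq> H" for t p
    proof (rule ccontr)
      assume neg: "\<not> ?thesis"
      obtain n k where t: "t = (n, k)" by (cases t)
      have "polyfinite X (\<odot>)"
      proof (rule polyfiniteI[OF polyfun_hpoly[OF p]])
        fix z assume "z \<in> H"
        then obtain a j where "a \<in> H" "j < k" "hpoly (Suc n) p a = hpoly (Suc n) p (pw (Suc j) z \<odot> a)"
          using neg unfolding t u_def v_def by auto
        then show "\<exists>j a. 1 \<le> j \<and> j \<le> k \<and> a \<in> H \<and> hpoly (Suc n) p a = hpoly (Suc n) p (pw j z \<odot> a)"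
          by (intro exI[of _ "Suc j"] exI[of _ a]) simp
      qed simp
      then show False using npf by blast
    qed
  next
    fix D
    assume D: "invariant_pseudometric T (\<odot>) e D"
      and sep: "\<And>t. \<exists>\<eta>>0. \<forall>p. range p \<subseteq> H \<longrightarrow> (\<exists>x\<in>H. \<forall>a\<in>H. \<forall>j<snd t. \<eta> \<le> D (u t j p x a) (v t j p x a))"
    interpret invariant_pseudometric T "(\<odot>)" e D by (rule D)
    obtain \<Theta> where \<Theta>: "|\<Theta>| <o |UNIV :: real set|"
      "\<And>f b. (f, b) \<in> \<Theta> \<Longrightarrow> b \<in> H \<and> (\<exists>n\<ge>1. polyfun n f)" "\<forall>x\<in>H. \<exists>(f, b)\<in>\<Theta>. D (f x) b = 0"
      using small_polynomial_cover[OF C inj] by blast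
    define Z where "Z = (\<lambda>(f, b). {x \<in> H. D (f x) b = 0})"
    have "\<exists>A\<in>Z ` \<Theta>. \<not> dispersed A"
    proof (rule cov_closed_null_not_dispersed[OF cov])
      show "|Z ` \<Theta>| <o |UNIV :: real set|" using \<Theta>(1) by (rule image_ordLess)
      show "H \<subseteq> \<Union>(Z ` \<Theta>)" using \<Theta>(3) by (fastforce simp: Z_def)
    qed (auto simp: Z_def)
    then obtain f b where fb: "(f, b) \<in> \<Theta>" and nd: "\<not> dispersed {x \<in> H. D (f x) b = 0}" by (auto simp: Z_def)
    then obtain n where b: "b \<in> H" and n: "n \<ge> 1" "polyfun n f" using \<Theta>(2) by blast
    then obtain p where p: "range p \<subseteq> H" "\<forall>x\<in>H. f x = hpoly n p x" unfolding polyfun_def by blast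
    obtain n' where n': "n = Suc n'" using n(1) by (cases n) auto
    have fX: "f y \<in> X" if "y \<in> H" for y using polyfunH[OF n(2) that] HX by blast
    have "dispersed {x \<in> H. D (f x) b = 0}"
      unfolding dispersed_def
    proof
      fix N
      obtain \<eta> where \<eta>: "\<eta> > 0" "\<forall>p. range p \<subseteq> H \<longrightarrow>
          (\<exists>x\<in>H. \<forall>a\<in>H. \<forall>j<N. \<eta> \<le> D (u (n', N) j p x a) (v (n', N) j p x a))"
        using sep[of "(n', N)"] by (simp del: hpoly.simps) blast
      then obtain z where z: "z \<in> H" "\<forall>a\<in>H. \<forall>j<N. \<eta> \<le> D (u (n', N) j p z a) (v (n', N) j p z a)"
        using p(1) by blast
      \<comment> \<open>Both f(a) and f(a') agree with b modulo D and f is n-Lipschitz, so the bound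
        for f at a' and z^j a' becomes one for the distance from a to z^j a'.\<close>
      have "\<eta> / n \<le> D a (pw j z \<odot> a')"
        if a: "a \<in> H" "D (f a) b = 0" and a': "a' \<in> H" "D (f a') b = 0" and j: "j \<in> {1..N}" for a a' j
      proof -
        obtain i where i: "j = Suc i" "i < N" using j by (cases j) auto
        have c: "pw j z \<odot> a' \<in> H" using pwH z(1) a'(1) Hmult by blast
        have "u (n', N) i p z a' = f a'" "v (n', N) i p z a' = f (pw j z \<odot> a')"
          using p(2) a'(1) c by (simp_all add: u_def v_def n' i(1) del: hpoly.simps pw.simps)
        then have "\<eta> \<le> D (f a') (f (pw j z \<odot> a'))" using z(2) a'(1) i(2) by metis
        also have "\<dots> \<le> D (f a') b + D (f a) b + D (f a) (f (pw j z \<odot> a'))"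
          using D_tri[of "f a'" b "f (pw j z \<odot> a')"] D_tri[of b "f a" "f (pw j z \<odot> a')"] D_sym[of b "f a"]
            fX[OF a(1)] fX[OF a'(1)] fX[OF c] HX[OF b] by simp
        also have "\<dots> = D (f a) (f (pw j z \<odot> a'))" using a a' by simp
        also have "\<dots> \<le> n * D a (pw j z \<odot> a')" using hpoly_Lipschitz[OF p(1) a(1) c] p(2) a(1) c by simp
        finally show ?thesis using n(1) by (simp add: field_simps)
      qed
      then show "\<exists>z\<in>H. \<exists>\<delta>>0. \<forall>a\<in>{x \<in> H. D (f x) b = 0}. \<forall>a'\<in>{x \<in> H. D (f x) b = 0}. \<forall>j\<in>{1..N}. \<delta> \<le> D a (pw j z \<odot> a')"
        using z(1) \<eta> n(1) by (intro bexI[of _ z] exI[of _ "\<eta> / n"]) auto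
    qed
    then show False using nd by blast
  qed
qed

end

theorem corollary2:
  fixes \<C> :: "'a top_semigroup set"
    and K :: "'a topology"
    and m :: "'a \<Rightarrow> 'a \<Rightarrow> 'a"
    and X :: "'a set"
  assumes "\<forall>S\<in>\<C>. topological_semigroup S"
    and "\<forall>S. zero_discrete S \<and> Hausdorff_semigroup S \<longrightarrow> S \<in> \<C>"
    and "\<forall>S. compact_Hausdorff_semigroup S \<longrightarrow> S \<in> \<C>"
    and "compact_Hausdorff_semigroup (K, m)"
    and "subsemigroup X (topspace K) m"
    and "injectively_closed \<C> X m"
  shows "(cov meager_sets =o continuum \<longrightarrow> polybounded X m) \<and>
         (cov closed_null_sets =o continuum \<longrightarrow> polyfinite X m)"
proof (cases "X = {}")
  \<comment> \<open>The empty semigroup has no idempotent, but the empty family covers it.\<close>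
  case True
  then have "polybounded X m" unfolding polybounded_def by (intro exI[of _ "{}"]) simp
  moreover have "polyfinite X m" using True unfolding polyfinite_def by (intro exI[of _ 0] exI[of _ "{}"]) simp
  ultimately show ?thesis by blast
next
  case False
  have K: "semigroup_on (topspace K) m" "continuous_map (prod_topology K K) K (\<lambda>(x, y). m x y)"
    "Hausdorff_space K" "compact_space K" using assms(4) by auto
  have X: "X \<subseteq> topspace K" "\<And>x y. x \<in> X \<Longrightarrow> y \<in> X \<Longrightarrow> m x y \<in> X"
    using assms(5) by (auto simp: subsemigroup_def)
  \<comment> \<open>The identity is an injective homomorphism into \<open>K\<close>, so X is closed
    in \<open>K\<close> and hence compact.\<close>
  have "(K, m) \<in> \<C>" using assms(3,4) by blast
  then have "closedin K ((\<lambda>x. x) ` X)"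
    using assms(6) X(1) unfolding injectively_closed_def by fastforce
  then have clo: "closedin K X" by simp
  define T where "T = subtopology K X"
  have tT: "topspace T = X" using X(1) by (auto simp: T_def topspace_subtopology)
  interpret compact_semigroup T m
  proof
    show "compact_space T" unfolding T_def
      using closedin_compact_space[OF K(4) clo] compact_space_subtopology by blast
    show "Hausdorff_space T" unfolding T_def using K(3) Hausdorff_space_subtopology by blast
    show "m x y \<in> topspace T" if "x \<in> topspace T" "y \<in> topspace T" for x y
      using that X(2) by (simp add: tT)
    show "m (m x y) z = m x (m y z)" if "x \<in> topspace T" "y \<in> topspace T" "z \<in> topspace T" for x y z
      using that X(1) K(1) by (simp add: tT semigroup_on_def subset_iff)
    have "prod_topology T T = subtopology (prod_topology K K) (X \<times> X)"
      unfolding T_def by (rule subtopology_Times[symmetric])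
    then show "continuous_map (prod_topology T T) T (\<lambda>(x, y). m x y)"
      unfolding T_def using X(2) continuous_map_from_subtopology[OF K(2), of "X \<times> X"]
      by (auto simp: continuous_map_in_subtopology)
  qed
  obtain e where e: "e \<in> topspace T" "m e e = e"
    "\<And>a. a \<in> topspace T \<Longrightarrow> m a e = a \<Longrightarrow> \<exists>b\<in>topspace T. m b a = e"
    using minimal_idempotent_ex False tT by metis
  interpret kernel_semigroup T m e by unfold_locales (use e in auto)
  show ?thesis
    using polybounded_of_injectively_closed[OF assms(2)] polyfinite_of_injectively_closed[OF assms(2)] assms(6)
    by (simp add: tT)
qed

end
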